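(* For every $\alpha>0$ there exists $n_0\in\mathbb{N}$ such that for all integers $n\geq n_0$ the following holds. If $H=([n],E)$ is a $3$-uniform hypergraph with $d(i,j)\geq \min\left(i,j,\frac{n}{2}\right)+\alpha n$ for all pairs $\{i,j\}\in[n]^{(2)}$, then $H$ contains a tight Hamiltonian cycle.
   Context: A $3$-uniform hypergraph (3-graph) is a pair $(V,E)$ with $E\subseteq V^{(3)}$ (the $3$-element subsets of $V$). Vertices are the integers $[n]=\{1,\dots,n\}$ and are compared as integers. For distinct vertices $v,w$, the pair degree is $d(v,w)=|\{x\in V: \{v,w,x\}\in E\}|$. A tight path of length $\ell$ is a 3-graph on $\ell+2$ distinct vertices $x_1,\dots,x_{\ell+2}$ with edge set $\{x_ix_{i+1}x_{i+2}: i\in[\ell]\}$. A tight cycle of length $\ell\geq 4$ consists of a tight path $x_1,\dots,x_\ell$ together with the edges $x_{\ell-1}x_\ell x_1$ and $x_\ell x_1x_2$. A tight Hamiltonian cycle of $H$ is a tight cycle in $H$ containing all vertices of $H$. *)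

theory Defs
  imports Main "HOL-Analysis.Analysis"
begin

definition three_graph :: "nat set \<Rightarrow> nat set set \<Rightarrow> bool" where
  "three_graph V E \<longleftrightarrow> (\<forall>e\<in>E. e \<subseteq> V \<and> card e = 3)"

definition pair_degree :: "nat set \<Rightarrow> nat set set \<Rightarrow> nat \<Rightarrow> nat \<Rightarrow> nat" where
  "pair_degree V E v w = card {x \<in> V. {v, w, x} \<in> E}"

definition tight_cycle :: "nat set set \<Rightarrow> nat list \<Rightarrow> bool" where
  "tight_cycle E xs \<longleftrightarrow> length xs \<ge> 4 \<and> distinct xs \<and>
     (\<forall>i < length xs. {xs ! i, xs ! ((i + 1) mod length xs), xs ! ((i + 2) mod length xs)} \<in> E)"

definition tight_hamiltonian_cycle :: "nat set \<Rightarrow> nat set set \<Rightarrow> bool" where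
  "tight_hamiltonian_cycle V E \<longleftrightarrow> (\<exists>xs. set xs = V \<and> tight_cycle E xs)"

end

theory Submission
  imports Defs "HOL-Real_Asymp.Real_Asymp"
begin

text \<open>The proof uses the absorption method, with every random choice derandomised. Each step of a tight
  walk can raise the smaller of the last two vertices until both lie in the upper half \<open>W\<close>, where pair
  degrees exceed \<open>n/2\<close>; pairs in \<open>W\<close> are joined by walks in link graphs. A vertex of \<open>W\<close> can be inserted
  into many 5-vertex paths, and a smaller vertex can be exchanged for a larger one, so that boundedly many
  exchanges absorb every vertex. Disjoint absorbers and a small reservoir of connecting tuples
  are selected by a potential function argument.

  The rest is tiled by tight paths of bounded length. Given vertex weights of nonpositive total,
  the degree condition yields many edges of almost nonpositive weight, hence a tight path consisting of such
  edges. Removing such paths one by one for multiplicative weights that record the discrepancy of all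
  neighbourhoods and initial segments, the remaining vertices inherit the degree condition until few
  are left. The paths are closed to a cycle through the reservoir, and the leftover is absorbed.\<close>

section \<open>Counting tuples\<close>

text \<open>The degree bound depends on the labels: a pair with a small vertex may have degree
  little more than \<alpha>n, and two such neighbourhoods may be disjoint. Only pairs inside
  \<open>W\<close> have neighbourhoods that are forced to intersect, which is why connections and
  insertions are arranged there and why a small vertex is exchanged upwards instead of being
  inserted. After vertices are removed, labels no longer tell how many vertices lie below; ranks
  within the remainder do. Hence initial segments are balanced together with neighbourhoods, and the
  condition inherited by the remainder compares degrees with ranks. The statement about weights is
  the dual of a fractional tiling; multiplicative weights turn it into an actual one without a
  regularity partition. The constants depend on each other in the order \<mu> (absorbers), \<nu>
  (reservoir), \<eta> (leftover), \<open>m\<close> (path length): the absorbers must outnumber the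
  total level of all that the reservoir and the tiling leave uncovered, and the paths must be long
  enough for the reservoir to join them all.\<close>

definition tuples :: "'a set \<Rightarrow> nat \<Rightarrow> 'a list set" where
  "tuples V k = {t. set t \<subseteq> V \<and> length t = k}"

text \<open>Counting all lists, repetitions included, and normalising by the full power makes
  densities multiply under concatenation and invariant under reordering; \<open>many_good\<close>
  restores distinctness afterwards.\<close>

definition many :: "'a set \<Rightarrow> real \<Rightarrow> nat \<Rightarrow> ('a list \<Rightarrow> bool) \<Rightarrow> bool" where
  "many V c k P \<longleftrightarrow> c * real (card V) ^ k \<le> real (card {t \<in> tuples V k. P t})"

lemma finite_tuples: "finite V \<Longrightarrow> finite (tuples V k)"
  unfolding tuples_def by (rule finite_lists_length_eq)

lemma card_tuples: "finite V \<Longrightarrow> card (tuples V k) = card V ^ k"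
  unfolding tuples_def by (rule card_lists_length_eq)

lemma many_mono:
  assumes "finite V" "many V c k P" "\<And>t. t \<in> tuples V k \<Longrightarrow> P t \<Longrightarrow> Q t" "d \<le> c"
  shows "many V d k Q"
proof -
  have "d * real (card V) ^ k \<le> c * real (card V) ^ k"
    using assms(4) by (intro mult_right_mono) auto
  also have "\<dots> \<le> real (card {t \<in> tuples V k. P t})"
    using assms(2) by (simp add: many_def)
  also have "\<dots> \<le> real (card {t \<in> tuples V k. Q t})"
    using assms(1,3) by (auto intro!: card_mono simp: finite_tuples)
  finally show ?thesis by (simp add: many_def)
qed

lemma many_Nil:
  assumes "P []" "c \<le> 1"
  shows "many V c 0 P"
proof -
  have "{t \<in> tuples V 0. P t} = {[]}"
    using assms by (auto simp: tuples_def)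
  thus ?thesis using assms by (simp add: many_def)
qed

lemma card_Sigma_ge:
  assumes "finite A" "\<And>x. x \<in> A \<Longrightarrow> finite (B x)" "\<And>x. x \<in> A \<Longrightarrow> b \<le> real (card (B x))"
  shows "real (card A) * b \<le> real (card (Sigma A B))"
proof -
  have "real (card A) * b = (\<Sum>x\<in>A. b)" by simp
  also have "\<dots> \<le> (\<Sum>x\<in>A. real (card (B x)))" by (intro sum_mono assms)
  also have "\<dots> = real (card (Sigma A B))"
    using assms by (subst card_SigmaI) auto
  finally show ?thesis .
qed

lemma many_append:
  assumes "finite V" "many V c k P" "0 \<le> d"
    and Q: "\<And>s. s \<in> tuples V k \<Longrightarrow> P s \<Longrightarrow> many V d l (Q s)"
  shows "many V (c * d) (k + l) (\<lambda>t. P (take k t) \<and> Q (take k t) (drop k t))"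
proof -
  let ?A = "{s \<in> tuples V k. P s}"
  let ?B = "\<lambda>s. {t \<in> tuples V l. Q s t}"
  let ?C = "{t \<in> tuples V (k + l). P (take k t) \<and> Q (take k t) (drop k t)}"
  have fin: "finite ?A" "\<And>s. finite (?B s)" using assms(1) by (auto simp: finite_tuples)
  have "c * d * real (card V) ^ (k + l) = c * real (card V) ^ k * (d * real (card V) ^ l)"
    by (simp add: power_add)
  also have "\<dots> \<le> real (card ?A) * (d * real (card V) ^ l)"
    using assms(2,3) by (intro mult_right_mono) (auto simp: many_def)
  also have "\<dots> \<le> real (card (Sigma ?A ?B))"
    using fin Q by (intro card_Sigma_ge) (auto simp: many_def)
  also have "\<dots> = real (card ((\<lambda>(s, t). s @ t) ` Sigma ?A ?B))"
    by (subst card_image) (auto simp: inj_on_def tuples_def)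
  also have "\<dots> \<le> real (card ?C)"
    using assms(1) by (intro of_nat_mono card_mono) (auto simp: finite_tuples, auto simp: tuples_def)
  finally show ?thesis by (simp add: many_def)
qed

lemma many_Cons:
  assumes "finite V" "c * real (card V) \<le> real (card X)" "X \<subseteq> V" "0 \<le> d"
    and "\<And>x. x \<in> X \<Longrightarrow> many V d k (\<lambda>t. P (x # t))"
  shows "many V (c * d) (Suc k) P"
proof -
  let ?B = "\<lambda>x. {t \<in> tuples V k. P (x # t)}"
  have fin: "finite X" "\<And>s. finite (?B s)"
    using assms(1,3) by (auto simp: finite_tuples finite_subset)
  have "c * d * real (card V) ^ Suc k = c * real (card V) * (d * real (card V) ^ k)"
    by simp
  also have "\<dots> \<le> real (card X) * (d * real (card V) ^ k)"
    using assms(2,4) by (intro mult_right_mono) auto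
  also have "\<dots> \<le> real (card (Sigma X ?B))"
    using fin assms(5) by (intro card_Sigma_ge) (auto simp: many_def)
  also have "\<dots> = real (card ((\<lambda>(x, t). x # t) ` Sigma X ?B))"
    by (subst card_image) (auto simp: inj_on_def)
  also have "\<dots> \<le> real (card {t \<in> tuples V (Suc k). P t})"
    using assms(1,3) by (intro of_nat_mono card_mono) (auto simp: finite_tuples, auto simp: tuples_def)
  finally show ?thesis by (simp add: many_def)
qed

lemma many_inj:
  assumes "finite V" "many V c k P" "inj_on f (tuples V k)" "f ` tuples V k \<subseteq> tuples V k"
    and "\<And>t. t \<in> tuples V k \<Longrightarrow> P t \<Longrightarrow> Q (f t)"
  shows "many V c k Q"
proof -
  let ?S = "{t \<in> tuples V k. P t}"
  have inj: "inj_on f ?S"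
    using assms(3) by (rule inj_on_subset) auto
  have "c * real (card V) ^ k \<le> real (card ?S)" using assms(2) by (simp add: many_def)
  also have "\<dots> = real (card (f ` ?S))" using inj by (simp add: card_image)
  also have "f ` ?S \<subseteq> {t \<in> tuples V k. Q t}"
    using assms(4,5) by auto
  hence "real (card (f ` ?S)) \<le> real (card {t \<in> tuples V k. Q t})"
    using assms(1) by (intro of_nat_mono card_mono) (auto simp: finite_tuples)
  finally show ?thesis by (simp add: many_def)
qed

text \<open>The two conditions on \<open>js\<close> force it to be a permutation. Its use is to
  bring the coordinate to be copied to the front, where \<open>many_dup\<close> acts.\<close>

lemma many_perm:
  assumes "finite V" "many V c k P" "set js = {..<k}" "length js = k"
    and "\<And>t. t \<in> tuples V k \<Longrightarrow> P t \<Longrightarrow> Q (map ((!) t) js)"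
  shows "many V c k Q"
proof (rule many_inj[OF assms(1,2), where f = "\<lambda>t. map ((!) t) js"])
  show "inj_on (\<lambda>t. map ((!) t) js) (tuples V k)"
    using assms(3) by (auto simp: inj_on_def tuples_def intro!: nth_equalityI)
  show "(\<lambda>t. map ((!) t) js) ` tuples V k \<subseteq> tuples V k"
    using assms(3,4) by (auto simp: tuples_def subset_iff)
qed (rule assms(5))

text \<open>Cauchy-Schwarz: if \<open>?A s\<close> are the heads that fit the tail \<open>s\<close>,
  tuples with two independent heads are counted by the squares of \<open>card (?A s)\<close>. A
  dense pattern thus stays dense when a vertex gets a second copy, which later lets a walk that
  revisits a vertex become a path.\<close>

lemma many_dup:
  assumes "finite V" "many V c l P" "0 \<le> c" "V \<noteq> {}" "0 < l"
  shows "many V (c\<^sup>2) (Suc l) (\<lambda>t. P (t ! 0 # drop 2 t) \<and> P (t ! 1 # drop 2 t))"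
proof -
  obtain k where l: "l = Suc k" using assms(5) gr0_implies_Suc by blast
  let ?n = "real (card V)"
  let ?A = "\<lambda>s. {x \<in> V. P (x # s)}"
  have n: "?n > 0" using assms by (simp add: card_gt_0_iff)
  have finA: "finite (?A s)" for s using assms(1) by simp
  let ?I1 = "(\<lambda>(s, x). x # s) ` (SIGMA s:tuples V k. ?A s)"
  let ?I2 = "(\<lambda>(s, x, y). x # y # s) ` (SIGMA s:tuples V k. ?A s \<times> ?A s)"
  have I1: "{t \<in> tuples V (Suc k). P t} = ?I1"
  proof (intro set_eqI iffI)
    fix t assume "t \<in> {t \<in> tuples V (Suc k). P t}"
    thus "t \<in> ?I1" by (cases t) (force simp: tuples_def)+
  qed (auto simp: tuples_def)
  have c1: "real (card {t \<in> tuples V (Suc k). P t}) = (\<Sum>s\<in>tuples V k. real (card (?A s)))"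
    unfolding I1 using assms(1)
    by (subst card_image) (auto simp: inj_on_def finite_tuples)
  have "real (card ?I2) = (\<Sum>s\<in>tuples V k. (real (card (?A s)))\<^sup>2)"
    using assms(1)
    by (subst card_image) (auto simp: inj_on_def finite_tuples card_cartesian_product power2_eq_square)
  moreover have "?I2 \<subseteq> {t \<in> tuples V (Suc (Suc k)). P (t ! 0 # drop 2 t) \<and> P (t ! 1 # drop 2 t)}"
    by (auto simp: tuples_def numeral_2_eq_2)
  hence "card ?I2 \<le> card {t \<in> tuples V (Suc (Suc k)). P (t ! 0 # drop 2 t) \<and> P (t ! 1 # drop 2 t)}"
    using assms(1) by (intro card_mono) (auto simp: finite_tuples)
  ultimately have c2: "(\<Sum>s\<in>tuples V k. (real (card (?A s)))\<^sup>2)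
      \<le> real (card {t \<in> tuples V (Suc (Suc k)). P (t ! 0 # drop 2 t) \<and> P (t ! 1 # drop 2 t)})"
    by linarith
  have "(c * ?n ^ Suc k)\<^sup>2 \<le> (\<Sum>s\<in>tuples V k. real (card (?A s)))\<^sup>2"
    using assms(2,3) n unfolding many_def l c1 by (intro power_mono) auto
  also have "\<dots> \<le> ?n ^ k * (\<Sum>s\<in>tuples V k. (real (card (?A s)))\<^sup>2)"
    using sum_squared_le_sum_of_squares[of "\<lambda>s. real (card (?A s))" "tuples V k"] assms(1)
    by (simp add: card_tuples mult.commute)
  also have "\<dots> \<le> ?n ^ k * real (card {t \<in> tuples V (Suc (Suc k)). P (t ! 0 # drop 2 t) \<and> P (t ! 1 # drop 2 t)})"
    using n by (intro mult_left_mono c2) auto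
  also have "(c * ?n ^ Suc k)\<^sup>2 = ?n ^ k * (c\<^sup>2 * ?n ^ Suc (Suc k))"
    by (simp add: power2_eq_square algebra_simps)
  finally show ?thesis using n by (simp add: many_def l del: power_Suc)
qed

lemma bad_tuples:
  assumes "finite V" "finite X"
  shows "card {t \<in> tuples V k. \<not> (distinct t \<and> set t \<inter> X = {})} * card V \<le> k * (card X + k) * card V ^ k"
proof (induction k)
  case 0
  have *: "{t \<in> tuples V 0. \<not> (distinct t \<and> set t \<inter> X = {})} = {}" by (auto simp: tuples_def)
  thus ?case unfolding * by simp
next
  case (Suc k)
  let ?bad = "\<lambda>k. {t \<in> tuples V k. \<not> (distinct t \<and> set t \<inter> X = {})}"
  let ?n = "card V"
  have "?bad (Suc k) \<subseteq> (\<lambda>(x, t). x # t) ` (V \<times> ?bad k) \<union> (\<lambda>(t, x). x # t) ` (SIGMA t:tuples V k. X \<union> set t)"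
  proof
    fix t assume t: "t \<in> ?bad (Suc k)"
    then obtain x s where xs: "t = x # s" by (cases t) (auto simp: tuples_def)
    show "t \<in> (\<lambda>(x, t). x # t) ` (V \<times> ?bad k) \<union> (\<lambda>(t, x). x # t) ` (SIGMA t:tuples V k. X \<union> set t)"
      using t xs by (force simp: tuples_def)
  qed
  hence "card (?bad (Suc k)) \<le> card ((\<lambda>(x, t). x # t) ` (V \<times> ?bad k) \<union> (\<lambda>(t, x). x # t) ` (SIGMA t:tuples V k. X \<union> set t))"
    using assms by (intro card_mono) (auto simp: finite_tuples)
  also have "\<dots> \<le> card ((\<lambda>(x, t). x # t) ` (V \<times> ?bad k)) + card ((\<lambda>(t, x). x # t) ` (SIGMA t:tuples V k. X \<union> set t))"
    by (rule card_Un_le)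
  also have "\<dots> \<le> card (V \<times> ?bad k) + card (SIGMA t:tuples V k. X \<union> set t)"
    using assms by (intro add_mono card_image_le) (auto simp: finite_tuples)
  also have "card (V \<times> ?bad k) = card (?bad k) * ?n" by (simp add: card_cartesian_product)
  also have "card (SIGMA t:tuples V k. X \<union> set t) = (\<Sum>t\<in>tuples V k. card (X \<union> set t))"
    using assms by (subst card_SigmaI) (auto simp: finite_tuples)
  also have "\<dots> \<le> (\<Sum>t\<in>tuples V k. card X + k)"
  proof (intro sum_mono)
    fix t assume "t \<in> tuples V k"
    hence "card (set t) \<le> k" using card_length[of t] by (simp add: tuples_def)
    thus "card (X \<union> set t) \<le> card X + k" using card_Un_le[of X "set t"] by linarith
  qed
  also have "\<dots> = (card X + k) * ?n ^ k" using assms by (simp add: card_tuples)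
  also have "card (?bad k) * ?n \<le> k * (card X + k) * ?n ^ k" by (rule Suc)
  finally have "card (?bad (Suc k)) \<le> (k * (card X + k) + (card X + k)) * ?n ^ k"
    by (simp add: algebra_simps)
  also have "\<dots> \<le> (Suc k * (card X + Suc k)) * ?n ^ k"
    by (intro mult_right_mono) auto
  finally have "card (?bad (Suc k)) * ?n \<le> (Suc k * (card X + Suc k)) * ?n ^ k * ?n"
    by (rule mult_right_mono) simp
  thus ?case by (simp add: algebra_simps)
qed

lemma many_good:
  assumes "finite V" "V \<noteq> {}" "finite X" "many V c k P"
    and "real k * (real (card X) + real k) \<le> c / 2 * real (card V)"
  shows "many V (c / 2) k (\<lambda>t. P t \<and> distinct t \<and> set t \<inter> X = {})"
proof -
  let ?n = "real (card V)"
  let ?B = "{t \<in> tuples V k. \<not> (distinct t \<and> set t \<inter> X = {})}"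
  let ?G = "{t \<in> tuples V k. P t \<and> distinct t \<and> set t \<inter> X = {}}"
  have n: "?n > 0" using assms by (simp add: card_gt_0_iff)
  have "real (card ?B) * ?n \<le> real k * (real (card X) + real k) * ?n ^ k"
    using bad_tuples[OF assms(1,3), of k]
    by (metis (no_types, lifting) of_nat_add of_nat_le_iff of_nat_mult of_nat_power)
  also have "\<dots> \<le> (c / 2 * ?n) * ?n ^ k" by (intro mult_right_mono assms(5)) auto
  finally have "real (card ?B) * ?n \<le> (c / 2 * ?n ^ k) * ?n" by (simp add: algebra_simps)
  hence B: "real (card ?B) \<le> c / 2 * ?n ^ k" using n by (simp add: mult_le_cancel_right)
  have "{t \<in> tuples V k. P t} \<subseteq> ?G \<union> ?B" by auto
  hence "card {t \<in> tuples V k. P t} \<le> card (?G \<union> ?B)"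
    using assms(1) by (intro card_mono) (auto simp: finite_tuples)
  also have "\<dots> \<le> card ?G + card ?B" by (rule card_Un_le)
  finally have "real (card {t \<in> tuples V k. P t}) \<le> real (card ?G) + real (card ?B)" by linarith
  moreover have "c * ?n ^ k \<le> real (card {t \<in> tuples V k. P t})" using assms(4) by (simp add: many_def)
  ultimately show ?thesis using B by (simp add: many_def)
qed

section \<open>Tight walks and the degree condition\<close>

fun tw :: "nat set set \<Rightarrow> nat list \<Rightarrow> bool" where
  "tw E (x # y # z # xs) \<longleftrightarrow> {x, y, z} \<in> E \<and> tw E (y # z # xs)"
| "tw E xs \<longleftrightarrow> True"

lemma tw_iff: "tw E xs \<longleftrightarrow> (\<forall>i. i + 2 < length xs \<longrightarrow> {xs ! i, xs ! (i + 1), xs ! (i + 2)} \<in> E)"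
proof (induction E xs rule: tw.induct)
  case (1 E x y z xs)
  have "(\<forall>i. i + 2 < length (x # y # z # xs) \<longrightarrow> {(x # y # z # xs) ! i, (x # y # z # xs) ! (i + 1), (x # y # z # xs) ! (i + 2)} \<in> E)
    \<longleftrightarrow> {x, y, z} \<in> E \<and> (\<forall>i. i + 2 < length (y # z # xs) \<longrightarrow> {(y # z # xs) ! i, (y # z # xs) ! (i + 1), (y # z # xs) ! (i + 2)} \<in> E)"
    (is "(\<forall>i. ?P i) \<longleftrightarrow> ?R \<and> (\<forall>i. ?Q i)")
  proof -
    have "?P 0 \<longleftrightarrow> ?R" by simp
    moreover have "?P (Suc i) \<longleftrightarrow> ?Q i" for i by simp
    ultimately show ?thesis by (metis not0_implies_Suc)
  qed
  thus ?case using 1 by simp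
qed auto

lemma tw_rev [simp]: "tw E (rev xs) \<longleftrightarrow> tw E xs"
proof -
  have *: "tw E (rev xs)" if "tw E xs" for xs
    unfolding tw_iff
  proof (intro allI impI)
    fix i assume i: "i + 2 < length (rev xs)"
    define j where "j = length xs - i - 3"
    have "{xs ! j, xs ! (j + 1), xs ! (j + 2)} \<in> E"
      using that i unfolding tw_iff j_def by auto
    moreover have "rev xs ! i = xs ! (j + 2)" "rev xs ! (i + 1) = xs ! (j + 1)" "rev xs ! (i + 2) = xs ! j"
      using i by (auto simp: rev_nth j_def intro!: arg_cong[of _ _ "nth xs"])
    ultimately show "{rev xs ! i, rev xs ! (i + 1), rev xs ! (i + 2)} \<in> E"
      by (simp add: insert_commute)
  qed
  show ?thesis using *[of xs] *[of "rev xs"] by auto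
qed

lemma tw_join: "tw E (xs @ a # b # ys) \<longleftrightarrow> tw E (xs @ [a, b]) \<and> tw E (a # b # ys)"
proof (induction xs)
  case Nil
  show ?case by (cases ys) auto
next
  case (Cons x xs)
  show ?case
  proof (cases xs)
    case Nil thus ?thesis by (cases ys) auto
  next
    case xs: (Cons c r)
    show ?thesis
    proof (cases r)
      case Nil thus ?thesis using xs Cons by auto
    next
      case (Cons d r')
      thus ?thesis using xs Cons.IH by auto
    qed
  qed
qed

lemma tw_appendD1:
  assumes "tw E (xs @ ys)"
  shows "tw E xs"
  unfolding tw_iff
proof (intro allI impI)
  fix i assume i: "i + 2 < length xs"
  hence "{(xs @ ys) ! i, (xs @ ys) ! (i + 1), (xs @ ys) ! (i + 2)} \<in> E"
    using assms unfolding tw_iff by simp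
  thus "{xs ! i, xs ! (i + 1), xs ! (i + 2)} \<in> E" using i by (simp add: nth_append)
qed

lemma tw_appendD2: "tw E (xs @ ys) \<Longrightarrow> tw E ys"
  using tw_appendD1[of E "rev ys" "rev xs"] by (metis rev_append tw_rev)

section \<open>Degrees above a label threshold\<close>

lemma card_below: "real (card {z \<in> {1..n}. real z < \<tau>}) \<le> max 0 \<tau>"
proof -
  have "{z \<in> {1..n}. real z < \<tau>} \<subseteq> {1..nat \<lfloor>\<tau>\<rfloor>}"
    by (auto simp: le_nat_floor)
  hence "card {z \<in> {1..n}. real z < \<tau>} \<le> nat \<lfloor>\<tau>\<rfloor>"
    by (metis card_atLeastAtMost card_mono diff_Suc_1 finite_atLeastAtMost)
  moreover have "real (nat \<lfloor>\<tau>\<rfloor>) \<le> max 0 \<tau>" by linarith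
  ultimately show ?thesis by linarith
qed

lemma card_Int_ge:
  assumes "finite V" "A \<subseteq> V" "B \<subseteq> V"
  shows "real (card A) + real (card B) - real (card V) \<le> real (card (A \<inter> B))"
proof -
  have "card A + card B = card (A \<union> B) + card (A \<inter> B)"
    using assms by (intro card_Un_Int) (auto intro: finite_subset)
  moreover have "card (A \<union> B) \<le> card V" using assms by (intro card_mono) auto
  ultimately show ?thesis by linarith
qed

text \<open>The bound \<alpha> \<le> 1/4 loses nothing, since the degree condition for \<alpha>
  implies it for every smaller value; it leaves room in \<open>W\<close> for discarding a few
  vertices.\<close>

locale posa_graph =
  fixes n :: nat and E :: "nat set set" and \<alpha> :: real
  assumes graph: "three_graph {1..n} E"
    and \<alpha>: "0 < \<alpha>" "\<alpha> \<le> 1 / 4"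
    and degree: "\<And>i j. i \<in> {1..n} \<Longrightarrow> j \<in> {1..n} \<Longrightarrow> i \<noteq> j \<Longrightarrow>
      real (pair_degree {1..n} E i j) \<ge> min (min (real i) (real j)) (real n / 2) + \<alpha> * real n"
begin

abbreviation V :: "nat set" where "V \<equiv> {1..n}"

definition N :: "nat \<Rightarrow> nat \<Rightarrow> nat set" where
  "N x y = {z \<in> V. {x, y, z} \<in> E}"

lemma N_subset: "N x y \<subseteq> V" by (auto simp: N_def)

lemma finite_N [simp]: "finite (N x y)" by (simp add: N_def)

lemma edgeD:
  assumes "{x, y, z} \<in> E"
  shows "x \<noteq> y" "y \<noteq> z" "x \<noteq> z" "x \<in> V" "y \<in> V" "z \<in> V"
proof -
  have *: "card {x, y, z} = 3" "{x, y, z} \<subseteq> V"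
    using assms graph by (auto simp: three_graph_def)
  show "x \<in> V" "y \<in> V" "z \<in> V" using * by auto
  show "x \<noteq> y" "y \<noteq> z" "x \<noteq> z" using *(1) by (auto simp: card_insert_if split: if_splits)
qed

lemma N_D:
  assumes "z \<in> N x y"
  shows "x \<noteq> y" "y \<noteq> z" "x \<noteq> z" "x \<in> V" "y \<in> V" "z \<in> V" "{x, y, z} \<in> E"
  using assms edgeD[of x y z] by (auto simp: N_def)

lemma N_degree:
  assumes "x \<in> V" "y \<in> V" "x \<noteq> y"
  shows "min (min (real x) (real y)) (real n / 2) + \<alpha> * real n \<le> real (card (N x y))"
  using degree[OF assms] by (simp add: pair_degree_def N_def)

text \<open>At most \<tau> labels lie below \<tau>, so the excess of the degree over \<tau> survives
  as neighbours of large label. This drives both the climb to \<open>W\<close> and the exchange of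
  small vertices.\<close>

lemma N_above:
  assumes "x \<in> V" "y \<in> V" "x \<noteq> y" "0 \<le> \<tau>"
  shows "min (min (real x) (real y)) (real n / 2) + \<alpha> * real n - \<tau> \<le> real (card {z \<in> N x y. \<tau> \<le> real z})"
proof -
  have "N x y \<subseteq> {z \<in> N x y. \<tau> \<le> real z} \<union> {z \<in> V. real z < \<tau>}"
    using N_subset by fastforce
  hence "card (N x y) \<le> card {z \<in> N x y. \<tau> \<le> real z} + card {z \<in> V. real z < \<tau>}"
    by (intro order.trans[OF card_mono card_Un_le]) auto
  thus ?thesis using N_degree[OF assms(1-3)] card_below[of n \<tau>] assms(4) by linarith
qed

definition W :: "nat set" where "W = {x \<in> V. real n / 2 \<le> real x}"

lemma card_W: "real n / 2 \<le> real (card W)"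
proof -
  have "V \<subseteq> W \<union> {z \<in> V. real z < real n / 2}" by (auto simp: W_def)
  hence "card V \<le> card W + card {z \<in> V. real z < real n / 2}"
    by (intro order.trans[OF card_mono card_Un_le]) (auto simp: W_def)
  thus ?thesis using card_below[of n "real n / 2"] by simp
qed

lemma N_W:
  assumes "x \<in> W" "y \<in> W" "x \<noteq> y"
  shows "real n / 2 + \<alpha> * real n \<le> real (card (N x y))"
  using N_degree[of x y] assms by (auto simp: W_def min_def split: if_splits)

lemma N_int_W:
  assumes "x \<in> W" "y \<in> W" "x \<noteq> y"
  shows "\<alpha> * real n \<le> real (card (N x y \<inter> W))"
proof -
  have "N x y \<inter> W = {z \<in> N x y. real n / 2 \<le> real z}" using N_D(6) by (fastforce simp: W_def)
  thus ?thesis using N_above[of x y "real n / 2"] assms by (auto simp: W_def min_def split: if_splits)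
qed

text \<open>Both neighbourhoods exceed half of \<open>V\<close> by \<alpha>n, hence overlap. This is
  the reason for singling out \<open>W\<close>.\<close>

lemma N_int_N:
  assumes "x \<in> W" "y \<in> W" "x \<noteq> y" "z \<in> W" "w \<in> W" "z \<noteq> w"
  shows "\<alpha> * real n \<le> real (card (N x y \<inter> N z w))"
proof -
  have "\<alpha> * real n \<ge> 0" using \<alpha> by simp
  thus ?thesis
    using card_Int_ge[of V "N x y" "N z w"] N_W[OF assms(1-3)] N_W[OF assms(4-6)] N_subset by auto
qed

text \<open>Two steps of a tight walk can be chosen to raise the smaller of the last two vertices by
  \<open>\<alpha>n/2\<close>.\<close>

lemma reach_W:
  assumes "a \<in> V" "b \<in> V" "a \<noteq> b"
    and "real n / 2 - real j * (\<alpha> / 2 * real n) \<le> min (real a) (real b)"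
  shows "many V ((\<alpha> / 2) ^ (2 * j)) (2 * j)
    (\<lambda>t. tw E (a # b # t) \<and> (\<exists>r x y. a # b # t = r @ [x, y] \<and> x \<in> W \<and> y \<in> W \<and> x \<noteq> y))"
  using assms
proof (induction j arbitrary: a b)
  case 0
  hence "a \<in> W" "b \<in> W" by (auto simp: W_def)
  thus ?case using 0 by (auto intro!: many_Nil)
next
  case (Suc j)
  define d where "d = \<alpha> / 2 * real n"
  have d: "d \<ge> 0" using \<alpha> by (simp add: d_def)
  have d2: "\<alpha> * real n = 2 * d" by (simp add: d_def)
  define m where "m = min (min (real a) (real b)) (real n / 2)"
  \<comment> \<open>The degree excess is \<open>2 * d\<close>: one half raises the threshold from
    \<open>m\<close> to \<sigma>, the other half is the number of choices that remain. The cap at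
    n/2 is the target of the climb.\<close>
  define \<sigma> where "\<sigma> = min (m + d) (real n / 2)"
  have \<sigma>: "0 \<le> \<sigma>" "m \<le> \<sigma>" "\<sigma> \<le> m + d" using d by (auto simp: m_def \<sigma>_def)
  let ?P = "\<lambda>a b t. tw E (a # b # t) \<and> (\<exists>r x y. a # b # t = r @ [x, y] \<and> x \<in> W \<and> y \<in> W \<and> x \<noteq> y)"
  have one: "d \<le> real (card {z \<in> N x y. \<sigma> \<le> real z})" if "x \<in> V" "y \<in> V" "x \<noteq> y" "m \<le> real x" "m \<le> real y" for x y
    using N_above[OF that(1-3) \<sigma>(1)] that d2 \<sigma> unfolding m_def by linarith
  have "many V ((\<alpha> / 2) * ((\<alpha> / 2) * (\<alpha> / 2) ^ (2 * j))) (Suc (Suc (2 * j))) (?P a b)"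
  proof (rule many_Cons)
    show "\<alpha> / 2 * real (card V) \<le> real (card {z \<in> N a b. \<sigma> \<le> real z})"
      using one[of a b] Suc.prems by (auto simp: d_def m_def)
    fix c assume c: "c \<in> {z \<in> N a b. \<sigma> \<le> real z}"
    hence c': "c \<in> V" "b \<noteq> c" "{a, b, c} \<in> E" "\<sigma> \<le> real c" using N_D[of c a b] by auto
    \<comment> \<open>The pair \<open>b\<close>, \<open>c\<close> may still have minimum
      \<open>m\<close> because of \<open>b\<close>; the next vertex pushes \<open>b\<close> out, and
      then both last vertices are at least \<sigma>.\<close>
    show "many V (\<alpha> / 2 * (\<alpha> / 2) ^ (2 * j)) (Suc (2 * j)) (\<lambda>t. ?P a b (c # t))"
    proof (rule many_Cons)
      show "\<alpha> / 2 * real (card V) \<le> real (card {z \<in> N b c. \<sigma> \<le> real z})"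
        using one[of b c] Suc.prems c' \<sigma> by (auto simp: d_def m_def)
      fix e assume e: "e \<in> {z \<in> N b c. \<sigma> \<le> real z}"
      hence e': "e \<in> V" "c \<noteq> e" "{b, c, e} \<in> E" "\<sigma> \<le> real e" using N_D[of e b c] by auto
      have "real n / 2 - real j * (\<alpha> / 2 * real n) \<le> \<sigma>"
      proof -
        have "real n / 2 - real (Suc j) * d \<le> m"
          using Suc.prems(4) d by (auto simp: m_def d_def min_def)
        moreover have "real (Suc j) * d = real j * d + d" by (simp add: algebra_simps)
        moreover have "real j * d \<ge> 0" using d by simp
        ultimately show ?thesis unfolding \<sigma>_def d_def[symmetric] by linarith
      qed
      hence "many V ((\<alpha> / 2) ^ (2 * j)) (2 * j) (?P c e)"
        using c' e' by (intro Suc.IH) auto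
      thus "many V ((\<alpha> / 2) ^ (2 * j)) (2 * j) (\<lambda>t. ?P a b (c # e # t))"
      proof (rule many_mono[rotated])
        fix t assume "?P c e t"
        then obtain r x y where "tw E (c # e # t)" "c # e # t = r @ [x, y]" "x \<in> W" "y \<in> W" "x \<noteq> y"
          by blast
        moreover have "tw E (a # b # c # e # t)" using \<open>tw E (c # e # t)\<close> c' e' by simp
        moreover have "a # b # c # e # t = (a # b # r) @ [x, y]" using \<open>c # e # t = r @ [x, y]\<close> by simp
        ultimately show "?P a b (c # e # t)" by blast
      qed auto
    qed (use N_subset \<alpha> in auto)
  qed (use N_subset \<alpha> in auto)
  thus ?case by simp
qed

end

section \<open>Connecting pairs\<close>

text \<open>Each double step gains \<alpha>n/2, so 1/\<alpha> of them are enough to climb to n/2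
  from anywhere.\<close>

definition reach_len :: "real \<Rightarrow> nat" where
  "reach_len \<alpha> = nat \<lceil>1 / \<alpha>\<rceil>"

definition con_len :: "real \<Rightarrow> nat" where
  "con_len \<alpha> = 4 * reach_len \<alpha> + 10"

text \<open>Two climbs of \<open>2 * reach_len \<alpha>\<close> vertices each and a bridge of ten.
  The exponent 56 is 7 times 8: seven choices of density \<alpha>, squared by each of three
  duplications.\<close>

definition con_dens :: "real \<Rightarrow> real" where
  "con_dens \<alpha> = (\<alpha> / 2) ^ (2 * reach_len \<alpha>) * ((\<alpha> / 2) ^ (2 * reach_len \<alpha>) * \<alpha> ^ 56)"

lemma con_len_pos: "0 < con_len \<alpha>" by (simp add: con_len_def)

lemma con_dens_pos: "0 < \<alpha> \<Longrightarrow> 0 < con_dens \<alpha>" by (simp add: con_dens_def)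

lemma con_dens_le_1: "0 < \<alpha> \<Longrightarrow> \<alpha> \<le> 1 \<Longrightarrow> con_dens \<alpha> \<le> 1"
  unfolding con_dens_def by (intro mult_le_one power_le_one mult_nonneg_nonneg zero_le_power) auto

context posa_graph
begin

text \<open>In the link graph of \<open>v\<close> there is a walk \<open>a b p3 p4 p q\<close>, and in that of \<open>v'\<close> a walk
  \<open>q p s x y\<close>; inserting \<open>v\<close>, respectively \<open>v'\<close>, after every second vertex turns them into one tight
  walk. Copies of \<open>v\<close>, \<open>v'\<close>, \<open>p\<close> make its vertices distinct for most choices.\<close>

lemma connect_W:
  assumes ab: "a \<in> W" "b \<in> W" "a \<noteq> b" and xy: "x \<in> W" "y \<in> W" "x \<noteq> y"
    and n: "16 \<le> n"
  shows "many V (\<alpha> ^ 56) 10 (\<lambda>t. tw E (a # b # t @ [x, y]))"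
proof -
  have \<alpha>0: "0 \<le> \<alpha>" using \<alpha> by simp
  have fin: "finite V" by simp
  have Vne: "V \<noteq> {}" using n by auto
  \<comment> \<open>In terms of links: \<open>a b\<close>, \<open>b p3\<close>,
    \<open>p3 p4\<close>, \<open>p4 p\<close>, \<open>p q\<close> are edges in the link of
    \<open>v\<close>, and \<open>q p\<close>, \<open>p s\<close>, \<open>s x\<close>,
    \<open>x y\<close> in that of \<open>v'\<close>. At the common edge \<open>p q\<close> the walk
    changes from \<open>v\<close> to \<open>v'\<close>.\<close>
  define C where "C v v' p q p3 p4 s \<longleftrightarrow>
     v \<in> N a b \<and> v' \<in> N x y \<and> q \<in> N v p \<and> q \<in> N v' p \<and> p3 \<in> N v b \<and>
     p4 \<in> N v p3 \<and> p4 \<in> N v p \<and> s \<in> N v' p \<and> s \<in> N v' x" for v v' p q p3 p4 s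
  define C' where "C' t \<longleftrightarrow> C (t!0) (t!1) (t!2) (t!3) (t!4) (t!5) (t!6)" for t
  have "many V (\<alpha> * (\<alpha> * (\<alpha> * (\<alpha> * (\<alpha> * (\<alpha> * (\<alpha> * 1))))))) (Suc (Suc (Suc (Suc (Suc (Suc (Suc 0))))))) C'"
  proof (rule many_Cons[OF fin, where X = "N a b \<inter> W"], goal_cases)
    case (4 v)
    hence v: "v \<in> N a b" "v \<in> W" by auto
    have [simp]: "v \<noteq> b" "b \<noteq> v" using N_D[OF v(1)] by auto
    show ?case
    proof (rule many_Cons[OF fin, where X = "N x y \<inter> W"], goal_cases)
      case (4 v')
      hence v': "v' \<in> N x y" "v' \<in> W" by auto
      have [simp]: "v' \<noteq> x" "x \<noteq> v'" using N_D[OF v'(1)] by auto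
      show ?case
      proof (rule many_Cons[OF fin, where X = "W - {v, v'}"], goal_cases)
        case (4 p)
        hence p: "p \<in> W" "p \<noteq> v" "p \<noteq> v'" by auto
        show ?case
        proof (rule many_Cons[OF fin, where X = "N v p \<inter> N v' p"], goal_cases)
          case (4 q)
          hence q: "q \<in> N v p" "q \<in> N v' p" by auto
          show ?case
          proof (rule many_Cons[OF fin, where X = "N v b \<inter> W"], goal_cases)
            case (4 p3)
            hence p3: "p3 \<in> N v b" "p3 \<in> W" by auto
            have [simp]: "v \<noteq> p3" using N_D[OF p3(1)] by auto
            show ?case
            proof (rule many_Cons[OF fin, where X = "N v p3 \<inter> N v p"], goal_cases)
              case (4 p4)
              hence p4: "p4 \<in> N v p3" "p4 \<in> N v p" by auto
              show ?case
              proof (rule many_Cons[OF fin, where X = "N v' p \<inter> N v' x"], goal_cases)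
                case (4 s)
                hence s: "s \<in> N v' p" "s \<in> N v' x" by auto
                show ?case
                  using v v' q p3 p4 s by (intro many_Nil) (auto simp: C'_def C_def)
              next
                case 1
                show ?case using N_int_N[of v' p v' x] v' p xy by simp
              qed (use N_subset in auto)
            next
              case 1
              show ?case using N_int_N[of v p3 v p] v p3 p by simp
            qed (use N_subset \<alpha>0 in auto)
          next
            case 1
            show ?case using N_int_W[of v b] v ab by simp
          qed (use N_subset \<alpha>0 in auto)
        next
          case 1
          show ?case using N_int_N[of v p v' p] v v' p by simp
        qed (use N_subset \<alpha>0 in auto)
      next
        case 1
        have "card W - card {v, v'} \<le> card (W - {v, v'})" by (rule diff_card_le_card_Diff) simp
        moreover have "card {v, v'} \<le> 2" by (simp add: card_insert_if)
        ultimately have "real (card W) - 2 \<le> real (card (W - {v, v'}))" by linarith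
        moreover have "\<alpha> * real n \<le> 1 / 4 * real n" using \<alpha> by (intro mult_right_mono) auto
        moreover have "16 \<le> real n" using n by simp
        ultimately have "\<alpha> * real n \<le> real (card (W - {v, v'}))" using card_W by linarith
        thus ?case by simp
      qed (use N_subset \<alpha>0 W_def in auto)
    next
      case 1
      show ?case using N_int_W[of x y] xy by simp
    qed (use N_subset \<alpha>0 in auto)
  next
    case 1
    show ?case using N_int_W[of a b] ab by simp
  qed (use N_subset \<alpha>0 in auto)
  hence "many V (\<alpha> ^ 7) 7 C'" by (simp add: eval_nat_numeral)
  from many_dup[OF fin this] Vne \<alpha>0
  have "many V ((\<alpha> ^ 7)\<^sup>2) 8 (\<lambda>t. C' (t ! 0 # drop 2 t) \<and> C' (t ! 1 # drop 2 t))" by simp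
  hence "many V ((\<alpha> ^ 7)\<^sup>2) 8 (\<lambda>t. C (t!1) (t!0) (t!3) (t!4) (t!5) (t!6) (t!7) \<and> C (t!2) (t!0) (t!3) (t!4) (t!5) (t!6) (t!7))"
    by (rule many_perm[OF fin, where js = "[2,0,1,3,4,5,6,7]"]) (auto simp: C'_def tuples_def)
  from many_dup[OF fin this] Vne \<alpha>0
  have "many V (((\<alpha> ^ 7)\<^sup>2)\<^sup>2) 9 (\<lambda>t.
      (\<lambda>t. C (t!1) (t!0) (t!3) (t!4) (t!5) (t!6) (t!7) \<and> C (t!2) (t!0) (t!3) (t!4) (t!5) (t!6) (t!7)) (t ! 0 # drop 2 t)
    \<and> (\<lambda>t. C (t!1) (t!0) (t!3) (t!4) (t!5) (t!6) (t!7) \<and> C (t!2) (t!0) (t!3) (t!4) (t!5) (t!6) (t!7)) (t ! 1 # drop 2 t))"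
    by simp
  hence "many V (((\<alpha> ^ 7)\<^sup>2)\<^sup>2) 9 (\<lambda>t. 
      C (t!3) (t!1) (t!0) (t!5) (t!6) (t!7) (t!8) \<and> C (t!4) (t!1) (t!0) (t!5) (t!6) (t!7) (t!8)
    \<and> C (t!3) (t!2) (t!0) (t!5) (t!6) (t!7) (t!8) \<and> C (t!4) (t!2) (t!0) (t!5) (t!6) (t!7) (t!8))"
    by (rule many_perm[OF fin, where js = "[4,0,1,2,3,5,6,7,8]"]) (auto simp: tuples_def)
  from many_dup[OF fin this] Vne \<alpha>0
  have "many V ((((\<alpha> ^ 7)\<^sup>2)\<^sup>2)\<^sup>2) 10 (\<lambda>t. 
     (\<lambda>t. C (t!3) (t!1) (t!0) (t!5) (t!6) (t!7) (t!8) \<and> C (t!4) (t!1) (t!0) (t!5) (t!6) (t!7) (t!8)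
    \<and> C (t!3) (t!2) (t!0) (t!5) (t!6) (t!7) (t!8) \<and> C (t!4) (t!2) (t!0) (t!5) (t!6) (t!7) (t!8)) (t ! 0 # drop 2 t)
   \<and> (\<lambda>t. C (t!3) (t!1) (t!0) (t!5) (t!6) (t!7) (t!8) \<and> C (t!4) (t!1) (t!0) (t!5) (t!6) (t!7) (t!8)
    \<and> C (t!3) (t!2) (t!0) (t!5) (t!6) (t!7) (t!8) \<and> C (t!4) (t!2) (t!0) (t!5) (t!6) (t!7) (t!8)) (t ! 1 # drop 2 t))"
    by simp
  \<comment> \<open>The entries are two copies each of \<open>p\<close>, \<open>v'\<close>,
    \<open>v\<close>, followed by \<open>q\<close>, \<open>p3\<close>, \<open>p4\<close>,
    \<open>s\<close>; the permutation spells the walk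
    \<open>a b v p3 p4 v p q v' p s v' x y\<close>.\<close>
  hence "many V ((((\<alpha> ^ 7)\<^sup>2)\<^sup>2)\<^sup>2) 10 (\<lambda>t. tw E (a # b # t @ [x, y]))"
    by (rule many_perm[OF fin, where js = "[4,7,8,5,0,6,2,1,9,3]"])
       (auto simp: tuples_def C_def N_def insert_commute)
  thus ?thesis by (simp flip: power_mult)
qed

abbreviation J :: nat where "J \<equiv> reach_len \<alpha>"
abbreviation L :: nat where "L \<equiv> con_len \<alpha>"
abbreviation con :: real where "con \<equiv> con_dens \<alpha>"

lemma J_ge: "1 \<le> real J * \<alpha>"
proof -
  have "1 / \<alpha> \<le> real J" using \<alpha> by (simp add: reach_len_def)
  thus ?thesis using \<alpha> by (simp add: field_simps)
qed

text \<open>Both pairs climb into \<open>W\<close>, the second one backwards as \<open>y\<close>,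
  \<open>x\<close>, since reversal preserves tight walks; \<open>connect_W\<close> then bridges the
  two ends. Length and density are the same for all pairs, so a single family of tuples can serve
  them.\<close>

lemma connect:
  assumes ab: "a \<in> V" "b \<in> V" "a \<noteq> b" and xy: "x \<in> V" "y \<in> V" "x \<noteq> y"
    and n: "16 \<le> n"
  shows "many V con L (\<lambda>t. tw E (a # b # t @ [x, y]))"
proof -
  have fin: "finite V" by simp
  let ?k = "2 * J"
  define P where "P a b t \<longleftrightarrow> tw E (a # b # t) \<and> (\<exists>r x y. a # b # t = r @ [x, y] \<and> x \<in> W \<and> y \<in> W \<and> x \<noteq> y)" for a b t
  have J: "real n / 2 - real J * (\<alpha> / 2 * real n) \<le> z" if "0 \<le> z" for z
  proof -
    have "1 * real n \<le> real J * \<alpha> * real n" using J_ge by (intro mult_right_mono) auto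
    thus ?thesis using that by (simp add: algebra_simps)
  qed
  have reach: "many V ((\<alpha> / 2) ^ ?k) ?k (P a b)" if "a \<in> V" "b \<in> V" "a \<noteq> b" for a b
    using reach_W[OF that J] unfolding P_def by simp
  define mid where "mid u w t \<longleftrightarrow> tw E (a # b # u @ t @ rev (y # x # w))" for u w t
  have mid: "many V (\<alpha> ^ 56) 10 (mid u w)" if u: "P a b u" and w: "P y x w" for u w
  proof -
    obtain r c d where u': "a # b # u = r @ [c, d]" "c \<in> W" "d \<in> W" "c \<noteq> d" "tw E (r @ [c, d])"
      using u unfolding P_def by auto
    obtain r' c' d' where w': "y # x # w = r' @ [c', d']" "c' \<in> W" "d' \<in> W" "c' \<noteq> d'" "tw E (r' @ [c', d'])"
      using w unfolding P_def by auto
    have eq: "a # b # u @ t @ rev (y # x # w) = r @ c # d # (t @ d' # c' # rev r')" for t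
    proof -
      have "a # b # u @ t @ rev (y # x # w) = (a # b # u) @ t @ rev (y # x # w)" by simp
      also have "\<dots> = (r @ [c, d]) @ t @ rev (r' @ [c', d'])" by (simp only: u'(1) w'(1))
      finally show ?thesis by simp
    qed
    have t2: "tw E (d' # c' # rev r')" using w'(5) tw_rev[of E "r' @ [c', d']"] by simp
    have "mid u w t" if "tw E (c # d # t @ [d', c'])" for t
    proof -
      have "tw E ((c # d # t) @ d' # c' # rev r')"
        using that t2 by (intro tw_join[THEN iffD2]) simp
      hence "tw E (r @ c # d # (t @ d' # c' # rev r'))"
        using u'(5) by (intro tw_join[THEN iffD2]) simp
      thus ?thesis unfolding mid_def eq .
    qed
    thus ?thesis
      using connect_W[of c d d' c'] u' w' n by (auto elim!: many_mono[rotated 1])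
  qed
  have inner: "many V ((\<alpha> / 2) ^ ?k * \<alpha> ^ 56) (?k + 10) (\<lambda>t. P y x (take ?k t) \<and> mid u (take ?k t) (drop ?k t))"
    if "P a b u" for u
    using that mid \<alpha> by (intro many_append[OF fin reach]) (use xy in auto)
  have "many V con (?k + (?k + 10))
     (\<lambda>t. P a b (take ?k t) \<and> (P y x (take ?k (drop ?k t)) \<and> mid (take ?k t) (take ?k (drop ?k t)) (drop ?k (drop ?k t))))"
    unfolding con_dens_def
    using \<alpha> inner by (intro many_append[OF fin reach[OF ab]]) auto
  moreover have "?k + (?k + 10) = L" by (simp add: con_len_def)
  ultimately have many: "many V con L (\<lambda>t. mid (take ?k t) (take ?k (drop ?k t)) (drop ?k (drop ?k t)))"
    by (auto elim!: many_mono[rotated 1])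
  \<comment> \<open>The bridge depends on both climbs and is therefore chosen last;
    \<open>?f\<close> moves it to the middle and reverses the second climb.\<close>
  let ?f = "\<lambda>t. take ?k t @ drop ?k (drop ?k t) @ rev (take ?k (drop ?k t))"
  show ?thesis
  proof (rule many_inj[OF fin many, where f = ?f])
    show "inj_on ?f (tuples V L)"
    proof (rule inj_onI)
      fix s t :: "nat list" assume st: "s \<in> tuples V L" "t \<in> tuples V L" "?f s = ?f t"
      hence "take ?k s = take ?k t" "take ?k (drop ?k s) = take ?k (drop ?k t)"
        "drop ?k (drop ?k s) = drop ?k (drop ?k t)"
        by (auto simp: tuples_def con_len_def simp del: drop_drop)
      thus "s = t" by (metis append_take_drop_id)
    qed
    show "?f ` tuples V L \<subseteq> tuples V L"
      by (auto simp: tuples_def con_len_def dest!: in_set_takeD in_set_dropD)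
    show "tw E (a # b # ?f t @ [x, y])" if "mid (take ?k t) (take ?k (drop ?k t)) (drop ?k (drop ?k t))" for t
      using that by (simp add: mid_def del: drop_drop)
  qed
qed

end

section \<open>Absorbers\<close>

text \<open>The exponent is 3 times 4: three choices of density \<alpha>/2, then two duplications.
  The value also lies below the density \<alpha>^5 of absorbers for vertices of
  \<open>W\<close>.\<close>

definition abs_dens :: "real \<Rightarrow> real" where
  "abs_dens \<alpha> = (\<alpha> / 2) ^ 12"

lemma abs_dens_pos: "0 < \<alpha> \<Longrightarrow> 0 < abs_dens \<alpha>" by (simp add: abs_dens_def)

lemma abs_dens_le_1: "0 < \<alpha> \<Longrightarrow> \<alpha> \<le> 1 \<Longrightarrow> abs_dens \<alpha> \<le> 1"
  unfolding abs_dens_def by (intro power_le_one) auto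

context posa_graph
begin

text \<open>A vertex of the upper half is inserted into the path \<open>t\<close>. A smaller vertex instead replaces
  the middle vertex of \<open>t\<close>, which is larger by \<open>\<alpha>n/4\<close> or already in the upper half, and has to be
  absorbed in turn; \<open>lev\<close> bounds the number of these replacements.\<close>

definition absorbs :: "nat \<Rightarrow> nat list \<Rightarrow> bool" where
  "absorbs v t \<longleftrightarrow> tw E t \<and>
     (if v \<in> W then tw E [t ! 0, t ! 1, v, t ! 2, t ! 3, t ! 4]
      else tw E [t ! 0, t ! 1, v, t ! 3, t ! 4] \<and>
        min (real v + \<alpha> / 4 * real n) (real n / 2) \<le> real (t ! 2))"

abbreviation absc :: real where "absc \<equiv> abs_dens \<alpha>"

lemma absorbers_W:
  assumes v: "v \<in> W" and n: "16 \<le> n"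
  shows "many V absc 5 (absorbs v)"
proof -
  have fin: "finite V" by simp
  have \<alpha>0: "0 \<le> \<alpha>" using \<alpha> by simp
  \<comment> \<open>The coordinates are \<open>b c a d e\<close> for the path
    \<open>a b c d e\<close>, which turns into \<open>a b v c d e\<close>. As \<open>b\<close> and
    \<open>c\<close> are chosen in \<open>W\<close>, both \<open>a\<close> and \<open>d\<close> are
    common neighbours of two pairs of \<open>W\<close>; \<open>e\<close> only has to continue the
    path.\<close>
  define A where "A t \<longleftrightarrow> tw E [t!2, t!0, t!1, t!3, t!4] \<and> tw E [t!2, t!0, v, t!1, t!3, t!4]" for t
  have "many V (\<alpha> * (\<alpha> * (\<alpha> * (\<alpha> * (\<alpha> * 1))))) (Suc (Suc (Suc (Suc (Suc 0))))) A"
  proof (rule many_Cons[OF fin, where X = "W - {v}"], goal_cases)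
    case 1
    have "card W - card {v} \<le> card (W - {v})" by (rule diff_card_le_card_Diff) simp
    hence "real (card W) - 1 \<le> real (card (W - {v}))" by simp
    moreover have "\<alpha> * real n \<le> 1 / 4 * real n" using \<alpha> by (intro mult_right_mono) auto
    moreover have "16 \<le> real n" using n by simp
    ultimately have "\<alpha> * real n \<le> real (card (W - {v}))" using card_W by linarith
    thus ?case by simp
  next
    case (4 b)
    hence b: "b \<in> W" "b \<noteq> v" by auto
    show ?case
    proof (rule many_Cons[OF fin, where X = "N v b \<inter> W"], goal_cases)
      case 1
      show ?case using N_int_W[of v b] v b by simp
    next
      case (4 c)
      hence c: "c \<in> N v b" "c \<in> W" by auto
      have ne: "v \<noteq> c" "b \<noteq> c" using N_D[OF c(1)] by auto
      show ?case
      proof (rule many_Cons[OF fin, where X = "N v b \<inter> N b c"], goal_cases)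
        case 1
        show ?case using N_int_N[of v b b c] v b c ne by simp
      next
        case (4 a)
        hence a: "a \<in> N v b" "a \<in> N b c" by auto
        show ?case
        proof (rule many_Cons[OF fin, where X = "N v c \<inter> N b c"], goal_cases)
          case 1
          show ?case using N_int_N[of v c b c] v b c ne by simp
        next
          case (4 d)
          hence d: "d \<in> N v c" "d \<in> N b c" by auto
          show ?case
          proof (rule many_Cons[OF fin, where X = "N c d"], goal_cases)
            case 1
            show ?case using N_degree[of c d] N_D[OF d(1)] by simp
          next
            case (4 e)
            show ?case using a c d 4
              by (intro many_Nil) (auto simp: A_def N_def insert_commute)
          qed (use N_subset \<alpha>0 in auto)
        qed (use N_subset \<alpha>0 in auto)
      qed (use N_subset \<alpha>0 in auto)
    qed (use N_subset \<alpha>0 in auto)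
  qed (use N_subset \<alpha>0 W_def in auto)
  hence "many V (\<alpha> ^ 5) 5 A" by (simp add: eval_nat_numeral)
  hence *: "many V (\<alpha> ^ 5) 5 (absorbs v)"
    by (rule many_perm[OF fin, where js = "[2,0,1,3,4]"])
       (use v in \<open>auto simp: A_def absorbs_def tuples_def\<close>)
  have "absc \<le> \<alpha> ^ 12" unfolding abs_dens_def using \<alpha> by (intro power_mono) auto
  also have "\<alpha> ^ 12 \<le> \<alpha> ^ 5" using \<alpha> by (intro power_decreasing) auto
  finally show ?thesis using * by (intro many_mono[OF fin *]) auto
qed

lemma absorbers_not_W:
  assumes v: "v \<in> V" "v \<notin> W" and n: "16 \<le> n"
  shows "many V absc 5 (absorbs v)"
proof -
  have fin: "finite V" by simp
  have Vne: "V \<noteq> {}" using n by auto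
  have \<alpha>0: "0 \<le> \<alpha> / 2" using \<alpha> by simp
  have vn: "real v < real n / 2" using v by (auto simp: W_def)
  have an: "0 < \<alpha> * real n" using \<alpha> n by simp
  \<comment> \<open>As \<open>x\<close> is above \<open>v\<close>, the pair \<open>v\<close>,
    \<open>x\<close> has degree at least \<open>v\<close> plus \<alpha>n, so at least 3\<alpha>n/4
    of the neighbours reach \<open>s\<close>; with \<open>x\<close> and \<open>y\<close> both at
    least \<open>s\<close>, the excess for this pair yields the large \<open>u\<close>.\<close>
  define s where "s = real v + \<alpha> / 4 * real n"
  define D where "D x y u \<longleftrightarrow> y \<in> N v x \<and> u \<in> N x y \<and> min s (real n / 2) \<le> real u" for x y u
  have s: "0 \<le> s" "real v < s" using an by (auto simp: s_def)
  have "many V ((\<alpha> / 2) * ((\<alpha> / 2) * ((\<alpha> / 2) * 1))) (Suc (Suc (Suc 0))) (\<lambda>t. D (t!0) (t!1) (t!2))"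
  proof (rule many_Cons[OF fin, where X = "{x \<in> V. s \<le> real x}"], goal_cases)
    case 1
    have "V \<subseteq> {x \<in> V. s \<le> real x} \<union> {z \<in> V. real z < s}" by auto
    hence "card V \<le> card {x \<in> V. s \<le> real x} + card {z \<in> V. real z < s}"
      by (intro order.trans[OF card_mono card_Un_le]) auto
    hence "real n - s \<le> real (card {x \<in> V. s \<le> real x})" using card_below[of n s] s by simp
    moreover have "\<alpha> * real n \<le> 1 / 4 * real n" using \<alpha> by (intro mult_right_mono) auto
    ultimately have "\<alpha> / 2 * real n \<le> real (card {x \<in> V. s \<le> real x})"
      using vn an unfolding s_def by linarith
    thus ?case by simp
  next
    case (4 x)
    hence x: "x \<in> V" "s \<le> real x" by auto
    show ?case
    proof (rule many_Cons[OF fin, where X = "{y \<in> N v x. s \<le> real y}"], goal_cases)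
      case 1
      have "min (min (real v) (real x)) (real n / 2) = real v" using x s vn by simp
      hence "real v + \<alpha> * real n - s \<le> real (card {y \<in> N v x. s \<le> real y})"
        using N_above[of v x s] v x s by auto
      thus ?case using an by (simp add: s_def)
    next
      case (4 y)
      hence y: "y \<in> N v x" "s \<le> real y" by auto
      have xy: "x \<noteq> y" "y \<in> V" using N_D[OF y(1)] by auto
      show ?case
      proof (rule many_Cons[OF fin, where X = "{u \<in> N x y. min s (real n / 2) \<le> real u}"], goal_cases)
        case 1
        have "\<alpha> * real n \<le> real (card {u \<in> N x y. min s (real n / 2) \<le> real u})"
          using N_above[of x y "min s (real n / 2)"] x xy y s by auto
        thus ?case using an by simp
      next
        case (4 u)
        show ?case using y 4
          by (intro many_Nil) (auto simp: D_def)
      qed (use N_subset \<alpha>0 in auto)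
    qed (use N_subset \<alpha>0 in auto)
  qed (use \<alpha>0 in auto)
  hence "many V ((\<alpha> / 2) ^ 3) 3 (\<lambda>t. D (t!0) (t!1) (t!2))" by (simp add: eval_nat_numeral)
  from many_dup[OF fin this] Vne \<alpha>0
  have "many V (((\<alpha> / 2) ^ 3)\<^sup>2) 4 (\<lambda>t. (\<lambda>t. D (t!0) (t!1) (t!2)) (t ! 0 # drop 2 t) \<and> (\<lambda>t. D (t!0) (t!1) (t!2)) (t ! 1 # drop 2 t))"
    by simp
  hence "many V (((\<alpha> / 2) ^ 3)\<^sup>2) 4 (\<lambda>t. D (t!1) (t!0) (t!3) \<and> D (t!2) (t!0) (t!3))"
    by (rule many_perm[OF fin, where js = "[2,0,1,3]"]) (auto simp: tuples_def)
  from many_dup[OF fin this] Vne \<alpha>0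
  have "many V ((((\<alpha> / 2) ^ 3)\<^sup>2)\<^sup>2) 5 (\<lambda>t.
     (\<lambda>t. D (t!1) (t!0) (t!3) \<and> D (t!2) (t!0) (t!3)) (t ! 0 # drop 2 t)
   \<and> (\<lambda>t. D (t!1) (t!0) (t!3) \<and> D (t!2) (t!0) (t!3)) (t ! 1 # drop 2 t))"
    by simp
  \<comment> \<open>The entries are two copies of \<open>y\<close>, two of \<open>x\<close>, and
    \<open>u\<close>; the order \<open>[2,0,4,3,1]\<close> reads \<open>x y u x' y'\<close>.\<close>
  hence "many V ((((\<alpha> / 2) ^ 3)\<^sup>2)\<^sup>2) 5 (absorbs v)"
    by (rule many_perm[OF fin, where js = "[2,0,4,3,1]"])
       (use v in \<open>auto simp: tuples_def D_def N_def absorbs_def s_def insert_commute\<close>)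
  thus ?thesis by (simp add: abs_dens_def flip: power_mult)
qed

lemma absorbers: "v \<in> V \<Longrightarrow> 16 \<le> n \<Longrightarrow> many V absc 5 (absorbs v)"
  using absorbers_W absorbers_not_W by blast

text \<open>The number of exchanges, each gaining \<alpha>n/4, that suffice to lift \<open>v\<close>
  into \<open>W\<close>, plus one for the final insertion; \<open>nat\<close> cuts the quotient off
  at 0 for vertices of \<open>W\<close>.\<close>

definition lev :: "nat \<Rightarrow> nat" where
  "lev v = nat \<lceil>(real n / 2 - real v) / (\<alpha> / 4 * real n)\<rceil> + 1"

lemma nat_ceiling_less:
  fixes x y :: real
  assumes "x \<le> max 0 (y - 1)" "0 < y"
  shows "nat \<lceil>x\<rceil> < nat \<lceil>y\<rceil>"
proof (cases "0 \<le> y - 1")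
  case True
  hence "\<lceil>x\<rceil> \<le> \<lceil>y\<rceil> - 1" using assms ceiling_mono[of x "y - 1"] by simp
  moreover have "0 < \<lceil>y\<rceil>" using assms by simp
  ultimately show ?thesis by linarith
next
  case False
  hence "\<lceil>x\<rceil> \<le> 0" "0 < \<lceil>y\<rceil>" using assms by auto
  thus ?thesis by linarith
qed

lemma lev_swap:
  assumes "v \<in> V" "v \<notin> W" "min (real v + \<alpha> / 4 * real n) (real n / 2) \<le> real u"
  shows "lev u < lev v"
proof -
  define d where "d = \<alpha> / 4 * real n"
  have n: "0 < n" using assms by auto
  have d: "d > 0" using \<alpha> n by (simp add: d_def)
  have v: "real v < real n / 2" using assms by (auto simp: W_def)
  hence pos: "(real n / 2 - real v) / d > 0" using d by simp
  have "(real n / 2 - real u) / d \<le> max 0 ((real n / 2 - real v) / d - 1)"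
  proof (cases "real n / 2 \<le> real u")
    case True
    hence "(real n / 2 - real u) / d \<le> 0" using d by (simp add: divide_le_0_iff)
    thus ?thesis by simp
  next
    case False
    hence "real v + d \<le> real u" using assms(3) by (auto simp: d_def)
    hence "(real n / 2 - real u) / d \<le> (real n / 2 - real v - d) / d"
      using d by (intro divide_right_mono) auto
    also have "\<dots> = (real n / 2 - real v) / d - 1" using d by (simp add: field_simps)
    finally show ?thesis by simp
  qed
  hence "nat \<lceil>(real n / 2 - real u) / d\<rceil> < nat \<lceil>(real n / 2 - real v) / d\<rceil>"
    using pos nat_ceiling_less by blast
  thus ?thesis by (simp add: lev_def d_def)
qed

lemma lev_le: "0 < n \<Longrightarrow> real (lev v) \<le> 2 / \<alpha> + 2"
proof -
  assume n: "0 < n"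
  have "(real n / 2 - real v) / (\<alpha> / 4 * real n) \<le> (real n / 2) / (\<alpha> / 4 * real n)"
    using \<alpha> by (intro divide_right_mono) auto
  also have "\<dots> = 2 / \<alpha>" using n \<alpha> by (simp add: field_simps)
  finally have *: "(real n / 2 - real v) / (\<alpha> / 4 * real n) \<le> 2 / \<alpha>" .
  moreover have "0 < 2 / \<alpha>" using \<alpha> by simp
  ultimately have "real (nat \<lceil>(real n / 2 - real v) / (\<alpha> / 4 * real n)\<rceil>) \<le> 2 / \<alpha> + 1"
    by linarith
  thus ?thesis by (simp add: lev_def)
qed

end

section \<open>Selection of disjoint tuples\<close>

text \<open>Derandomised choice of \<open>m\<close> random tuples: every new tuple can be chosen so that the potential
  \<open>\<Sum>\<^sub>j 2 ^ (- hits of S j)\<close> drops by a factor \<open>1 - c / 4\<close>.\<close>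

lemma select_tuples:
  fixes c :: real
  assumes V: "finite V" "V \<noteq> {}" and J: "finite J" "J \<noteq> {}" and X: "finite X"
    and S: "\<And>j. j \<in> J \<Longrightarrow> many V c k (S j)" and c: "0 < c" and k: "0 < k"
    and m: "real k * (real (card X) + real k * real m + real k) \<le> c / 2 * real (card V)"
  shows "\<exists>F. finite F \<and> card F \<le> m \<and> (\<forall>t\<in>F. t \<in> tuples (V - X) k \<and> distinct t) \<and>
     disjoint_family_on set F \<and>
     (\<Sum>j\<in>J. (1/2) ^ card {t\<in>F. S j t}) \<le> real (card J) * (1 - c / 4) ^ m"
  using m
proof (induction m)
  case 0
  show ?case by (rule exI[of _ "{}"]) (simp add: disjoint_family_on_def)
next
  case (Suc m)
  have "real k * (real (card X) + real k * real m + real k) \<le> real k * (real (card X) + real k * real (Suc m) + real k)"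
    by (intro mult_left_mono) (auto simp: algebra_simps)
  hence "real k * (real (card X) + real k * real m + real k) \<le> c / 2 * real (card V)" using Suc.prems by linarith
  from Suc.IH[OF this] obtain F where F: "finite F" "card F \<le> m" "\<forall>t\<in>F. t \<in> tuples (V - X) k \<and> distinct t"
    "disjoint_family_on set F" 
    "(\<Sum>j\<in>J. (1/2) ^ card {t\<in>F. S j t}) \<le> real (card J) * (1 - c / 4) ^ m"
    by blast
  define Y where "Y = X \<union> (\<Union>t\<in>F. set t)"
  have finY: "finite Y" using X F by (auto simp: Y_def)
  have "card (\<Union>t\<in>F. set t) \<le> (\<Sum>t\<in>F. card (set t))" by (rule card_UN_le) (rule F)
  also have "\<dots> \<le> (\<Sum>t\<in>F. k)" using F(3) by (intro sum_mono) (auto simp: tuples_def distinct_card)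
  also have "\<dots> \<le> m * k" using F by simp
  finally have "card Y \<le> card X + m * k" unfolding Y_def using card_Un_le[of X "\<Union>t\<in>F. set t"] by linarith
  hence cY: "real (card Y) \<le> real (card X) + real k * real m" by (metis mult.commute of_nat_add of_nat_le_iff of_nat_mult)
  have kY: "real k * (real (card Y) + real k) \<le> c / 2 * real (card V)"
  proof -
    have "real k * (real (card Y) + real k) \<le> real k * (real (card X) + real k * real (Suc m) + real k)"
      using cY by (intro mult_left_mono) (auto simp: algebra_simps)
    thus ?thesis using Suc.prems by linarith
  qed
  define G where "G = {t \<in> tuples V k. distinct t \<and> set t \<inter> Y = {}}"
  have finG: "finite G" using V by (auto simp: G_def finite_tuples)
  have cardG: "real (card G) \<le> real (card V) ^ k"
  proof -
    have "card G \<le> card (tuples V k)" unfolding G_def using V by (intro card_mono) (auto simp: finite_tuples)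
    thus ?thesis using V by (simp add: card_tuples flip: of_nat_power)
  qed
  have GS: "c / 2 * real (card V) ^ k \<le> real (card {t\<in>G. S j t})" if "j \<in> J" for j
  proof -
    have "many V (c / 2) k (\<lambda>t. S j t \<and> distinct t \<and> set t \<inter> Y = {})"
      by (rule many_good[OF V finY S[OF that] kY])
    moreover have "{t\<in>G. S j t} = {t \<in> tuples V k. S j t \<and> distinct t \<and> set t \<inter> Y = {}}"
      by (auto simp: G_def)
    ultimately show ?thesis by (simp add: many_def)
  qed
  have Gpos: "0 < card G"
  proof -
    obtain j where "j \<in> J" using J by auto
    have "0 < c / 2 * real (card V) ^ k" using c V by (simp add: card_gt_0_iff)
    hence "0 < card {t\<in>G. S j t}" using GS[OF \<open>j \<in> J\<close>] by linarith
    thus ?thesis using finG by (auto simp: card_gt_0_iff)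
  qed
  let ?h = "\<lambda>j. (1/2::real) ^ card {t\<in>F. S j t}"
  have one: "(\<Sum>t\<in>G. if S j t then 1/2 else 1::real) \<le> real (card G) * (1 - c / 4)" if j: "j \<in> J" for j
  proof -
    have "(\<Sum>t\<in>G. if S j t then 1/2 else 1::real) = (\<Sum>t\<in>G. 1 - (if S j t then 1/2 else 0))"
      by (intro sum.cong) auto
    also have "\<dots> = real (card G) - real (card {t\<in>G. S j t}) / 2"
      using finG by (simp add: sum_subtractf sum.If_cases Int_def)
    also have "\<dots> \<le> real (card G) - c / 4 * real (card V) ^ k" using GS[OF j] by simp
    also have "\<dots> \<le> real (card G) - c / 4 * real (card G)"
      using cardG c by (intro diff_left_mono mult_left_mono) auto
    finally show ?thesis by (simp add: algebra_simps)
  qed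
  \<comment> \<open>Averaging over the admissible tuples \<open>G\<close>: at least a fraction c/2
    of them halves a given term, so each term shrinks on average by the factor 1 - c/4.\<close>
  have "(\<Sum>t\<in>G. \<Sum>j\<in>J. ?h j * (if S j t then 1/2 else 1)) = (\<Sum>j\<in>J. ?h j * (\<Sum>t\<in>G. if S j t then 1/2 else 1))"
    by (subst sum.swap) (simp add: sum_distrib_left)
  also have "\<dots> \<le> (\<Sum>j\<in>J. ?h j * (real (card G) * (1 - c / 4)))"
    using one by (intro sum_mono mult_left_mono) auto
  also have "\<dots> = real (card G) * ((1 - c / 4) * (\<Sum>j\<in>J. ?h j))"
    by (simp add: sum_distrib_left sum_distrib_right algebra_simps)
  finally have avg: "(\<Sum>t\<in>G. \<Sum>j\<in>J. ?h j * (if S j t then 1/2 else 1)) \<le> real (card G) * ((1 - c / 4) * (\<Sum>j\<in>J. ?h j))" .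
  obtain t where t: "t \<in> G" "(\<Sum>j\<in>J. ?h j * (if S j t then 1/2 else 1)) \<le> (1 - c / 4) * (\<Sum>j\<in>J. ?h j)"
  proof (rule ccontr)
    assume *: "\<not> thesis"
    have "(\<Sum>t\<in>G. (1 - c / 4) * (\<Sum>j\<in>J. ?h j)) < (\<Sum>t\<in>G. \<Sum>j\<in>J. ?h j * (if S j t then 1/2 else 1))"
    proof (rule sum_strict_mono)
      fix t assume "t \<in> G"
      thus "(1 - c / 4) * (\<Sum>j\<in>J. ?h j) < (\<Sum>j\<in>J. ?h j * (if S j t then 1/2 else 1))"
        using that[of t] * by (meson not_le)
    qed (use finG Gpos in \<open>auto simp: card_gt_0_iff\<close>)
    thus False using avg by simp
  qed
  have tG: "t \<in> tuples V k" "distinct t" "set t \<inter> Y = {}" using t by (auto simp: G_def)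
  have tne: "set t \<noteq> {}" using tG k by (auto simp: tuples_def)
  have tF: "t \<notin> F"
  proof
    assume "t \<in> F"
    hence "set t \<subseteq> Y" unfolding Y_def by blast
    thus False using tG(3) tne by (simp add: Int_absorb2)
  qed
  have c1: "0 \<le> 1 - c / 4"
  proof -
    obtain j where j: "j \<in> J" using J by auto
    have "c * real (card V) ^ k \<le> real (card V) ^ k"
    proof -
      have "c * real (card V) ^ k \<le> real (card {t \<in> tuples V k. S j t})" using S[OF j] by (simp add: many_def)
      also have "\<dots> \<le> real (card (tuples V k))" using V by (intro of_nat_mono card_mono) (auto simp: finite_tuples)
      finally show ?thesis using V by (simp add: card_tuples)
    qed
    moreover have "0 < real (card V) ^ k" using V by (simp add: card_gt_0_iff)
    ultimately have "c \<le> 1" by simp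
    thus ?thesis by simp
  qed
  show ?case
  proof (rule exI[of _ "insert t F"], intro conjI)
    show "finite (insert t F)" using F by simp
    show "card (insert t F) \<le> Suc m" using F tF by simp
    show "\<forall>s\<in>insert t F. s \<in> tuples (V - X) k \<and> distinct s"
      using F(3) tG by (auto simp: tuples_def Y_def)
    show "disjoint_family_on set (insert t F)"
      using F(4) tG(3) tF by (auto simp: disjoint_family_on_def Y_def)
    have "(\<Sum>j\<in>J. (1/2::real) ^ card {s\<in>insert t F. S j s}) = (\<Sum>j\<in>J. ?h j * (if S j t then 1/2 else 1))"
    proof (intro sum.cong refl)
      fix j
      have "{s\<in>insert t F. S j s} = (if S j t then insert t {s\<in>F. S j s} else {s\<in>F. S j s})" by auto
      thus "(1/2::real) ^ card {s\<in>insert t F. S j s} = ?h j * (if S j t then 1/2 else 1)"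
        using F(1) tF by auto
    qed
    also have "\<dots> \<le> (1 - c / 4) * (\<Sum>j\<in>J. ?h j)" by (rule t)
    also have "\<dots> \<le> (1 - c / 4) * (real (card J) * (1 - c / 4) ^ m)" using F(5) c1 by (intro mult_left_mono)
    finally show "(\<Sum>j\<in>J. (1/2::real) ^ card {s\<in>insert t F. S j s}) \<le> real (card J) * (1 - c / 4) ^ Suc m"
      by (simp add: algebra_simps)
  qed
qed

text \<open>A single term is at most the whole potential, so a demand with h hits has (1/2)^h \<le>
  |J| exp (-cm/4); with exp (-1) \<le> 1/2, logarithms give the bound. The loss is only logarithmic
  in the number of demands.\<close>

lemma select_tuples_hits:
  fixes c :: real
  assumes V: "finite V" "V \<noteq> {}" and J: "finite J" "J \<noteq> {}" and X: "finite X"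
    and S: "\<And>j. j \<in> J \<Longrightarrow> many V c k (S j)" and c: "0 < c" "c \<le> 1" and k: "0 < k"
    and m: "real k * (real (card X) + real k * real m + real k) \<le> c / 2 * real (card V)"
  shows "\<exists>F. finite F \<and> card F \<le> m \<and> (\<forall>t\<in>F. t \<in> tuples (V - X) k \<and> distinct t) \<and>
     disjoint_family_on set F \<and>
     (\<forall>j\<in>J. c / 4 * real m - ln (real (card J)) \<le> real (card {t\<in>F. S j t}))"
proof -
  have "\<exists>F. finite F \<and> card F \<le> m \<and> (\<forall>t\<in>F. t \<in> tuples (V - X) k \<and> distinct t) \<and>
     disjoint_family_on set F \<and>
     (\<Sum>j\<in>J. (1/2) ^ card {t\<in>F. S j t}) \<le> real (card J) * (1 - c / 4) ^ m"
    using S by (rule select_tuples[OF V J X _ c(1) k m])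
  then obtain F where F: "finite F" "card F \<le> m" "\<forall>t\<in>F. t \<in> tuples (V - X) k \<and> distinct t"
    "disjoint_family_on set F" 
    "(\<Sum>j\<in>J. (1/2) ^ card {t\<in>F. S j t}) \<le> real (card J) * (1 - c / 4) ^ m"
    by blast
  have "c / 4 * real m - ln (real (card J)) \<le> real (card {t\<in>F. S j t})" if j: "j \<in> J" for j
  proof -
    let ?h = "card {t\<in>F. S j t}"
    have cJ: "0 < real (card J)" using J by (simp add: card_gt_0_iff)
    have "(1/2) ^ ?h \<le> (\<Sum>j\<in>J. (1/2::real) ^ card {t\<in>F. S j t})"
      using j J by (intro member_le_sum) auto
    also note F(5)
    also have "(1 - c / 4) ^ m \<le> exp (- c / 4) ^ m"
      using c exp_ge_add_one_self[of "- c / 4"] by (intro power_mono) auto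
    hence "real (card J) * (1 - c / 4) ^ m \<le> real (card J) * exp (- c / 4) ^ m"
      using cJ by (intro mult_left_mono) auto
    also have "\<dots> = exp (ln (real (card J)) - c / 4 * real m)"
    proof -
      have "exp (- c / 4) ^ m = exp (- (c / 4 * real m))"
        by (simp add: exp_of_nat_mult[symmetric] algebra_simps)
      thus ?thesis using cJ by (simp add: diff_conv_add_uminus exp_add del: add_uminus_conv_diff)
    qed
    finally have "(1/2::real) ^ ?h \<le> exp (ln (real (card J)) - c / 4 * real m)" .
    moreover have "exp (- real ?h) \<le> (1/2::real) ^ ?h"
    proof -
      have "exp (- 1) \<le> (1/2::real)" using exp_ge_add_one_self[of "1::real"] by (simp add: exp_minus field_simps)
      hence "exp (- 1) ^ ?h \<le> (1/2::real) ^ ?h" by (intro power_mono) auto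
      thus ?thesis by (simp add: exp_of_nat_mult[symmetric])
    qed
    ultimately have "exp (- real ?h) \<le> exp (ln (real (card J)) - c / 4 * real m)" by linarith
    thus ?thesis by simp
  qed
  thus ?thesis using F by blast
qed

section \<open>Joining paths and absorbing vertices\<close>

text \<open>Repeating the first two entries at the end unrolls the cycle into a tight walk, so
  segments can be replaced without modular indices.\<close>

definition cyc :: "nat set set \<Rightarrow> nat list \<Rightarrow> bool" where
  "cyc E xs \<longleftrightarrow> 4 \<le> length xs \<and> distinct xs \<and> tw E (xs @ take 2 xs)"

lemma cyc_imp_tight_cycle:
  assumes "cyc E xs"
  shows "tight_cycle E xs"
  unfolding tight_cycle_def
proof (intro conjI allI impI)
  show "4 \<le> length xs" "distinct xs" using assms by (auto simp: cyc_def)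
  fix i assume i: "i < length xs"
  let ?n = "length xs" and ?ys = "xs @ take 2 xs"
  have nth: "?ys ! k = xs ! (k mod ?n)" if "k < ?n + 2" for k
  proof (cases "k < ?n")
    case False
    hence "k mod ?n = k - ?n" using that \<open>4 \<le> ?n\<close> by (simp add: le_mod_geq)
    thus ?thesis using False that by (simp add: nth_append)
  qed (simp add: nth_append)
  have "{?ys ! i, ?ys ! (i + 1), ?ys ! (i + 2)} \<in> E"
    using assms i \<open>4 \<le> ?n\<close> unfolding cyc_def tw_iff by auto
  thus "{xs ! i, xs ! ((i + 1) mod ?n), xs ! ((i + 2) mod ?n)} \<in> E"
    using i by (simp only: nth) (simp add: nth)
qed

lemma tw_replace:
  assumes "tw E (P @ a # b # M @ c # d # S)" "tw E (a # b # M' @ [c, d])"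
  shows "tw E (P @ a # b # M' @ c # d # S)"
proof -
  have 1: "tw E (P @ [a, b])" "tw E (a # b # M @ c # d # S)"
    using assms(1) tw_join by blast+
  hence "tw E ((a # b # M) @ c # d # S)" by simp
  hence "tw E (c # d # S)" using tw_join by blast
  hence "tw E ((a # b # M') @ c # d # S)" using assms(2) by (intro tw_join[THEN iffD2]) simp
  thus ?thesis using 1 by (intro tw_join[THEN iffD2]) simp
qed

text \<open>The pairs \<open>a b\<close> and \<open>c d\<close> shield the replaced block from its
  surroundings; since \<open>a b\<close> stand before the block, the two entries repeated at the end
  do not change either.\<close>

lemma cyc_replace:
  assumes "cyc E (P @ a # b # M @ c # d # S)" "tw E (a # b # M' @ [c, d])"
    and "distinct (P @ a # b # M' @ c # d # S)"
  shows "cyc E (P @ a # b # M' @ c # d # S)"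
proof -
  have t: "take 2 (P @ a # b # M @ c # d # S) = take 2 (P @ a # b # M' @ c # d # S)"
    by (cases P rule: remdups_adj.cases) (auto simp: numeral_2_eq_2)
  have "tw E (P @ a # b # M @ c # d # (S @ take 2 (P @ a # b # M @ c # d # S)))"
    using assms(1) by (simp add: cyc_def)
  hence "tw E (P @ a # b # M' @ c # d # (S @ take 2 (P @ a # b # M @ c # d # S)))"
    using assms(2) by (rule tw_replace)
  thus ?thesis using assms(3) unfolding t cyc_def by simp
qed

lemma length_ge2_snoc:
  assumes "2 \<le> length p"
  obtains r a b where "p = r @ [a, b]"
proof -
  have "p \<noteq> []" "butlast p \<noteq> []" using assms by (auto simp flip: length_greater_0_conv)
  hence "p = butlast (butlast p) @ [last (butlast p), last p]"
    by (metis append.assoc append_Cons append_Nil append_butlast_last_id)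
  thus ?thesis using that by blast
qed

lemma length_ge2_Cons:
  assumes "2 \<le> length p"
  obtains r a b where "p = a # b # r"
  using assms by (cases p rule: remdups_adj.cases) auto

section \<open>Reservoirs, closing a cycle, and the use of absorbers\<close>

context posa_graph
begin

text \<open>\<open>X\<close> stands for the vertices spent on earlier connections. With
  \<open>L\<close> vertices each, \<open>q + 1\<close> connections can be made in turn:
  \<open>q\<close> to chain \<open>q + 1\<close> paths and one to close the cycle.\<close>

definition reservoir :: "nat set \<Rightarrow> nat \<Rightarrow> bool" where
  "reservoir Y q \<longleftrightarrow> (\<forall>a\<in>V. \<forall>b\<in>V. \<forall>x\<in>V. \<forall>y\<in>V. \<forall>X\<subseteq>Y. a \<noteq> b \<longrightarrow> x \<noteq> y \<longrightarrow> card X \<le> L * q \<longrightarrow>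
     (\<exists>t. length t = L \<and> distinct t \<and> set t \<subseteq> Y - X \<and> tw E (a # b # t @ [x, y])))"

text \<open>Induction from the back: a new path is put in front, so the pair to be reached is the
  start of the head block. The result is a list of blocks that contains the given paths intact,
  because absorbers must later be located inside the cycle.\<close>

lemma chain:
  assumes "reservoir Y q" "finite Y" "ps \<noteq> []" "length ps \<le> Suc q" "\<And>p. p \<in> set ps \<Longrightarrow> 2 \<le> length p \<and> tw E p"
    and "distinct (concat ps)" "set (concat ps) \<subseteq> V - Y"
  shows "\<exists>bs. bs \<noteq> [] \<and> hd bs = hd ps \<and> set ps \<subseteq> set bs \<and> tw E (concat bs) \<and> distinct (concat bs) \<and>
     set (concat ps) \<subseteq> set (concat bs) \<and> set (concat bs) \<subseteq> set (concat ps) \<union> Y \<and>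
     card (set (concat bs) \<inter> Y) \<le> L * (length ps - 1)"
  using assms(3-)
proof (induction ps)
  case Nil thus ?case by simp
next
  case (Cons p ps)
  have pY: "set p \<inter> Y = {}" using Cons.prems(5) by auto
  show ?case
  proof (cases "ps = []")
    case True
    thus ?thesis using Cons.prems pY by (intro exI[of _ "[p]"]) auto
  next
    case False
    have "\<exists>bs. bs \<noteq> [] \<and> hd bs = hd ps \<and> set ps \<subseteq> set bs \<and> tw E (concat bs) \<and> distinct (concat bs) \<and>
     set (concat ps) \<subseteq> set (concat bs) \<and> set (concat bs) \<subseteq> set (concat ps) \<union> Y \<and>
     card (set (concat bs) \<inter> Y) \<le> L * (length ps - 1)"
      using False Cons.prems by (intro Cons.IH) auto
    then obtain bs where bs: "bs \<noteq> []" "hd bs = hd ps" "set ps \<subseteq> set bs" "tw E (concat bs)" "distinct (concat bs)"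
     "set (concat ps) \<subseteq> set (concat bs)" "set (concat bs) \<subseteq> set (concat ps) \<union> Y"
     "card (set (concat bs) \<inter> Y) \<le> L * (length ps - 1)" by blast
    have "2 \<le> length p" using Cons.prems by auto
    then obtain r a b where p: "p = r @ [a, b]" by (rule length_ge2_snoc)
    have "2 \<le> length (hd ps)" using Cons.prems False by auto
    then obtain s x y where hd: "hd ps = x # y # s" by (rule length_ge2_Cons)
    define s' where "s' = s @ concat (tl bs)"
    have cbs: "concat bs = x # y # s'" using bs(1,2) hd by (cases bs) (auto simp: s'_def)
    have xy: "x \<in> V" "y \<in> V" "x \<noteq> y"
    proof -
      have "hd ps \<in> set ps" using False by simp
      hence "{x, y} \<subseteq> set (concat ps)" using hd by (auto intro!: bexI[of _ "hd ps"])
      thus "x \<in> V" "y \<in> V" using Cons.prems(5) by auto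
      show "x \<noteq> y" using bs(5) cbs by simp
    qed
    have ab: "a \<in> V" "b \<in> V" "a \<noteq> b" using Cons.prems p by auto
    have "L * (length ps - 1) \<le> L * q" using Cons.prems(2) by (intro mult_left_mono) auto
    hence "card (set (concat bs) \<inter> Y) \<le> L * q" using bs(8) by linarith
    then obtain t where t: "length t = L" "distinct t" "set t \<subseteq> Y - (set (concat bs) \<inter> Y)" "tw E (a # b # t @ [x, y])"
      using assms(1) ab xy unfolding reservoir_def by (metis inf_le2)
    have "tw E ((a # b # t) @ x # y # s')" using t(4) bs(4) cbs by (intro tw_join[THEN iffD2]) simp
    hence "tw E (r @ a # b # (t @ x # y # s'))"
      using Cons.prems(3)[of p] p by (intro tw_join[THEN iffD2]) simp
    hence tw: "tw E (p @ t @ concat bs)" using p cbs by simp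
    have eq: "set (concat (p # t # bs)) \<inter> Y = set t \<union> (set (concat bs) \<inter> Y)"
      using pY t(3) by auto
    have "card (set (concat (p # t # bs)) \<inter> Y) \<le> card (set t) + card (set (concat bs) \<inter> Y)"
      unfolding eq by (rule card_Un_le)
    also have "\<dots> \<le> L + L * (length ps - 1)" using t bs(8) by (simp add: distinct_card)
    also have "\<dots> = L * (length (p # ps) - 1)" using False by (cases ps) auto
    finally have c: "card (set (concat (p # t # bs)) \<inter> Y) \<le> L * (length (p # ps) - 1)" .
    have d: "distinct (concat (p # t # bs))"
    proof -
      have "set p \<inter> set t = {}" using t(3) pY by blast
      moreover have "set p \<inter> set (concat bs) = {}"
      proof -
        have "set p \<inter> set (concat ps) = {}" using Cons.prems(4) by auto
        thus ?thesis using bs(7) pY by blast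
      qed
      moreover have "set t \<inter> set (concat bs) = {}" using t(3) by blast
      moreover have "distinct p" using Cons.prems(4) by simp
      ultimately have "distinct (p @ t @ concat bs)"
        using t(2) bs(5) by (simp only: distinct_append set_append) blast
      thus ?thesis by simp
    qed
    show ?thesis
      using tw c d bs t by (intro exI[of _ "p # t # bs"]) auto
  qed
qed

lemma close_cycle:
  assumes "reservoir Y q" "finite Y" "ps \<noteq> []" "length ps \<le> Suc q" "\<And>p. p \<in> set ps \<Longrightarrow> 4 \<le> length p \<and> tw E p"
    and "distinct (concat ps)" "set (concat ps) \<subseteq> V - Y"
  shows "\<exists>bs. set ps \<subseteq> set bs \<and> cyc E (concat bs) \<and>
     set (concat ps) \<subseteq> set (concat bs) \<and> set (concat bs) \<subseteq> V"
proof -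
  have "\<exists>bs. bs \<noteq> [] \<and> hd bs = hd ps \<and> set ps \<subseteq> set bs \<and> tw E (concat bs) \<and> distinct (concat bs) \<and>
     set (concat ps) \<subseteq> set (concat bs) \<and> set (concat bs) \<subseteq> set (concat ps) \<union> Y \<and>
     card (set (concat bs) \<inter> Y) \<le> L * (length ps - 1)"
    using assms by (intro chain) force+
  then obtain bs where bs: "bs \<noteq> []" "hd bs = hd ps" "set ps \<subseteq> set bs" "tw E (concat bs)" "distinct (concat bs)"
     "set (concat ps) \<subseteq> set (concat bs)" "set (concat bs) \<subseteq> set (concat ps) \<union> Y"
     "card (set (concat bs) \<inter> Y) \<le> L * (length ps - 1)" by blast
  have YV: "set (concat bs) \<subseteq> V"
  proof
    fix z assume z: "z \<in> set (concat bs)"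
    have "2 < length (concat bs)"
      using assms(3,5) bs(1,2) by (cases bs; cases ps) force+
    then obtain i where "i < length (concat bs)" "z = concat bs ! i"
      using z unfolding in_set_conv_nth by blast
    define j where "j = min i (length (concat bs) - 3)"
    have "{concat bs ! j, concat bs ! (j + 1), concat bs ! (j + 2)} \<in> E"
      using bs(4) \<open>2 < length (concat bs)\<close> unfolding tw_iff j_def by auto
    moreover have "i = j \<or> i = j + 1 \<or> i = j + 2"
      using \<open>i < length (concat bs)\<close> \<open>2 < length (concat bs)\<close> unfolding j_def by linarith
    ultimately show "z \<in> V" using edgeD \<open>z = concat bs ! i\<close> by blast
  qed
  have l4: "4 \<le> length (hd ps)" using assms(3,5) by auto
  hence "2 \<le> length (hd ps)" by simp
  then obtain s x y where hd: "hd ps = x # y # s" by (rule length_ge2_Cons)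
  define s' where "s' = s @ concat (tl bs)"
  have cbs: "concat bs = x # y # s'" using bs(1,2) hd by (cases bs) (auto simp: s'_def)
  have len: "4 \<le> length (concat bs)" using cbs l4 hd by (simp add: s'_def)
  hence "2 \<le> length (concat bs)" by simp
  then obtain r a b where p: "concat bs = r @ [a, b]" by (rule length_ge2_snoc)
  have ab: "a \<in> V" "b \<in> V" "a \<noteq> b" using YV bs(5) unfolding p by auto
  have xy: "x \<in> V" "y \<in> V" "x \<noteq> y" using YV bs(5) unfolding cbs by auto
  have "L * (length ps - 1) \<le> L * q" using assms(4) by (intro mult_left_mono) auto
  hence "card (set (concat bs) \<inter> Y) \<le> L * q" using bs(8) by linarith
  then obtain t where t: "length t = L" "distinct t" "set t \<subseteq> Y - (set (concat bs) \<inter> Y)" "tw E (a # b # t @ [x, y])"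
    using assms(1) ab xy unfolding reservoir_def by (metis inf_le2)
  have "tw E (r @ a # b # (t @ [x, y]))" using t(4) bs(4) p by (intro tw_join[THEN iffD2]) simp
  hence tw: "tw E ((concat bs @ t) @ [x, y])" using p by simp
  have take: "take 2 (concat bs @ t) = [x, y]" by (simp add: cbs numeral_2_eq_2)
  have "cyc E (concat (bs @ [t]))"
    using tw take len t bs(5) by (auto simp: cyc_def simp del: length_concat)
  moreover have "set t \<subseteq> V"
  proof
    fix z assume "z \<in> set t"
    then obtain i where i: "i < length t" "z = t ! i" by (auto simp: in_set_conv_nth)
    have "{(a # b # t @ [x, y]) ! i, (a # b # t @ [x, y]) ! (i + 1), (a # b # t @ [x, y]) ! (i + 2)} \<in> E"
      using t(4) i unfolding tw_iff by auto
    moreover have "(a # b # t @ [x, y]) ! (i + 2) = z" using i by (simp add: nth_append)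
    ultimately show "z \<in> V" using edgeD by metis
  qed
  ultimately show ?thesis
    using bs YV by (intro exI[of _ "bs @ [t]"]) auto
qed

lemma absorb_all:
  assumes "cyc E (concat bs)" "set (concat bs) \<subseteq> V" "finite G" "G \<subseteq> set bs" "\<And>g. g \<in> G \<Longrightarrow> length g = 5"
    and "\<And>v. v \<in> V \<Longrightarrow> (\<Sum>u\<in>V - set (concat bs). lev u) \<le> card {g \<in> G. absorbs v g}"
  shows "\<exists>xs. set xs = V \<and> cyc E xs"
  using assms
proof (induction "\<Sum>u\<in>V - set (concat bs). lev u" arbitrary: bs G rule: less_induct)
  case (less bs G)
  let ?w = "\<lambda>bs. \<Sum>u\<in>V - set (concat bs). lev u"
  show ?case
  proof (cases "V \<subseteq> set (concat bs)")
    case True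
    thus ?thesis using less.prems by (intro exI[of _ "concat bs"]) auto
  next
    case False
    then obtain v where v: "v \<in> V" "v \<notin> set (concat bs)" by blast
    have lev1: "1 \<le> lev v" by (simp add: lev_def)
    have wv: "?w bs = lev v + (\<Sum>u\<in>V - set (concat bs) - {v}. lev u)"
      using v by (intro sum.remove) auto
    hence "1 \<le> card {g \<in> G. absorbs v g}" using less.prems(6)[OF v(1)] lev1 by linarith
    hence "{g \<in> G. absorbs v g} \<noteq> {}" by (metis card.empty not_one_le_zero)
    then obtain g where g: "g \<in> G" "absorbs v g" by blast
    obtain a b u c d where gg: "g = [a, b, u, c, d]"
      using less.prems(5)[OF g(1)] by (auto simp: length_Suc_conv numeral_eq_Suc)
    obtain b1 b2 where bs: "bs = b1 @ g # b2"
      using g(1) less.prems(4) by (meson in_set_conv_decomp subsetD)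
    have dist: "distinct (concat b1 @ a # b # [u] @ c # d # concat b2)"
      using less.prems(1) by (simp add: cyc_def bs gg)
    have cyc0: "cyc E (concat b1 @ a # b # [u] @ c # d # concat b2)"
      using less.prems(1) by (simp add: bs gg)
    have vnot: "v \<notin> set (concat b1) \<union> set (concat b2) \<union> {a, b, u, c, d}"
      using v(2) by (auto simp: bs gg)
    \<comment> \<open>\<open>M\<close> will be \<open>[v, u]\<close> for an insertion and
      \<open>[v]\<close> for an exchange, which leaves \<open>u\<close> uncovered in place of
      \<open>v\<close>.\<close>
    have step: ?thesis if M: "tw E (a # b # M @ [c, d])" "distinct M" "set M \<subseteq> {u, v}"
      and w: "?w (b1 @ (a # b # M @ [c, d]) # b2) < ?w bs" for M
    proof (rule less.hyps[of "b1 @ (a # b # M @ [c, d]) # b2" "G - {g}"])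
      let ?bs = "b1 @ (a # b # M @ [c, d]) # b2"
      show "?w ?bs < ?w bs" by (rule w)
      have "distinct (concat b1 @ a # b # M @ c # d # concat b2)"
        using dist vnot M(2,3) by auto
      thus "cyc E (concat ?bs)" using cyc_replace[OF cyc0 M(1)] by simp
      show "set (concat ?bs) \<subseteq> V" using less.prems(2) M(3) v(1) by (auto simp: bs gg)
      show "finite (G - {g})" using less.prems(3) by simp
      show "G - {g} \<subseteq> set ?bs" using less.prems(4) by (auto simp: bs)
      show "length h = 5" if "h \<in> G - {g}" for h using that less.prems(5) by auto
      show "?w ?bs \<le> card {h \<in> G - {g}. absorbs z h}" if "z \<in> V" for z
      proof -
        have "?w bs \<le> card {h \<in> G. absorbs z h}" by (rule less.prems(6)[OF that])
        also have "\<dots> \<le> card (insert g {h \<in> G - {g}. absorbs z h})"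
          using less.prems(3) by (intro card_mono) auto
        also have "\<dots> \<le> Suc (card {h \<in> G - {g}. absorbs z h})" by (rule card_insert_le_m1) auto
        finally show ?thesis using w by linarith
      qed
    qed
    show ?thesis
    proof (cases "v \<in> W")
      case True
      have "V - set (concat (b1 @ (a # b # [v, u] @ [c, d]) # b2)) = V - set (concat bs) - {v}"
        by (auto simp: bs gg)
      hence "?w (b1 @ (a # b # [v, u] @ [c, d]) # b2) < ?w bs" using wv lev1 by simp
      moreover have "tw E (a # b # [v, u] @ [c, d])" using g True by (simp add: absorbs_def gg)
      ultimately show ?thesis using vnot by (intro step[of "[v, u]"]) auto
    next
      case False
      have "V - set (concat (b1 @ (a # b # [v] @ [c, d]) # b2)) = insert u (V - set (concat bs) - {v})"
        using dist vnot less.prems(2) by (auto simp: bs gg)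
      moreover have "u \<notin> V - set (concat bs) - {v}" by (auto simp: bs gg)
      ultimately have "?w (b1 @ (a # b # [v] @ [c, d]) # b2) = lev u + (\<Sum>u\<in>V - set (concat bs) - {v}. lev u)"
        by simp
      moreover have "lev u < lev v"
        using g False v(1) by (intro lev_swap) (auto simp: absorbs_def gg numeral_2_eq_2)
      moreover have "tw E (a # b # [v] @ [c, d])" using g False by (simp add: absorbs_def gg numeral_3_eq_3 numeral_2_eq_2 eval_nat_numeral)
      ultimately show ?thesis using wv by (intro step[of "[v]"]) auto
    qed
  qed
qed

end

section \<open>Light tight paths\<close>

text \<open>A subgraph maximising (number of edges) - \<open>g\<close> * (size of the shadow) has the property that every
  pair in its shadow has degree at least \<open>g\<close>, so that tight paths can be extended greedily.\<close>

lemma dense_imp_core: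
  fixes F :: "nat set set"
  assumes U: "finite U" and F: "\<And>e. e \<in> F \<Longrightarrow> e \<subseteq> U \<and> card e = 3" and g: "g * card U ^ 2 < card F"
  shows "\<exists>X\<subseteq>F. X \<noteq> {} \<and> (\<forall>e\<in>X. \<forall>p\<subseteq>e. card p = 2 \<longrightarrow> g \<le> card {e' \<in> X. p \<subseteq> e'})"
proof -
  define sh where "sh X = {p. card p = 2 \<and> (\<exists>e\<in>X. p \<subseteq> e)}" for X :: "nat set set"
  define f where "f X = int (card X) - int g * int (card (sh X))" for X
  have finF: "finite F" using U F by (intro finite_subset[of F "Pow U"]) auto
  have sh_sub: "sh X \<subseteq> (\<lambda>(x, y). {x, y}) ` (U \<times> U)" if XF: "X \<subseteq> F" for X
  proof
    fix p assume "p \<in> sh X"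
    then obtain e where "card p = 2" "p \<subseteq> e" "e \<in> F" using XF by (auto simp: sh_def)
    thus "p \<in> (\<lambda>(x, y). {x, y}) ` (U \<times> U)" using F[of e] by (auto simp: card_2_iff)
  qed
  have finsh: "finite (sh X)" if "X \<subseteq> F" for X
    using sh_sub[OF that] U by (auto intro: finite_subset)
  have "card (sh F) \<le> card (U \<times> U)"
    using sh_sub[of F] U by (intro surj_card_le) auto
  hence "card (sh F) \<le> card U ^ 2" by (simp add: card_cartesian_product power2_eq_square)
  hence "g * card (sh F) < card F" using g by (meson le_less_trans mult_le_mono2)
  hence fF: "0 < f F" by (simp add: f_def flip: of_nat_mult)
  have "finite (f ` Pow F)" using finF by simp
  moreover have "f ` Pow F \<noteq> {}" by auto
  ultimately have "Max (f ` Pow F) \<in> f ` Pow F" by (rule Max_in)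
  then obtain X where X: "X \<subseteq> F" "f X = Max (f ` Pow F)" by (auto simp: eq_commute)
  have maxX: "f Y \<le> f X" if "Y \<subseteq> F" for Y
    unfolding X(2) using that finF by (intro Max_ge) auto
  have finX: "finite X" using X finF finite_subset by blast
  have "X \<noteq> {}"
  proof
    assume "X = {}"
    hence "f X = 0" by (simp add: f_def sh_def)
    thus False using maxX[of F] fF by simp
  qed
  moreover have "g \<le> card {e' \<in> X. p \<subseteq> e'}" if e: "e \<in> X" "p \<subseteq> e" "card p = 2" for e p
  proof (rule ccontr)
    assume small: "\<not> ?thesis"
    \<comment> \<open>Deleting the triples over \<open>p\<close> loses fewer than \<open>g\<close>
      triples but frees the shadow pair \<open>p\<close>, worth \<open>g\<close>, so
      \<open>f\<close> would increase.\<close>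
    define Y where "Y = X - {e' \<in> X. p \<subseteq> e'}"
    have "card Y = card X - card {e' \<in> X. p \<subseteq> e'}" unfolding Y_def using finX by (intro card_Diff_subset) auto
    moreover have "card {e' \<in> X. p \<subseteq> e'} \<le> card X" using finX by (intro card_mono) auto
    ultimately have cY: "int (card X) - int g < int (card Y)" using small by linarith
    have "sh Y \<subseteq> sh X - {p}" by (auto simp: sh_def Y_def)
    hence "card (sh Y) \<le> card (sh X - {p})" using finsh[OF X(1)] by (intro card_mono) auto
    moreover have "p \<in> sh X" using e by (auto simp: sh_def)
    ultimately have "card (sh Y) + 1 \<le> card (sh X)"
      using finsh[OF X(1)] by (metis Suc_eq_plus1 Suc_leI card_Diff1_less le_less_trans)
    hence "int g * (int (card (sh Y)) + 1) \<le> int g * int (card (sh X))" by (intro mult_left_mono) auto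
    hence "f X < f Y" using cY by (simp add: f_def algebra_simps)
    moreover have "Y \<subseteq> F" using X by (auto simp: Y_def)
    ultimately show False using maxX[of Y] by linarith
  qed
  ultimately show ?thesis using X(1) by blast
qed

text \<open>The last pair is kept inside a triple of the core and so has at least \<open>g\<close>
  continuations; at most \<open>l\<close> of them lead back to the \<open>l\<close> vertices used so
  far, which is less than \<open>g\<close> as long as the path has to grow.\<close>

lemma dense_imp_tight_path:
  fixes F :: "nat set set"
  assumes U: "finite U" and F: "\<And>e. e \<in> F \<Longrightarrow> e \<subseteq> U \<and> card e = 3" and g: "g * card U ^ 2 < card F"
    and l: "2 \<le> l" "l \<le> g"
  shows "\<exists>xs. distinct xs \<and> set xs \<subseteq> U \<and> length xs = l \<and> tw F xs"
proof -
  obtain X where X: "X \<subseteq> F" "X \<noteq> {}" "\<And>e p. e \<in> X \<Longrightarrow> p \<subseteq> e \<Longrightarrow> card p = 2 \<Longrightarrow> g \<le> card {e' \<in> X. p \<subseteq> e'}"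
    using dense_imp_core[OF U F g] by metis
  have "\<exists>r a b. length r + 2 = l \<and> distinct (r @ [a, b]) \<and> set (r @ [a, b]) \<subseteq> U \<and> tw F (r @ [a, b]) \<and> (\<exists>e\<in>X. {a, b} \<subseteq> e)"
    using l
  proof (induction l rule: nat_induct_at_least)
    case base
    obtain e where e: "e \<in> X" using X by auto
    hence "card e = 3" using X F by blast
    then obtain a b c where "e = {a, b, c}" "a \<noteq> b" by (auto simp: card_3_iff)
    thus ?case using e X(1) F by (intro exI[of _ "[]"] exI[of _ a] exI[of _ b]) auto
  next
    case (Suc l)
    then obtain r a b e where r: "length r + 2 = l" "distinct (r @ [a, b])" "set (r @ [a, b]) \<subseteq> U"
      "tw F (r @ [a, b])" "e \<in> X" "{a, b} \<subseteq> e" by auto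
    let ?D = "{e' \<in> X. {a, b} \<subseteq> e'}"
    have "a \<noteq> b" using r(2) by auto
    hence "g \<le> card ?D" using X(3)[OF r(5,6)] by simp
    hence "l < card ?D" using Suc.prems by simp
    moreover have "card ((\<lambda>z. {a, b, z}) ` set (r @ [a, b])) \<le> l"
      using card_image_le[of "set (r @ [a, b])" "\<lambda>z. {a, b, z}"] card_length[of "r @ [a, b]"] r(1) by simp
    ultimately have "\<not> ?D \<subseteq> (\<lambda>z. {a, b, z}) ` set (r @ [a, b])"
      using card_mono[of "(\<lambda>z. {a, b, z}) ` set (r @ [a, b])" ?D] by (meson List.finite_set finite_imageI leD le_less_trans)
    then obtain e' where e': "e' \<in> X" "{a, b} \<subseteq> e'" "e' \<notin> (\<lambda>z. {a, b, z}) ` set (r @ [a, b])" by blast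
    have c3: "card e' = 3" "e' \<subseteq> U" using e' X(1) F by auto
    have "card (e' - {a, b}) = 1" using e'(2) c3 \<open>a \<noteq> b\<close> by (subst card_Diff_subset) auto
    then obtain z where z: "e' - {a, b} = {z}" by (auto simp: card_1_singleton_iff)
    hence ez: "e' = {a, b, z}" using e'(2) by blast
    have "z \<notin> set (r @ [a, b])" using e'(3) unfolding ez by blast
    moreover have "tw F (r @ [a, b, z])"
      using r(4) e'(1) X(1) ez by (intro tw_join[THEN iffD2]) auto
    moreover have "z \<in> U" using ez c3 by auto
    moreover have "length (r @ [a]) + 2 = Suc l" "distinct (r @ [a, b, z])" "{b, z} \<subseteq> e'"
      using r(1,2) ez calculation(1) by auto
    moreover have "set (r @ [a, b, z]) \<subseteq> U" using r(3) calculation(3) by simp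
    moreover have "(r @ [a]) @ [b, z] = r @ [a, b, z]" by simp
    ultimately show ?case using e'(1) by metis
  qed
  then obtain r a b where "length r + 2 = l \<and> distinct (r @ [a, b]) \<and> set (r @ [a, b]) \<subseteq> U \<and> tw F (r @ [a, b])" by blast
  thus ?thesis by (intro exI[of _ "r @ [a, b]"]) auto
qed

lemma card_rank_le:
  fixes U :: "nat set" and r :: real
  assumes "finite U" "0 \<le> r"
  shows "real (card {x \<in> U. real (card {z \<in> U. z \<le> x}) \<le> r}) \<le> r"
proof (cases "{x \<in> U. real (card {z \<in> U. z \<le> x}) \<le> r} = {}")
  case True
  thus ?thesis using assms by (metis card.empty of_nat_0)
next
  case False
  let ?S = "{x \<in> U. real (card {z \<in> U. z \<le> x}) \<le> r}"
  have fin: "finite ?S" using assms by simp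
  have "Max ?S \<in> ?S" using fin False by (rule Max_in)
  moreover have "?S \<subseteq> {z \<in> U. z \<le> Max ?S}" using fin by auto
  hence "card ?S \<le> card {z \<in> U. z \<le> Max ?S}" using assms by (intro card_mono) auto
  ultimately show ?thesis by fastforce
qed

text \<open>Sort \<open>U\<close> by weight. If the \<open>p\<close>-th lightest vertex and the \<open>p\<close>-th heaviest vertex satisfy
  \<open>w (u (N - 1 - p)) \<le> \<epsilon> - 2 * w (u p)\<close>, then the vertices of rank greater than \<open>p - 2\<delta>N\<close> among the
  \<open>p\<close> lightest ones span many light triples; if this fails for all \<open>p\<close>, the total weight is
  positive.\<close>

lemma many_light_triples:
  fixes U :: "nat set" and w :: "nat \<Rightarrow> real" and D :: "nat \<Rightarrow> nat \<Rightarrow> nat set"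
  defines "rk \<equiv> \<lambda>x. real (card {z \<in> U. z \<le> x})"
  assumes U: "finite U" and w: "\<And>x. x \<in> U \<Longrightarrow> \<bar>w x\<bar> \<le> 1" "(\<Sum>x\<in>U. w x) \<le> 0"
    and \<epsilon>: "0 < \<epsilon>" "\<epsilon> \<le> 1" "40 \<le> \<epsilon> * real (card U)" and \<delta>: "\<delta> = \<epsilon> / 32"
    and D: "\<And>x y. D x y \<subseteq> U"
    and deg: "\<And>x y. x \<in> U \<Longrightarrow> y \<in> U \<Longrightarrow> x \<noteq> y \<Longrightarrow>
      min (min (rk x) (rk y)) (real (card U) / 2) + 4 * \<delta> * real (card U) \<le> real (card (D x y))"
  shows "8 * \<delta> ^ 3 * real (card U) ^ 3 \<le>
    real (card {(x, y, z). x \<in> U \<and> y \<in> U \<and> x \<noteq> y \<and> z \<in> D x y \<and> w x + w y + w z \<le> \<epsilon>})"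
proof -
  define N where "N = card U"
  define us where "us = sort_key w (sorted_list_of_set U)"
  define u where "u p = us ! p" for p
  have us: "set us = U" "distinct us" "length us = N" "sorted (map w us)"
    using U by (auto simp: us_def N_def)
  have mono: "w (u p) \<le> w (u q)" if "p \<le> q" "q < N" for p q
    using sorted_nth_mono[OF us(4), of p q] that us(3) by (simp add: u_def)
  have bij: "bij_betw u {..<N} U"
    using bij_betw_nth[OF us(2), of "{..<N}" U] us by (simp add: u_def[abs_def])
  have uU: "u p \<in> U" if "p < N" for p using that us by (simp add: u_def flip: us(1))
  have d0: "0 < \<delta>" using \<epsilon> \<delta> by simp
  define c where "c = 2 * \<delta> * real N"
  have c0: "0 \<le> c" using d0 by (simp add: c_def)
  have "\<exists>p. c \<le> real p \<and> 2 * p < N \<and> w (u (N - 1 - p)) \<le> \<epsilon> - 2 * w (u p)"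
  proof (rule ccontr)
    assume "\<not> ?thesis"
    hence *: "\<epsilon> - 2 * w (u p) < w (u (N - 1 - p))" if "c \<le> real p" "2 * p < N" for p
      using that by (meson not_le)
    \<comment> \<open>Let a \<le> b be the two weights. Failure means b > \<epsilon> - 2a, that is a
      + b > \<epsilon> - a; either a \<le> \<epsilon>/2 and this suffices, or both weights exceed
      \<epsilon>/2.\<close>
    have low: "\<epsilon> / 2 \<le> w (u p) + w (u (N - 1 - p))" if "c \<le> real p" "2 * p < N" for p
    proof (cases "w (u p) \<le> \<epsilon> / 2")
      case True
      thus ?thesis using *[OF that] by linarith
    next
      case False
      moreover have "w (u p) \<le> w (u (N - 1 - p))" using that by (intro mono) auto
      ultimately show ?thesis using \<epsilon> by linarith
    qed
    \<comment> \<open>Positions fewer than \<open>c\<close> steps from an end, about which nothing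
      is known. Two weights sum to at least -2 there, and \<epsilon>/2 - 5/2 \<le> -2 because
      \<epsilon> \<le> 1.\<close>
    define bad where "bad = {p \<in> {..<N}. real p < c} \<union> {p \<in> {..<N}. real (N - 1 - p) < c}"
    have pair: "\<epsilon> / 2 - (if p \<in> bad then 5 / 2 else 0) \<le> w (u p) + w (u (N - 1 - p))" if p: "p < N" for p
    proof (cases "p \<in> bad")
      case True
      have "\<bar>w (u p)\<bar> \<le> 1" "\<bar>w (u (N - 1 - p))\<bar> \<le> 1" using p by (auto intro!: w uU)
      thus ?thesis using True \<epsilon> by simp
    next
      case False
      show ?thesis
      proof (cases "2 * p < N")
        case True
        thus ?thesis using low[of p] False p by (auto simp: bad_def)
      next
        case f: False
        have "N - 1 - (N - 1 - p) = p" "2 * (N - 1 - p) < N" using p f by linarith+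
        thus ?thesis using low[of "N - 1 - p"] False p f by (auto simp: bad_def)
      qed
    qed
    have cb: "real (card bad) \<le> 2 * (c + 1)"
    proof -
      have 1: "card {p \<in> {..<N}. real p < c} \<le> nat \<lceil>c\<rceil>"
      proof -
        have "{p \<in> {..<N}. real p < c} \<subseteq> {..<nat \<lceil>c\<rceil>}"
        proof
          fix p assume "p \<in> {p \<in> {..<N}. real p < c}"
          hence "real p < c" by simp
          hence "p < nat \<lceil>c\<rceil>" by linarith
          thus "p \<in> {..<nat \<lceil>c\<rceil>}" by simp
        qed
        hence "card {p \<in> {..<N}. real p < c} \<le> card {..<nat \<lceil>c\<rceil>}" by (intro card_mono) auto
        thus ?thesis by simp
      qed
      have "card {p \<in> {..<N}. real (N - 1 - p) < c} = card {p \<in> {..<N}. real p < c}"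
        by (rule bij_betw_same_card[of "\<lambda>p. N - 1 - p"], rule bij_betwI[of _ _ _ "\<lambda>p. N - 1 - p"]) auto
      hence "card bad \<le> 2 * nat \<lceil>c\<rceil>" unfolding bad_def
        using card_Un_le[of "{p \<in> {..<N}. real p < c}" "{p \<in> {..<N}. real (N - 1 - p) < c}"] 1 by linarith
      hence "real (card bad) \<le> 2 * real (nat \<lceil>c\<rceil>)"
        by (metis of_nat_le_iff of_nat_mult of_nat_numeral)
      moreover have "real (nat \<lceil>c\<rceil>) \<le> c + 1" using c0 by linarith
      ultimately show ?thesis by argo
    qed
    have S: "(\<Sum>p<N. w (u p)) = (\<Sum>x\<in>U. w x)" by (rule sum.reindex_bij_betw[OF bij])
    have "(\<Sum>p<N. w (u (N - 1 - p))) = (\<Sum>p<N. w (u p))"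
      by (rule sum.reindex_bij_betw[of _ "{..<N}" "{..<N}" "\<lambda>p. w (u p)"], rule bij_betwI[of _ _ _ "\<lambda>p. N - 1 - p"]) auto
    hence "(\<Sum>p<N. w (u p) + w (u (N - 1 - p))) \<le> 0" using S w(2) by (simp add: sum.distrib)
    moreover have "(\<Sum>p<N. \<epsilon> / 2 - (if p \<in> bad then 5 / 2 else 0)) \<le> (\<Sum>p<N. w (u p) + w (u (N - 1 - p)))"
      by (intro sum_mono pair) auto
    moreover have "(\<Sum>p<N. \<epsilon> / 2 - (if p \<in> bad then 5 / 2 else 0)) = real N * (\<epsilon> / 2) - real (card bad) * (5 / 2)"
    proof -
      have "{..<N} \<inter> bad = bad" by (auto simp: bad_def)
      thus ?thesis by (simp add: sum_subtractf sum.If_cases Int_def)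
    qed
    moreover have "c = \<epsilon> * real N / 16" by (simp add: c_def \<delta>)
    \<comment> \<open>Of \<epsilon>N/2 the bad positions cost at most 5c + 5 = 5\<epsilon>N/16 + 5,
      and the rest 3\<epsilon>N/16 - 5 is positive since \<epsilon>N \<ge> 40.\<close>
    ultimately show False using cb \<epsilon>(3) unfolding N_def[symmetric] by (simp add: algebra_simps)
  qed
  then obtain p where p: "c \<le> real p" "2 * p < N" "w (u (N - 1 - p)) \<le> \<epsilon> - 2 * w (u p)" by blast
  \<comment> \<open>Of the \<open>p + 1\<close> lightest vertices at most \<open>p - c\<close> have
    rank at most \<open>p - c\<close>, so \<open>c + 1\<close> remain; the extra one lets
    \<open>y\<close> differ from \<open>x\<close>.\<close>
  define T where "T = {x \<in> u ` {..p}. real p - c < rk x}"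
  have TU: "T \<subseteq> U" using p uU by (auto simp: T_def)
  have finT: "finite T" by (simp add: T_def)
  have cT: "c + 1 \<le> real (card T)"
  proof -
    have "u ` {..p} \<subseteq> T \<union> {x \<in> U. rk x \<le> real p - c}"
      using uU p by (auto simp: T_def)
    hence "card (u ` {..p}) \<le> card T + card {x \<in> U. rk x \<le> real p - c}"
      using finT U by (intro order.trans[OF card_mono card_Un_le]) auto
    moreover have "card (u ` {..p}) = p + 1"
      using p bij by (subst card_image) (auto simp: bij_betw_def intro: inj_on_subset)
    moreover have "real (card {x \<in> U. rk x \<le> real p - c}) \<le> real p - c"
      unfolding rk_def using U p(1) by (intro card_rank_le) auto
    ultimately show ?thesis by linarith
  qed
  define Z where "Z x y = {z \<in> D x y. w x + w y + w z \<le> \<epsilon>}" for x y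
  have finD: "finite (D x y)" for x y using D U finite_subset by blast
  hence finZ: "finite (Z x y)" for x y by (simp add: Z_def)
  \<comment> \<open>As 4\<delta>N is 2c, the degree is at least (p - c) + 2c = p + c, and only
    \<open>p\<close> vertices stand behind position \<open>N - 1 - p\<close>; the other
    \<open>c\<close> choices of \<open>z\<close> give light triples.\<close>
  have cZ: "c \<le> real (card (Z x y))" if xy: "x \<in> T" "y \<in> T" "x \<noteq> y" for x y
  proof -
    have "real p - c \<le> min (min (rk x) (rk y)) (real N / 2)" using xy p c0 by (auto simp: T_def)
    moreover have "min (min (rk x) (rk y)) (real N / 2) + 2 * c \<le> real (card (D x y))"
      using deg[of x y] xy TU unfolding N_def[symmetric] c_def by (auto simp: algebra_simps)
    ultimately have 1: "real p + c \<le> real (card (D x y))" by linarith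
    have "D x y \<subseteq> Z x y \<union> u ` {N - p..<N}"
    proof
      fix z assume z: "z \<in> D x y"
      then obtain j where j: "j < N" "z = u j" using D bij by (force simp: bij_betw_def)
      show "z \<in> Z x y \<union> u ` {N - p..<N}"
      proof (cases "z \<in> Z x y")
        case False
        have "w x \<le> w (u p)" "w y \<le> w (u p)" using xy p by (auto simp: T_def intro: mono)
        hence "w (u (N - 1 - p)) < w (u j)" using False z j p(3) by (auto simp: Z_def)
        hence "\<not> j \<le> N - 1 - p" using mono[of j "N - 1 - p"] j p by fastforce
        thus ?thesis using j by auto
      qed simp
    qed
    hence "card (D x y) \<le> card (Z x y) + card (u ` {N - p..<N})"
      using finZ by (intro order.trans[OF card_mono card_Un_le]) auto
    moreover have "card (u ` {N - p..<N}) \<le> p" using card_image_le[of "{N - p..<N}" u] by simp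
    ultimately show ?thesis using 1 by linarith
  qed
  let ?R = "{(x, y, z). x \<in> U \<and> y \<in> U \<and> x \<noteq> y \<and> z \<in> D x y \<and> w x + w y + w z \<le> \<epsilon>}"
  have "8 * \<delta> ^ 3 * real (card U) ^ 3 = c * (c * c)" by (simp add: c_def N_def power3_eq_cube)
  also have "\<dots> \<le> real (card T) * (c * c)" using cT c0 by (intro mult_right_mono) auto
  also have "\<dots> \<le> real (card (SIGMA x:T. SIGMA y:T - {x}. Z x y))"
  proof (rule card_Sigma_ge)
    fix x assume x: "x \<in> T"
    have "c * c \<le> real (card (T - {x})) * c"
      using cT c0 x finT by (intro mult_right_mono) (auto simp: card_Diff_singleton)
    also have "\<dots> \<le> real (card (SIGMA y:T - {x}. Z x y))"
      using finT finZ cZ x by (intro card_Sigma_ge) auto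
    finally show "c * c \<le> real (card (SIGMA y:T - {x}. Z x y))" .
  qed (use finT finZ in auto)
  also have "\<dots> \<le> real (card ?R)"
  proof -
    have "?R \<subseteq> U \<times> U \<times> U" using D by blast
    hence "finite ?R" by (rule finite_subset) (use U in simp)
    moreover have "(SIGMA x:T. SIGMA y:T - {x}. Z x y) \<subseteq> ?R" using TU by (auto simp: Z_def)
    ultimately show ?thesis by (intro of_nat_mono card_mono)
  qed
  finally show ?thesis .
qed

section \<open>Balanced packing of paths\<close>

text \<open>A path on 3m vertices splits into m disjoint consecutive triples, each an edge of
  \<open>F\<close>; hence the path lengths divisible by three.\<close>

lemma light_path_sum:
  assumes "length xs = 3 * m" "distinct xs" "tw F xs" "\<And>e. e \<in> F \<Longrightarrow> card e = 3 \<and> (\<Sum>x\<in>e. w x) \<le> (\<epsilon>::real)"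
  shows "(\<Sum>x\<in>set xs. w x) \<le> \<epsilon> * real m"
  using assms(1-3)
proof (induction m arbitrary: xs)
  case 0 thus ?case by simp
next
  case (Suc m)
  then obtain x y z r where xs: "xs = x # y # z # r" "length r = 3 * m"
    by (auto simp: length_Suc_conv numeral_3_eq_3)
  have "tw F ([x, y, z] @ r)" using Suc.prems xs by simp
  hence "tw F r" by (rule tw_appendD2)
  hence "(\<Sum>x\<in>set r. w x) \<le> \<epsilon> * real m" using Suc xs by auto
  moreover have "(\<Sum>v\<in>{x, y, z}. w v) \<le> \<epsilon>" using assms(4)[of "{x, y, z}"] Suc.prems(3) xs by auto
  hence "w x + w y + w z \<le> \<epsilon>" using Suc.prems(2) xs by auto
  ultimately show ?case using Suc.prems(2) xs by (auto simp: algebra_simps)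
qed

lemma card_triples_le:
  fixes F :: "nat set set"
  assumes F: "finite F" "\<And>e. e \<in> F \<Longrightarrow> card e = 3" and R: "\<And>x y z. (x, y, z) \<in> R \<Longrightarrow> {x, y, z} \<in> F"
  shows "card R \<le> 27 * card F"
proof -
  have fe: "finite e" if "e \<in> F" for e using F(2)[OF that] by (metis card.infinite zero_neq_numeral)
  have "R \<subseteq> (\<Union>e\<in>F. e \<times> e \<times> e)"
  proof
    fix t assume t: "t \<in> R"
    obtain x y z where "t = (x, y, z)" by (cases t)
    thus "t \<in> (\<Union>e\<in>F. e \<times> e \<times> e)" using R[of x y z] t by blast
  qed
  hence "card R \<le> card (\<Union>e\<in>F. e \<times> e \<times> e)" using F fe by (intro card_mono) auto
  also have "\<dots> \<le> (\<Sum>e\<in>F. card (e \<times> e \<times> e))" by (rule card_UN_le) (rule F)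
  also have "\<dots> = (\<Sum>e\<in>F. 27)" using F by (intro sum.cong) (auto simp: card_cartesian_product)
  finally show ?thesis by simp
qed

lemma light_tight_path:
  fixes U :: "nat set" and w :: "nat \<Rightarrow> real"
  assumes E: "\<And>e. e \<in> E \<Longrightarrow> card e = 3" and U: "finite U"
    and w: "\<And>x. x \<in> U \<Longrightarrow> \<bar>w x\<bar> \<le> 1" "(\<Sum>x\<in>U. w x) \<le> 0"
    and \<epsilon>: "0 < \<epsilon>" "\<epsilon> \<le> 1" "40 \<le> \<epsilon> * real (card U)" and \<delta>: "\<delta> = \<epsilon> / 32"
    and m: "0 < m" "27 * (3 * real m) < 8 * \<delta> ^ 3 * real (card U)"
    and deg: "\<And>x y. x \<in> U \<Longrightarrow> y \<in> U \<Longrightarrow> x \<noteq> y \<Longrightarrow>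
      min (min (real (card {z \<in> U. z \<le> x})) (real (card {z \<in> U. z \<le> y}))) (real (card U) / 2)
        + 4 * \<delta> * real (card U) \<le> real (card {z \<in> U. {x, y, z} \<in> E})"
  shows "\<exists>xs. distinct xs \<and> set xs \<subseteq> U \<and> length xs = 3 * m \<and> tw E xs \<and> (\<Sum>x\<in>set xs. w x) \<le> \<epsilon> * real m"
proof -
  let ?N = "real (card U)"
  define F where "F = {e \<in> E. e \<subseteq> U \<and> (\<Sum>x\<in>e. w x) \<le> \<epsilon>}"
  let ?R = "{(x, y, z). x \<in> U \<and> y \<in> U \<and> x \<noteq> y \<and> z \<in> {z \<in> U. {x, y, z} \<in> E} \<and> w x + w y + w z \<le> \<epsilon>}"
  have "8 * \<delta> ^ 3 * ?N ^ 3 \<le> real (card ?R)"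
    by (rule many_light_triples[OF U w \<epsilon> \<delta> _ deg]) auto
  moreover have "card ?R \<le> 27 * card F"
  proof (rule card_triples_le)
    have "F \<subseteq> Pow U" by (auto simp: F_def)
    thus "finite F" using U by (simp add: finite_subset)
    show "card e = 3" if "e \<in> F" for e using that E by (auto simp: F_def)
    fix x y z assume "(x, y, z) \<in> ?R"
    hence *: "{x, y, z} \<in> E" "{x, y, z} \<subseteq> U" "w x + w y + w z \<le> \<epsilon>" by auto
    hence "card {x, y, z} = 3" using E by blast
    hence "x \<noteq> y" "y \<noteq> z" "x \<noteq> z" by (auto simp: card_insert_if split: if_splits)
    thus "{x, y, z} \<in> F" using * by (auto simp: F_def algebra_simps)
  qed
  ultimately have F1: "8 * \<delta> ^ 3 * ?N ^ 3 \<le> 27 * real (card F)" by linarith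
  have "0 < ?N" using \<epsilon> by (cases "card U") auto
  hence "27 * (3 * real m) * ?N ^ 2 < 8 * \<delta> ^ 3 * ?N * ?N ^ 2" using m by (intro mult_strict_right_mono) auto
  also have "\<dots> = 8 * \<delta> ^ 3 * ?N ^ 3" by (simp add: power3_eq_cube power2_eq_square)
  finally have "real (3 * m) * ?N ^ 2 < real (card F)" using F1 by simp
  hence "3 * m * card U ^ 2 < card F" by (metis of_nat_less_iff of_nat_mult of_nat_power)
  then obtain xs where xs: "distinct xs" "set xs \<subseteq> U" "length xs = 3 * m" "tw F xs"
    using dense_imp_tight_path[OF U, of F "3 * m" "3 * m"] E m by (auto simp: F_def)
  have "(\<Sum>x\<in>set xs. w x) \<le> \<epsilon> * real m"
    using E by (intro light_path_sum[OF xs(3,1,4)]) (auto simp: F_def)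
  moreover have "tw E xs" using xs(4) by (auto simp: tw_iff F_def)
  ultimately show ?thesis using xs by blast
qed

section \<open>Second-order bounds for exp and cosh\<close>

lemma exp_le_quadratic:
  fixes z :: real
  assumes "\<bar>z\<bar> \<le> 1"
  shows "exp z \<le> 1 + z + z\<^sup>2"
proof (cases "0 \<le> z")
  case True
  thus ?thesis using exp_bound[of z] assms by auto
next
  case False
  define u where "u = - z"
  have u: "0 < u" "u \<le> 1" using False assms by (auto simp: u_def)
  have a: "1 + u + u\<^sup>2 / 2 \<le> exp u" using exp_lower_Taylor_quadratic[of u] u by simp
  have b: "0 < 1 - u + u\<^sup>2" using u by (simp add: add_pos_pos add_nonneg_pos power2_eq_square)
  have "(1 - u + u\<^sup>2) * (1 + u + u\<^sup>2 / 2) = 1 + (u\<^sup>2 + u ^ 3 + u ^ 4) / 2"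
    by (simp add: field_simps power2_eq_square power3_eq_cube power4_eq_xxxx)
  hence "1 \<le> (1 - u + u\<^sup>2) * (1 + u + u\<^sup>2 / 2)" using u by simp
  also have "\<dots> \<le> (1 - u + u\<^sup>2) * exp u" using a b by (intro mult_left_mono) auto
  finally have "1 / exp u \<le> 1 - u + u\<^sup>2" by (simp add: divide_le_eq)
  thus ?thesis by (simp add: u_def exp_minus field_simps)
qed

text \<open>The linear term keeps its sign and is what a light path controls; the quadratic term is
  the growth that has to be paid for at every step.\<close>

lemma cosh_step:
  fixes x y :: real
  assumes "\<bar>y\<bar> \<le> 1"
  shows "cosh (x + y) \<le> cosh x * (1 + y\<^sup>2) + sinh x * y"
proof -
  have 1: "exp x * exp y \<le> exp x * (1 + y + y\<^sup>2)"
    using exp_le_quadratic[OF assms] by (intro mult_left_mono) auto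
  have "exp (- y) \<le> 1 - y + y\<^sup>2" using exp_le_quadratic[of "- y"] assms by simp
  hence 2: "exp (- x) * exp (- y) \<le> exp (- x) * (1 - y + y\<^sup>2)" by (intro mult_left_mono) auto
  have "cosh (x + y) = (exp x * exp y + exp (- x) * exp (- y)) / 2"
    by (simp add: cosh_def exp_add[symmetric] algebra_simps)
  also have "\<dots> \<le> (exp x * (1 + y + y\<^sup>2) + exp (- x) * (1 - y + y\<^sup>2)) / 2"
    using 1 2 by (intro divide_right_mono add_mono) auto
  also have "\<dots> = cosh x * (1 + y\<^sup>2) + sinh x * y" by (simp add: cosh_def sinh_def field_simps)
  finally show ?thesis .
qed

lemma abs_sinh_le_cosh: "\<bar>sinh x\<bar> \<le> cosh (x::real)"
  by (simp add: sinh_def cosh_def abs_le_iff field_simps add_pos_pos less_imp_le)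

lemma exp_abs_le_cosh: "exp \<bar>x\<bar> / 2 \<le> cosh (x::real)"
  by (cases "0 \<le> x") (simp_all add: cosh_def)

text \<open>Multiplicative weights: as long as a path that is light with respect to the weights
  \<open>\<Sum>\<^sub>j sinh (\<lambda> x\<^sub>j) f\<^sub>j\<close> can be removed, the discrepancies \<open>x\<^sub>j\<close> of the removed set stay small.\<close>

lemma balanced_packing:
  fixes f :: "'j \<Rightarrow> nat \<Rightarrow> real" and \<epsilon> \<kappa> \<eta> :: real
  assumes J: "finite J" "J \<noteq> {}" and V: "finite V0" and f: "\<And>j x. j \<in> J \<Longrightarrow> x \<in> V0 \<Longrightarrow> \<bar>f j x\<bar> \<le> 1"
    "\<And>j. j \<in> J \<Longrightarrow> (\<Sum>x\<in>V0. f j x) = 0"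
    and \<epsilon>: "0 < \<epsilon>" "\<epsilon> \<le> 1" and m: "0 < m"
    and \<kappa>: "3 * real m * ln (2 * real (card J)) / \<epsilon> + 2 * \<epsilon> * real (card V0) \<le> \<kappa>"
    and step: "\<And>R w. R \<subseteq> V0 \<Longrightarrow> (\<And>j. j \<in> J \<Longrightarrow> \<bar>\<Sum>x\<in>R. f j x\<bar> \<le> \<kappa>) \<Longrightarrow> \<eta> \<le> real (card (V0 - R)) \<Longrightarrow>
      (\<And>x. x \<in> V0 \<Longrightarrow> \<bar>w x\<bar> \<le> 1) \<Longrightarrow> (\<Sum>x\<in>V0 - R. w x) \<le> 0 \<Longrightarrow>
      \<exists>xs. distinct xs \<and> set xs \<subseteq> V0 - R \<and> length xs = 3 * m \<and> P xs \<and> (\<Sum>x\<in>set xs. w x) \<le> \<epsilon> * real m"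
  shows "\<exists>Ps. distinct (concat Ps) \<and> set (concat Ps) \<subseteq> V0 \<and> (\<forall>xs\<in>set Ps. length xs = 3 * m \<and> P xs) \<and>
    real (card (V0 - set (concat Ps))) < \<eta>"
proof (rule ccontr)
  assume neg: "\<not> ?thesis"
  define M where "M = 3 * real m"
  \<comment> \<open>The \<lambda> of the description above. A path changes a discrepancy by at most
    \<open>M\<close>, so the argument of cosh moves by at most \<epsilon> \<le> 1, as
    \<open>cosh_step\<close> requires.\<close>
  define \<mu> where "\<mu> = \<epsilon> / M"
  have M: "0 < M" "1 \<le> M" using m by (auto simp: M_def)
  have \<mu>: "0 < \<mu>" "\<mu> * M = \<epsilon>" using M \<epsilon> by (auto simp: \<mu>_def)
  define x where "x R j = (\<Sum>v\<in>R. f j v)" for R j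
  define \<Phi> where "\<Phi> R = (\<Sum>j\<in>J. cosh (\<mu> * x R j))" for R
  have cJ: "0 < real (card J)" using J by (simp add: card_gt_0_iff)
  have \<Phi>pos: "0 < \<Phi> R" for R unfolding \<Phi>_def using J by (intro sum_pos) auto
  \<comment> \<open>Each path multiplies the potential by at most exp (2\<epsilon>^2). If the
    remainder never dropped below \<eta>, paths could be added forever, which is absurd in a finite
    set.\<close>
  have "\<exists>Ps. length Ps = s \<and> distinct (concat Ps) \<and> set (concat Ps) \<subseteq> V0 \<and> (\<forall>xs\<in>set Ps. length xs = 3 * m \<and> P xs) \<and>
    \<Phi> (set (concat Ps)) \<le> real (card J) * exp (2 * \<epsilon>\<^sup>2) ^ s" for s
  proof (induction s)
    case 0
    show ?case by (rule exI[of _ "[]"]) (simp add: \<Phi>_def x_def)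
  next
    case (Suc s)
    then obtain Ps where Ps: "length Ps = s" "distinct (concat Ps)" "set (concat Ps) \<subseteq> V0"
      "\<forall>xs\<in>set Ps. length xs = 3 * m \<and> P xs" "\<Phi> (set (concat Ps)) \<le> real (card J) * exp (2 * \<epsilon>\<^sup>2) ^ s" by blast
    define R where "R = set (concat Ps)"
    have R: "R \<subseteq> V0" "finite R" using Ps by (auto simp: R_def)
    have cR: "card R = 3 * m * s"
    proof -
      have "length (concat Ps) = sum_list (map (\<lambda>_. 3 * m) Ps)"
        unfolding length_concat using Ps(4) by (intro arg_cong[of _ _ sum_list] map_cong) auto
      thus ?thesis unfolding R_def distinct_card[OF Ps(2)] using Ps(1) by (simp add: sum_list_triv del: length_concat)
    qed
    have "3 * m * s \<le> card V0" using cR card_mono[OF V R(1)] by simp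
    hence sM: "real s * M \<le> real (card V0)" unfolding M_def
      by (metis (no_types, opaque_lifting) mult.commute of_nat_le_iff of_nat_mult of_nat_numeral)
    \<comment> \<open>The logarithm of the potential, divided by \<mu>, bounds each discrepancy; s *
      M \<le> |V0| turns the accumulated growth into the linear term of \<kappa>.\<close>
    have bd: "\<bar>x R j\<bar> \<le> \<kappa>" if j: "j \<in> J" for j
    proof -
      have "exp \<bar>\<mu> * x R j\<bar> / 2 \<le> cosh (\<mu> * x R j)" by (rule exp_abs_le_cosh)
      also have "\<dots> \<le> \<Phi> R" unfolding \<Phi>_def using j J by (intro member_le_sum) auto
      also have "\<dots> \<le> real (card J) * exp (2 * \<epsilon>\<^sup>2) ^ s" using Ps(5) by (simp add: R_def)
      also have "\<dots> = exp (ln (real (card J))) * exp (2 * \<epsilon>\<^sup>2 * real s)"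
        using cJ by (simp add: exp_of_nat_mult[symmetric] mult.commute)
      finally have "exp \<bar>\<mu> * x R j\<bar> \<le> 2 * exp (ln (real (card J))) * exp (2 * \<epsilon>\<^sup>2 * real s)" by simp
      also have "\<dots> = exp (ln (2 * real (card J)) + 2 * \<epsilon>\<^sup>2 * real s)"
        using cJ by (simp add: exp_add)
      finally have "\<bar>\<mu> * x R j\<bar> \<le> ln (2 * real (card J)) + 2 * \<epsilon>\<^sup>2 * real s" by simp
      hence "\<mu> * \<bar>x R j\<bar> \<le> ln (2 * real (card J)) + 2 * \<epsilon>\<^sup>2 * real s" using \<mu> by (simp add: abs_mult)
      hence "\<bar>x R j\<bar> \<le> (ln (2 * real (card J)) + 2 * \<epsilon>\<^sup>2 * real s) / \<mu>"
        using \<mu> by (simp add: field_simps)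
      also have "\<dots> = M * ln (2 * real (card J)) / \<epsilon> + 2 * \<epsilon> * (real s * M)"
        using \<epsilon> M by (simp add: \<mu>_def field_simps power2_eq_square)
      also have "\<dots> \<le> M * ln (2 * real (card J)) / \<epsilon> + 2 * \<epsilon> * real (card V0)"
        using sM \<epsilon> by (intro add_left_mono mult_left_mono) auto
      also have "\<dots> \<le> \<kappa>" using \<kappa> by (simp add: M_def)
      finally show ?thesis .
    qed
    have large: "\<eta> \<le> real (card (V0 - R))"
      using neg Ps unfolding R_def by (meson not_le)
    \<comment> \<open>Up to the factor \<mu> the derivative of the potential at \<open>R\<close>,
      normalised so that |sinh| \<le> cosh gives the bound 1.\<close>
    define w where "w v = (\<Sum>j\<in>J. sinh (\<mu> * x R j) * f j v) / \<Phi> R" for v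
    have w1: "\<bar>w v\<bar> \<le> 1" if v: "v \<in> V0" for v
    proof -
      have "\<bar>\<Sum>j\<in>J. sinh (\<mu> * x R j) * f j v\<bar> \<le> (\<Sum>j\<in>J. \<bar>sinh (\<mu> * x R j) * f j v\<bar>)" by (rule sum_abs)
      also have "\<dots> \<le> (\<Sum>j\<in>J. cosh (\<mu> * x R j) * 1)"
        unfolding abs_mult using f(1) v by (intro sum_mono mult_mono abs_sinh_le_cosh) auto
      also have "\<dots> = \<Phi> R" by (simp add: \<Phi>_def)
      finally show ?thesis using \<Phi>pos[of R] by (simp add: w_def abs_divide)
    qed
    \<comment> \<open>As \<open>f j\<close> sums to 0 over \<open>V0\<close>, it sums to
      \<open>- x R j\<close> over \<open>V0 - R\<close>, and sinh has the sign of its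
      argument.\<close>
    have w2: "(\<Sum>v\<in>V0 - R. w v) \<le> 0"
    proof -
      have "(\<Sum>v\<in>V0 - R. w v) = (\<Sum>j\<in>J. sinh (\<mu> * x R j) * (\<Sum>v\<in>V0 - R. f j v)) / \<Phi> R"
        unfolding w_def sum_divide_distrib[symmetric] by (subst sum.swap) (simp add: sum_distrib_left)
      also have "(\<Sum>j\<in>J. sinh (\<mu> * x R j) * (\<Sum>v\<in>V0 - R. f j v)) = (\<Sum>j\<in>J. - (sinh (\<mu> * x R j) * x R j))"
        using R V f(2) by (intro sum.cong refl) (simp add: sum_diff x_def)
      also have "\<dots> / \<Phi> R \<le> 0"
      proof -
        have "0 \<le> sinh (\<mu> * x R j) * x R j" for j
          using \<mu>(1) by (cases "0 \<le> x R j") (auto intro!: mult_nonneg_nonneg mult_nonpos_nonpos simp: mult_nonneg_nonpos)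
        thus ?thesis using \<Phi>pos[of R] by (auto intro!: divide_nonpos_pos sum_nonpos)
      qed
      finally show ?thesis .
    qed
    obtain xs where xs: "distinct xs" "set xs \<subseteq> V0 - R" "length xs = 3 * m" "P xs" "(\<Sum>v\<in>set xs. w v) \<le> \<epsilon> * real m"
      using step[OF R(1) bd[unfolded x_def] large w1 w2] by blast
    define y where "y j = (\<Sum>v\<in>set xs. f j v)" for j
    have xy: "x (R \<union> set xs) j = x R j + y j" for j
      unfolding x_def y_def using xs R by (intro sum.union_disjoint) auto
    have yM: "\<bar>y j\<bar> \<le> M" if "j \<in> J" for j
    proof -
      have "\<bar>y j\<bar> \<le> (\<Sum>v\<in>set xs. \<bar>f j v\<bar>)" unfolding y_def by (rule sum_abs)
      also have "\<dots> \<le> (\<Sum>v\<in>set xs. 1)" using f(1)[OF that] xs by (intro sum_mono) auto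
      also have "\<dots> = M" using xs by (simp add: distinct_card M_def)
      finally show ?thesis .
    qed
    have ymu: "\<bar>\<mu> * y j\<bar> \<le> \<epsilon>" if "j \<in> J" for j
    proof -
      have "\<bar>\<mu> * y j\<bar> = \<mu> * \<bar>y j\<bar>" using \<mu> by (simp add: abs_mult)
      also have "\<dots> \<le> \<mu> * M" using yM[OF that] \<mu> by (intro mult_left_mono) auto
      finally show ?thesis using \<mu> by simp
    qed
    have "\<Phi> (R \<union> set xs) = (\<Sum>j\<in>J. cosh (\<mu> * x R j + \<mu> * y j))"
      by (simp add: \<Phi>_def xy algebra_simps)
    also have "\<dots> \<le> (\<Sum>j\<in>J. cosh (\<mu> * x R j) * (1 + \<epsilon>\<^sup>2) + sinh (\<mu> * x R j) * (\<mu> * y j))"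
    proof (rule sum_mono)
      fix j assume j: "j \<in> J"
      have "cosh (\<mu> * x R j + \<mu> * y j) \<le> cosh (\<mu> * x R j) * (1 + (\<mu> * y j)\<^sup>2) + sinh (\<mu> * x R j) * (\<mu> * y j)"
        using ymu[OF j] \<epsilon> by (intro cosh_step) auto
      moreover have "(\<mu> * y j)\<^sup>2 \<le> \<epsilon>\<^sup>2" using ymu[OF j] by (metis abs_ge_zero power2_abs power_mono)
      hence "cosh (\<mu> * x R j) * (1 + (\<mu> * y j)\<^sup>2) \<le> cosh (\<mu> * x R j) * (1 + \<epsilon>\<^sup>2)" by (intro mult_left_mono) auto
      ultimately show "cosh (\<mu> * x R j + \<mu> * y j) \<le> cosh (\<mu> * x R j) * (1 + \<epsilon>\<^sup>2) + sinh (\<mu> * x R j) * (\<mu> * y j)"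
        by linarith
    qed
    also have "\<dots> = \<Phi> R * (1 + \<epsilon>\<^sup>2) + \<mu> * (\<Sum>j\<in>J. sinh (\<mu> * x R j) * y j)"
      by (simp add: \<Phi>_def sum.distrib sum_distrib_left sum_distrib_right algebra_simps)
    also have "(\<Sum>j\<in>J. sinh (\<mu> * x R j) * y j) = \<Phi> R * (\<Sum>v\<in>set xs. w v)"
    proof -
      have "\<Phi> R * (\<Sum>v\<in>set xs. w v) = (\<Sum>v\<in>set xs. \<Sum>j\<in>J. sinh (\<mu> * x R j) * f j v)"
        using \<Phi>pos[of R] by (simp add: w_def sum_divide_distrib[symmetric])
      also have "\<dots> = (\<Sum>j\<in>J. sinh (\<mu> * x R j) * y j)"
        by (subst sum.swap) (simp add: y_def sum_distrib_left)
      finally show ?thesis ..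
    qed
    also have "\<mu> * (\<Phi> R * (\<Sum>v\<in>set xs. w v)) \<le> \<mu> * (\<Phi> R * (\<epsilon> * M))"
      using xs(5) \<mu> \<Phi>pos[of R] \<epsilon> m by (intro mult_left_mono order.trans[OF xs(5)]) (auto simp: M_def)
    also have "\<mu> * (\<Phi> R * (\<epsilon> * M)) = \<Phi> R * \<epsilon>\<^sup>2"
      using \<mu>(2) by (simp add: power2_eq_square algebra_simps)
    finally have "\<Phi> (R \<union> set xs) \<le> \<Phi> R * (1 + 2 * \<epsilon>\<^sup>2)" by (simp add: algebra_simps)
    also have "\<dots> \<le> \<Phi> R * exp (2 * \<epsilon>\<^sup>2)"
      using \<Phi>pos[of R] exp_ge_add_one_self[of "2 * \<epsilon>\<^sup>2"] by (intro mult_left_mono) auto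
    also have "\<dots> \<le> real (card J) * exp (2 * \<epsilon>\<^sup>2) ^ s * exp (2 * \<epsilon>\<^sup>2)"
      using Ps(5) unfolding R_def[symmetric] by (intro mult_right_mono) auto
    finally have "\<Phi> (R \<union> set xs) \<le> real (card J) * exp (2 * \<epsilon>\<^sup>2) ^ Suc s" by (simp add: algebra_simps)
    thus ?case using Ps xs unfolding R_def
      by (intro exI[of _ "xs # Ps"]) (auto simp: Un_commute)
  qed
  from this[of "Suc (card V0)"] obtain Ps where Ps: "length Ps = Suc (card V0)" "distinct (concat Ps)"
    "set (concat Ps) \<subseteq> V0" "\<forall>xs\<in>set Ps. length xs = 3 * m \<and> P xs" by blast
  have "length (concat Ps) = sum_list (map (\<lambda>_. 3 * m) Ps)"
    unfolding length_concat using Ps(4) by (intro arg_cong[of _ _ sum_list] map_cong) auto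
  hence "length (concat Ps) = Suc (card V0) * (3 * m)" using Ps(1) by (simp add: sum_list_triv)
  moreover have "length (concat Ps) \<le> card V0"
    using card_mono[OF V Ps(3)] unfolding distinct_card[OF Ps(2)] .
  moreover have "Suc (card V0) * 1 \<le> Suc (card V0) * (3 * m)" using m by (intro mult_left_mono) auto
  ultimately have "Suc (card V0) * 1 \<le> card V0" by (metis le_trans)
  thus False by simp
qed

section \<open>Almost perfect path tilings\<close>

context posa_graph
begin

lemma card_edge: "e \<in> E \<Longrightarrow> card e = 3"
  using graph by (auto simp: three_graph_def)

lemma tiling:
  fixes \<epsilon> \<eta> :: real
  assumes V0: "V0 \<subseteq> V" "real n - \<alpha> / 16 * real n \<le> real (card V0)" and n: "0 < n"
    and \<eta>: "0 < \<eta>" "\<eta> \<le> 1" and \<epsilon>: "\<epsilon> = \<alpha> * \<eta> / 96" and m: "0 < m"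
    and large: "40 \<le> \<epsilon> * (\<eta> * real n)" "27 * (3 * real m) < 8 * (\<epsilon> / 32) ^ 3 * (\<eta> * real n)"
      "3 * real m * ln (4 * real n ^ 2) / \<epsilon> \<le> \<epsilon> * real n"
  shows "\<exists>Ps. distinct (concat Ps) \<and> set (concat Ps) \<subseteq> V0 \<and> (\<forall>xs\<in>set Ps. length xs = 3 * m \<and> tw E xs) \<and>
    real (card (V0 - set (concat Ps))) < \<eta> * real n"
proof -
  have \<epsilon>01: "0 < \<epsilon>" "\<epsilon> \<le> 1"
  proof -
    show "0 < \<epsilon>" unfolding \<epsilon> using \<alpha> \<eta> by simp
    have "\<alpha> * \<eta> \<le> 1 * 1" using \<alpha> \<eta> by (intro mult_mono) auto
    thus "\<epsilon> \<le> 1" using \<epsilon> by simp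
  qed
  have finV0: "finite V0" using V0 finite_subset by blast
  define n0 where "n0 = real (card V0)"
  have n0: "n0 \<le> real n" "real n - \<alpha> / 16 * real n \<le> n0" "real n / 2 \<le> n0" "0 < n0"
  proof -
    show "n0 \<le> real n" using card_mono[OF _ V0(1)] by (simp add: n0_def)
    show 1: "real n - \<alpha> / 16 * real n \<le> n0" using V0 by (simp add: n0_def)
    have "\<alpha> * real n \<le> 1 * real n" using \<alpha> by (intro mult_right_mono) auto
    thus "real n / 2 \<le> n0" using 1 by simp
    thus "0 < n0" using n by linarith
  qed
  \<comment> \<open>Neighbourhoods carry the degrees and initial segments the ranks with which they
    are compared. There are at most 2n^2 sets, so the logarithm in \<kappa> is harmless.\<close>
  define \<A> where "\<A> = (\<lambda>(x, y). N x y) ` (V \<times> V) \<union> (\<lambda>t. {1..t}) ` V"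
  have fin\<A>: "finite \<A>" by (simp add: \<A>_def)
  have ne\<A>: "\<A> \<noteq> {}" using n by (auto simp: \<A>_def)
  have c\<A>: "real (card \<A>) \<le> 2 * real n ^ 2"
  proof -
    have "card \<A> \<le> card ((\<lambda>(x, y). N x y) ` (V \<times> V)) + card ((\<lambda>t. {1..t}) ` V)"
      unfolding \<A>_def by (rule card_Un_le)
    also have "\<dots> \<le> card (V \<times> V) + card V" by (intro add_mono card_image_le) auto
    also have "\<dots> = n * n + n" by (simp add: card_cartesian_product)
    also have "\<dots> \<le> n * n + n * n" using n by simp
    also have "\<dots> = 2 * n ^ 2" by (simp add: power2_eq_square)
    finally have "real (card \<A>) \<le> real (2 * n ^ 2)" by (rule of_nat_mono)
    thus ?thesis by simp
  qed
  define \<rho> where "\<rho> A = real (card (A \<inter> V0)) / n0" for A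
  define f where "f A v = (if v \<in> A then 1 else 0) - \<rho> A" for A v
  have \<rho>01: "0 \<le> \<rho> A" "\<rho> A \<le> 1" for A
    using n0 card_mono[OF finV0, of "A \<inter> V0"] by (auto simp: \<rho>_def n0_def divide_le_eq)
  have sumf: "(\<Sum>v\<in>R. f A v) = real (card (A \<inter> R)) - \<rho> A * real (card R)" if "R \<subseteq> V0" for A R
  proof -
    have "finite R" using that finV0 finite_subset by blast
    hence "(\<Sum>v\<in>R. if v \<in> A then 1 else 0::real) = real (card (A \<inter> R))"
      by (simp add: sum.If_cases Int_def conj_commute)
    thus ?thesis by (simp add: f_def sum_subtractf)
  qed
  show ?thesis
  proof (rule balanced_packing[OF fin\<A> ne\<A> finV0 _ _ \<epsilon>01 m, where f = f and \<kappa> = "3 * \<epsilon> * real n"])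
    show "\<bar>f A x\<bar> \<le> 1" for A x using \<rho>01[of A] by (auto simp: f_def)
    show "(\<Sum>x\<in>V0. f A x) = 0" for A using n0 sumf[of V0 A] by (simp add: \<rho>_def n0_def)
    show "3 * real m * ln (2 * real (card \<A>)) / \<epsilon> + 2 * \<epsilon> * real (card V0) \<le> 3 * \<epsilon> * real n"
    proof -
      have "ln (2 * real (card \<A>)) \<le> ln (4 * real n ^ 2)"
        using c\<A> fin\<A> ne\<A> by (intro ln_mono) (auto simp: card_gt_0_iff)
      hence "3 * real m * ln (2 * real (card \<A>)) / \<epsilon> \<le> 3 * real m * ln (4 * real n ^ 2) / \<epsilon>"
        using \<epsilon>01 by (intro divide_right_mono mult_left_mono) auto
      also note large(3)
      finally have "3 * real m * ln (2 * real (card \<A>)) / \<epsilon> \<le> \<epsilon> * real n" .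
      moreover have "\<epsilon> * real (card V0) \<le> \<epsilon> * real n" using n0 \<epsilon>01 by (intro mult_left_mono) (auto simp: n0_def)
      ultimately show ?thesis by simp
    qed
  next
    fix R and w :: "nat \<Rightarrow> real"
    assume R: "R \<subseteq> V0" and disc: "\<And>A. A \<in> \<A> \<Longrightarrow> \<bar>\<Sum>x\<in>R. f A x\<bar> \<le> 3 * \<epsilon> * real n"
      and big: "\<eta> * real n \<le> real (card (V0 - R))"
      and w: "\<And>x. x \<in> V0 \<Longrightarrow> \<bar>w x\<bar> \<le> 1" "(\<Sum>x\<in>V0 - R. w x) \<le> 0"
    define U where "U = V0 - R"
    define u where "u = real (card U)"
    have finU: "finite U" using finV0 by (simp add: U_def)
    have finR: "finite R" using R finV0 finite_subset by blast
    have un: "\<eta> * real n \<le> u" using big by (simp add: u_def U_def)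
    have u0: "0 < u" using un \<eta> n by (meson less_le_trans mult_pos_pos of_nat_0_less_iff)
    have cardU: "u = n0 - real (card R)"
      unfolding u_def U_def n0_def using R finR card_mono[OF finV0 R] by (simp add: card_Diff_subset of_nat_diff)
    \<comment> \<open>The constant 96 = 3 * 32 in \<epsilon>, with u \<ge> \<eta>n, turns the
      absolute discrepancy into a small fraction of \<open>u\<close>.\<close>
    have err: "3 * \<epsilon> * real n \<le> \<alpha> / 32 * u"
      using un \<alpha> mult_left_mono[OF un, of "\<alpha> / 32"] by (simp add: \<epsilon>)
    have bal: "\<bar>real (card (A \<inter> U)) - \<rho> A * u\<bar> \<le> \<alpha> / 32 * u" if A: "A \<in> \<A>" for A
    proof -
      have "A \<inter> V0 = (A \<inter> U) \<union> (A \<inter> R)" using R by (auto simp: U_def)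
      moreover have "card ((A \<inter> U) \<union> (A \<inter> R)) = card (A \<inter> U) + card (A \<inter> R)"
        using finU finR by (intro card_Un_disjoint) (auto simp: U_def)
      ultimately have "real (card (A \<inter> V0)) = real (card (A \<inter> U)) + real (card (A \<inter> R))" by simp
      moreover have "real (card (A \<inter> V0)) = \<rho> A * n0" using n0 by (simp add: \<rho>_def)
      ultimately have "real (card (A \<inter> U)) - \<rho> A * u = - (\<Sum>x\<in>R. f A x)"
        unfolding sumf[OF R] cardU by (simp add: algebra_simps)
      thus ?thesis using disc[OF A] err by linarith
    qed
    \<comment> \<open>\<alpha>/32 is the discrepancy, and \<alpha>/8 the price for measuring density
      in \<open>V0\<close> instead of \<open>V\<close>, from n - n0 \<le> \<alpha>n/16 and n0 \<ge>
      n/2.\<close>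
    have rk: "real (card {z \<in> U. z \<le> x}) \<le> real x / real n * u + 5 * \<alpha> / 32 * u" if x: "x \<in> V" for x
    proof -
      have eq: "{z \<in> U. z \<le> x} = {1..x} \<inter> U" using V0 by (auto simp: U_def)
      have "{1..x} \<in> \<A>" using x by (auto simp: \<A>_def)
      from bal[OF this] have 1: "real (card {z \<in> U. z \<le> x}) \<le> \<rho> {1..x} * u + \<alpha> / 32 * u"
        unfolding eq by linarith
      have "card ({1..x} \<inter> V0) \<le> card {1..x}" by (intro card_mono) auto
      hence "\<rho> {1..x} \<le> real x / n0" using n0 unfolding \<rho>_def by (intro divide_right_mono) auto
      also have "\<dots> \<le> real x / real n + \<alpha> / 8"
      proof -
        have "real x * (real n - n0) \<le> real n * (real n - n0)" using x n0 by (intro mult_right_mono) auto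
        also have "\<dots> \<le> real n * (\<alpha> / 16 * real n)" using n0 by (intro mult_left_mono) auto
        also have "\<dots> \<le> \<alpha> / 8 * (real n * n0)"
          using mult_left_mono[OF n0(3), of "\<alpha> / 8 * real n"] \<alpha> by (simp add: algebra_simps)
        finally have "real x * real n \<le> real x * n0 + \<alpha> / 8 * (real n * n0)" by (simp add: algebra_simps)
        thus ?thesis using n n0 by (simp add: field_simps)
      qed
      finally have "\<rho> {1..x} * u \<le> (real x / real n + \<alpha> / 8) * u" using u0 by (intro mult_right_mono) auto
      thus ?thesis using 1 by (simp add: algebra_simps)
    qed
    have deg: "min (min (real (card {z \<in> U. z \<le> x})) (real (card {z \<in> U. z \<le> y}))) (real (card U) / 2)
        + 4 * (\<epsilon> / 32) * real (card U) \<le> real (card {z \<in> U. {x, y, z} \<in> E})"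
      if xy: "x \<in> U" "y \<in> U" "x \<noteq> y" for x y
    proof -
      have xyV: "x \<in> V" "y \<in> V" using xy V0 by (auto simp: U_def)
      have eq: "{z \<in> U. {x, y, z} \<in> E} = N x y \<inter> U" using V0 by (auto simp: N_def U_def)
      have "N x y \<in> \<A>" using xyV by (auto simp: \<A>_def)
      from bal[OF this] have 1: "\<rho> (N x y) * u - \<alpha> / 32 * u \<le> real (card {z \<in> U. {x, y, z} \<in> E})"
        unfolding eq by linarith
      have "min (min (real x) (real y)) (real n / 2) + \<alpha> * real n + n0 - real n \<le> real (card (N x y \<inter> V0))"
        using card_Int_ge[of V "N x y" V0] V0 N_subset N_degree[OF xyV xy(3)] by (simp add: n0_def)
      hence "min (min (real x) (real y)) (real n / 2) + 15 / 16 * \<alpha> * real n \<le> real (card (N x y \<inter> V0))"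
        using n0 by (simp add: algebra_simps)
      hence "(min (min (real x) (real y)) (real n / 2) + 15 / 16 * \<alpha> * real n) / real n \<le> real (card (N x y \<inter> V0)) / real n"
        by (intro divide_right_mono) auto
      also have "\<dots> \<le> \<rho> (N x y)" unfolding \<rho>_def using n0 by (intro divide_left_mono) auto
      finally have "(min (min (real x) (real y)) (real n / 2) / real n + 15 / 16 * \<alpha>) * u \<le> \<rho> (N x y) * u"
        using u0 n by (intro mult_right_mono) (auto simp: add_divide_distrib)
      moreover have "min (min (real (card {z \<in> U. z \<le> x})) (real (card {z \<in> U. z \<le> y}))) (u / 2)
          \<le> min (min (real x) (real y)) (real n / 2) / real n * u + 5 * \<alpha> / 32 * u"
      proof -
        have "0 \<le> 5 * \<alpha> / 32 * u" using \<alpha> u0 by simp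
        moreover have "real n / 2 / real n * u = u / 2" using n by simp
        moreover note rk[OF xyV(1)] rk[OF xyV(2)]
        ultimately have "min (min (real (card {z \<in> U. z \<le> x})) (real (card {z \<in> U. z \<le> y}))) (u / 2)
            \<le> M / real n * u + 5 * \<alpha> / 32 * u" if "M = real x \<or> M = real y \<or> M = real n / 2" for M
          using that by (elim disjE) (hypsubst, linarith)+
        moreover have "min (min (real x) (real y)) (real n / 2) = real x \<or>
            min (min (real x) (real y)) (real n / 2) = real y \<or>
            min (min (real x) (real y)) (real n / 2) = real n / 2"
          by (auto simp: min_def)
        ultimately show ?thesis by blast
      qed
      \<comment> \<open>Balance of the slack: 15\<alpha>/16 - \<alpha>/32 - 5\<alpha>/32 =
        3\<alpha>/4 is left, while only \<epsilon>/8 is asked for.\<close>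
      moreover have "4 * (\<epsilon> / 32) * u \<le> 3 * \<alpha> / 4 * u"
      proof -
        have "\<alpha> * \<eta> \<le> \<alpha> * 1" using \<alpha> \<eta> by (intro mult_left_mono) auto
        thus ?thesis using u0 \<alpha> by (intro mult_right_mono) (auto simp: \<epsilon>)
      qed
      ultimately show ?thesis using 1 unfolding u_def[symmetric] by (simp add: algebra_simps)
    qed
    have "\<exists>xs. distinct xs \<and> set xs \<subseteq> U \<and> length xs = 3 * m \<and> tw E xs \<and> (\<Sum>x\<in>set xs. w x) \<le> \<epsilon> * real m"
    proof (rule light_tight_path[OF card_edge finU _ _ \<epsilon>01 _ refl m _ deg])
      show "\<bar>w x\<bar> \<le> 1" if "x \<in> U" for x using w(1) that by (simp add: U_def)
      show "sum w U \<le> 0" using w(2) by (simp add: U_def)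
      have "\<epsilon> * (\<eta> * real n) \<le> \<epsilon> * u" using un \<epsilon>01 by (intro mult_left_mono) auto
      thus "40 \<le> \<epsilon> * real (card U)" using large(1) by (simp add: u_def)
      have "8 * (\<epsilon> / 32) ^ 3 * (\<eta> * real n) \<le> 8 * (\<epsilon> / 32) ^ 3 * u" using un \<epsilon>01 by (intro mult_left_mono) auto
      thus "27 * (3 * real m) < 8 * (\<epsilon> / 32) ^ 3 * real (card U)" using large(2) by (simp add: u_def)
    qed
    thus "\<exists>xs. distinct xs \<and> set xs \<subseteq> V0 - R \<and> length xs = 3 * m \<and> tw E xs \<and> (\<Sum>x\<in>set xs. w x) \<le> \<epsilon> * real m"
      by (simp add: U_def)
  qed
qed

end

section \<open>The Hamiltonian cycle\<close>

lemma concat_distinct_list_of_family: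
  assumes "finite F" "disjoint_family_on set F" "\<And>t. t \<in> F \<Longrightarrow> distinct t"
  obtains ts where "set ts = F" "distinct (concat ts)" "length ts = card F"
proof -
  obtain ts where ts: "set ts = F" "distinct ts" using assms(1) finite_distinct_list by blast
  have "distinct (concat ts)"
    using ts assms(2,3) by (intro distinct_concat) (auto simp: disjoint_family_on_def)
  thus ?thesis using that ts by (metis distinct_card)
qed

context posa_graph
begin

text \<open>Connecting tuples keep positive density after a small set is removed, so its whole
  complement is a reservoir. It serves to link the absorbers before a small reservoir is set
  aside.\<close>

lemma reservoir_complement:
  assumes n: "16 \<le> n" and X: "X \<subseteq> V"
    and large: "real L * (real (card X) + real L * real q + real L) \<le> con / 2 * real n"
  shows "reservoir (V - X) q"
  unfolding reservoir_def
proof (intro ballI allI impI)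
  fix a b x y X' assume V: "a \<in> V" "b \<in> V" "x \<in> V" "y \<in> V" and X': "X' \<subseteq> V - X"
    and ne: "a \<noteq> b" "x \<noteq> y" and c: "card X' \<le> L * q"
  have fin: "finite V" by simp
  have fX: "finite X" "finite X'" using X X' finite_subset[OF _ fin] by blast+
  have Vne: "V \<noteq> {}" using V by blast
  have "card (X \<union> X') \<le> card X + L * q" using card_Un_le[of X X'] c by linarith
  hence "real (card (X \<union> X')) \<le> real (card X) + real L * real q" by (metis of_nat_add of_nat_le_iff of_nat_mult)
  hence "real L * (real (card (X \<union> X')) + real L) \<le> real L * (real (card X) + real L * real q + real L)"
    by (intro mult_left_mono) auto
  hence *: "real L * (real (card (X \<union> X')) + real L) \<le> con / 2 * real (card V)" using large by simp
  have "many V (con / 2) L (\<lambda>t. tw E (a # b # t @ [x, y]) \<and> distinct t \<and> set t \<inter> (X \<union> X') = {})"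
    using fX by (intro many_good[OF fin Vne _ connect[OF V(1,2) ne(1) V(3,4) ne(2) n] *]) auto
  hence "con / 2 * real n ^ L \<le> real (card {t \<in> tuples V L. tw E (a # b # t @ [x, y]) \<and> distinct t \<and> set t \<inter> (X \<union> X') = {}})"
    by (simp add: many_def)
  moreover have "0 < con / 2 * real n ^ L" using con_dens_pos[OF \<alpha>(1)] n by simp
  ultimately have "0 < card {t \<in> tuples V L. tw E (a # b # t @ [x, y]) \<and> distinct t \<and> set t \<inter> (X \<union> X') = {}}" by linarith
  then obtain t where "t \<in> tuples V L" "tw E (a # b # t @ [x, y])" "distinct t" "set t \<inter> (X \<union> X') = {}"
    by (auto simp: card_gt_0_iff)
  thus "\<exists>t. length t = L \<and> distinct t \<and> set t \<subseteq> V - X - X' \<and> tw E (a # b # t @ [x, y])"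
    by (intro exI[of _ t]) (auto simp: tuples_def)
qed

text \<open>There are at most n^4 demands, each met by more than \<open>L * q\<close> of the
  selected disjoint tuples; a set of at most \<open>L * q\<close> vertices cannot hit all of
  these.\<close>

lemma small_reservoir:
  assumes n: "16 \<le> n" and X: "X \<subseteq> V"
    and large: "real L * (real (card X) + real L * real r + real L) \<le> con / 2 * real n"
    and hits: "real (L * q) < con / 4 * real r - ln (real n ^ 4)"
  shows "\<exists>Y\<subseteq>V - X. card Y \<le> L * r \<and> reservoir Y q"
proof -
  have fin: "finite V" by simp
  have Vne: "V \<noteq> {}" using n by auto
  have fX: "finite X" using X finite_subset by blast
  define J where "J = {(a, b, x, y). a \<in> V \<and> b \<in> V \<and> x \<in> V \<and> y \<in> V \<and> a \<noteq> b \<and> x \<noteq> y}"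
  define S where "S = (\<lambda>(a, b, x, y) t. tw E (a # b # t @ [x, y]))"
  have Jsub: "J \<subseteq> V \<times> V \<times> V \<times> V" by (auto simp: J_def)
  hence finJ: "finite J" by (rule finite_subset) simp
  have "(1, 2, 1, 2) \<in> J" using n by (auto simp: J_def)
  hence neJ: "J \<noteq> {}" by blast
  have "card J \<le> card (V \<times> V \<times> V \<times> V)" using Jsub by (intro card_mono) auto
  hence "card J \<le> n ^ 4" by (simp add: card_cartesian_product power4_eq_xxxx)
  hence "real (card J) \<le> real n ^ 4" by (metis of_nat_le_iff of_nat_power)
  hence lnJ: "ln (real (card J)) \<le> ln (real n ^ 4)" using finJ neJ by (intro ln_mono) (auto simp: card_gt_0_iff)
  have "\<exists>F. finite F \<and> card F \<le> r \<and> (\<forall>t\<in>F. t \<in> tuples (V - X) L \<and> distinct t) \<and>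
     disjoint_family_on set F \<and> (\<forall>j\<in>J. con / 4 * real r - ln (real (card J)) \<le> real (card {t\<in>F. S j t}))"
  proof (rule select_tuples_hits[OF fin Vne finJ neJ fX])
    show "many V con L (S j)" if "j \<in> J" for j
      using that connect[OF _ _ _ _ _ _ n] by (auto simp: J_def S_def)
    show "0 < con" "con \<le> 1" using con_dens_pos con_dens_le_1 \<alpha> by auto
    show "0 < L" by (rule con_len_pos)
    show "real L * (real (card X) + real L * real r + real L) \<le> con / 2 * real (card V)" using large by simp
  qed
  then obtain F where F: "finite F" "card F \<le> r" "\<And>t. t \<in> F \<Longrightarrow> t \<in> tuples (V - X) L \<and> distinct t"
     "disjoint_family_on set F" "\<And>j. j \<in> J \<Longrightarrow> con / 4 * real r - ln (real (card J)) \<le> real (card {t\<in>F. S j t})"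
    by blast
  define Y where "Y = (\<Union>t\<in>F. set t)"
  have "card Y \<le> (\<Sum>t\<in>F. card (set t))" unfolding Y_def by (rule card_UN_le) (rule F)
  also have "\<dots> \<le> (\<Sum>t\<in>F. L)" using F(3) by (intro sum_mono) (auto simp: tuples_def distinct_card)
  also have "\<dots> \<le> L * r" using F(2) by simp
  finally have cY: "card Y \<le> L * r" .
  moreover have YV: "Y \<subseteq> V - X" using F(3) by (force simp: Y_def tuples_def)
  moreover have "reservoir Y q"
    unfolding reservoir_def
  proof (intro ballI allI impI)
    fix a b x y X' assume V: "a \<in> V" "b \<in> V" "x \<in> V" "y \<in> V" and X': "X' \<subseteq> Y"
      and ne: "a \<noteq> b" "x \<noteq> y" and c: "card X' \<le> L * q"
    define H where "H = {t\<in>F. S (a, b, x, y) t}"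
    have finX': "finite X'" using X' F(1) by (auto simp: Y_def intro: finite_subset)
    have "(a, b, x, y) \<in> J" using V ne by (auto simp: J_def)
    hence "real (L * q) < real (card H)" using F(5) hits lnJ unfolding H_def by fastforce
    hence "card X' < card H" using c by linarith
    have "\<exists>t\<in>H. set t \<inter> X' = {}"
    proof (rule ccontr)
      assume "\<not> ?thesis"
      hence "\<forall>t\<in>H. \<exists>z. z \<in> set t \<inter> X'" by blast
      then obtain h where h: "\<And>t. t \<in> H \<Longrightarrow> h t \<in> set t \<inter> X'" by metis
      have "inj_on h H"
      proof (rule inj_onI)
        fix s t assume st: "s \<in> H" "t \<in> H" "h s = h t"
        show "s = t"
        proof (rule ccontr)
          assume "s \<noteq> t"
          hence "set s \<inter> set t = {}" using F(4) st by (auto simp: disjoint_family_on_def H_def)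
          thus False using h[OF st(1)] h[OF st(2)] st(3) by auto
        qed
      qed
      moreover have "h ` H \<subseteq> X'" using h by blast
      ultimately have "card H \<le> card X'" using finX' by (metis card_inj_on_le)
      thus False using \<open>card X' < card H\<close> by simp
    qed
    then obtain t where t: "t \<in> H" "set t \<inter> X' = {}" by blast
    have "set t \<subseteq> Y" using t(1) unfolding H_def Y_def by blast
    thus "\<exists>t. length t = L \<and> distinct t \<and> set t \<subseteq> Y - X' \<and> tw E (a # b # t @ [x, y])"
      using t F(3)[of t] by (intro exI[of _ t]) (auto simp: H_def S_def tuples_def)
  qed
  ultimately show ?thesis by blast
qed

lemma absorber_family:
  assumes n: "16 \<le> n" and a: "25 * real r + 25 \<le> absc / 2 * real n"
  shows "\<exists>ts. distinct (concat ts) \<and> length ts \<le> r \<and> (\<forall>t\<in>set ts. length t = 5 \<and> tw E t \<and> set t \<subseteq> V) \<and>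
    (\<forall>v\<in>V. absc / 4 * real r - ln (real n) \<le> real (card {t\<in>set ts. absorbs v t}))"
proof -
  have fin: "finite V" by simp
  have Vne: "V \<noteq> {}" using n by auto
  have "\<exists>F. finite F \<and> card F \<le> r \<and> (\<forall>t\<in>F. t \<in> tuples (V - {}) 5 \<and> distinct t) \<and>
     disjoint_family_on set F \<and> (\<forall>v\<in>V. absc / 4 * real r - ln (real (card V)) \<le> real (card {t\<in>F. absorbs v t}))"
  proof (rule select_tuples_hits[OF fin Vne fin Vne])
    show "many V absc 5 (absorbs v)" if "v \<in> V" for v using absorbers[OF that n] .
    show "0 < absc" "absc \<le> 1" using abs_dens_pos abs_dens_le_1 \<alpha> by auto
    show "real 5 * (real (card {}) + real 5 * real r + real 5) \<le> absc / 2 * real (card V)" using a by simp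
  qed auto
  then obtain F where F: "finite F" "card F \<le> r" "\<And>t. t \<in> F \<Longrightarrow> t \<in> tuples V 5 \<and> distinct t"
     "disjoint_family_on set F" "\<And>v. v \<in> V \<Longrightarrow> absc / 4 * real r - ln (real n) \<le> real (card {t\<in>F. absorbs v t})"
    by auto
  \<comment> \<open>Selected tuples that are not tight walks cannot be blocks; dropping them costs
    no hit, as \<open>absorbs\<close> includes \<open>tw E t\<close>.\<close>
  define G where "G = {t \<in> F. tw E t}"
  have G: "finite G" "G \<subseteq> F" using F(1) by (auto simp: G_def)
  have "disjoint_family_on set G" using F(4) G(2) by (rule disjoint_family_on_mono[rotated])
  then obtain ts where ts: "set ts = G" "distinct (concat ts)" "length ts = card G"
    using concat_distinct_list_of_family[OF G(1)] F(3) G(2) by (metis subsetD)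
  have "card G \<le> r" using card_mono[OF F(1) G(2)] F(2) by linarith
  moreover have "{t\<in>G. absorbs v t} = {t\<in>F. absorbs v t}" for v by (auto simp: G_def absorbs_def)
  ultimately show ?thesis using ts F(3,5) G(2)
    by (intro exI[of _ ts]) (auto simp: tuples_def G_def)
qed

text \<open>\<mu>n absorbers, \<nu>n reservoir tuples, a tiling remainder of \<eta>n, paths on 3m
  vertices. The second inequality of \<open>small\<close> says that this remainder and the whole
  reservoir together have total level at most the number of absorbers available for any
  vertex.\<close>

lemma hamiltonian_of_constants:
  fixes \<mu> \<nu> \<eta> \<epsilon> :: real and m :: nat
  assumes n: "16 \<le> n" and pos: "0 < \<mu>" "0 < \<nu>" "0 < \<eta>" "\<eta> \<le> 1" "0 < m" and m2: "2 \<le> m"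
    and small: "(real L + 5) * \<mu> + real L * \<nu> \<le> \<alpha> / 16"
      "(2 / \<alpha> + 2) * (\<eta> + real L * \<nu>) \<le> absc * \<mu> / 8"
    and \<epsilon>: "\<epsilon> = \<alpha> * \<eta> / 96"
    and large: "25 * (\<mu> * real n) + 25 \<le> absc / 2 * real n"
      "absc * \<mu> / 8 * real n \<le> absc / 4 * (\<mu> * real n - 1) - ln (real n)"
      "real L * ((real L + 5) * (\<mu> * real n) + real L * (\<nu> * real n) + real L) \<le> con / 2 * real n"
      "con * \<nu> / 8 * real n \<le> con / 4 * (\<nu> * real n - 1) - ln (real n ^ 4)"
      "real n / (3 * real m) + 1 \<le> con * \<nu> / (16 * real L) * real n"
      "40 \<le> \<epsilon> * (\<eta> * real n)" "27 * (3 * real m) < 8 * (\<epsilon> / 32) ^ 3 * (\<eta> * real n)"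
      "3 * real m * ln (4 * real n ^ 2) / \<epsilon> \<le> \<epsilon> * real n"
  shows "tight_hamiltonian_cycle V E"
proof -
  have n0: "0 < real n" "0 < n" using n by auto
  have con0: "0 < con" by (rule con_dens_pos) (rule \<alpha>)
  have absc0: "0 < absc" by (rule abs_dens_pos) (rule \<alpha>)
  have L0: "0 < real L" using con_len_pos by simp
  define a where "a = nat \<lfloor>\<mu> * real n\<rfloor>"
  define r where "r = nat \<lfloor>\<nu> * real n\<rfloor>"
  \<comment> \<open>Half of the \<open>con * \<nu> / 8 * real n\<close> connecting tuples guaranteed
    per demand, divided by the \<open>L\<close> vertices that a connection uses.\<close>
  define q where "q = nat \<lfloor>con * \<nu> / (16 * real L) * real n\<rfloor>"
  have "0 \<le> \<mu> * real n" "0 \<le> \<nu> * real n" using pos by auto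
  hence a: "real a \<le> \<mu> * real n" "\<mu> * real n - 1 \<le> real a"
    and r: "real r \<le> \<nu> * real n" "\<nu> * real n - 1 \<le> real r"
    unfolding a_def r_def by linarith+
  have q0: "0 \<le> con * \<nu> / (16 * real L) * real n" using con0 pos L0 n0 by simp
  have q: "real q \<le> con * \<nu> / (16 * real L) * real n" "con * \<nu> / (16 * real L) * real n - 1 \<le> real q"
    using q0 unfolding q_def by linarith+
  have "25 * real a + 25 \<le> absc / 2 * real n" using large(1) a(1) by linarith
  from absorber_family[OF n this] obtain ts where ts: "distinct (concat ts)" "length ts \<le> a"
    "\<And>t. t \<in> set ts \<Longrightarrow> length t = 5 \<and> tw E t \<and> set t \<subseteq> V"
    "\<And>v. v \<in> V \<Longrightarrow> absc / 4 * real a - ln (real n) \<le> real (card {t\<in>set ts. absorbs v t})"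
    by blast
  have hits: "absc * \<mu> / 8 * real n \<le> real (card {t\<in>set ts. absorbs v t})" if "v \<in> V" for v
  proof -
    have "absc / 4 * (\<mu> * real n - 1) \<le> absc / 4 * real a" using a absc0 by (intro mult_left_mono) auto
    thus ?thesis using ts(4)[OF that] large(2) by linarith
  qed
  have ts_ne: "ts \<noteq> []"
  proof
    assume "ts = []"
    hence "absc * \<mu> / 8 * real n \<le> 0" using hits[of 1] n by simp
    moreover have "0 < absc * \<mu> / 8 * real n" using absc0 pos n0 by simp
    ultimately show False by linarith
  qed
  have "length (concat ts) = sum_list (map (\<lambda>_. 5) ts)"
    unfolding length_concat using ts(3) by (intro arg_cong[of _ _ sum_list] map_cong) auto
  hence cts: "card (set (concat ts)) \<le> 5 * a"
    unfolding distinct_card[OF ts(1)] using ts(2) by (simp add: sum_list_triv)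
  have tsV: "set (concat ts) \<subseteq> V" using ts(3) by auto
  have "real L * (real (card (set (concat ts))) + real L * real a + real L)
      \<le> real L * ((real L + 5) * (\<mu> * real n) + real L * (\<nu> * real n) + real L)"
  proof (intro mult_left_mono add_right_mono)
    have "real (card (set (concat ts))) + real L * real a \<le> real (5 * a) + real L * real a"
      using cts by (intro add_right_mono of_nat_mono)
    also have "\<dots> = (real L + 5) * real a" by (simp add: algebra_simps)
    also have "\<dots> \<le> (real L + 5) * (\<mu> * real n)" using a by (intro mult_left_mono) auto
    also have "\<dots> \<le> (real L + 5) * (\<mu> * real n) + real L * (\<nu> * real n)" using pos by simp
    finally show "real (card (set (concat ts))) + real L * real a \<le> (real L + 5) * (\<mu> * real n) + real L * (\<nu> * real n)" .
  qed auto
  hence "reservoir (V - set (concat ts)) a"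
    using large(3) tsV by (intro reservoir_complement[OF n]) linarith+
  hence "\<exists>bs. bs \<noteq> [] \<and> hd bs = hd ts \<and> set ts \<subseteq> set bs \<and> tw E (concat bs) \<and> distinct (concat bs) \<and>
     set (concat ts) \<subseteq> set (concat bs) \<and> set (concat bs) \<subseteq> set (concat ts) \<union> (V - set (concat ts)) \<and>
     card (set (concat bs) \<inter> (V - set (concat ts))) \<le> L * (length ts - 1)"
    using ts ts_ne tsV by (intro chain) auto
  then obtain as where as: "set ts \<subseteq> set as" "tw E (concat as)" "distinct (concat as)"
    "set (concat as) \<subseteq> set (concat ts) \<union> (V - set (concat ts))"
    "card (set (concat as) \<inter> (V - set (concat ts))) \<le> L * (length ts - 1)" by blast
  define A where "A = set (concat as)"
  have AV: "A \<subseteq> V" using as(4) tsV by (auto simp: A_def)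
  have finA: "finite A" by (simp add: A_def)
  have cA: "real (card A) \<le> (real L + 5) * (\<mu> * real n)"
  proof -
    have "A \<subseteq> set (concat ts) \<union> (A \<inter> (V - set (concat ts)))" using AV by blast
    hence "card A \<le> card (set (concat ts)) + card (A \<inter> (V - set (concat ts)))"
      using finA by (intro order.trans[OF card_mono card_Un_le]) auto
    also have "\<dots> \<le> 5 * a + L * a"
    proof (rule add_mono[OF cts])
      have "L * (length ts - 1) \<le> L * a" using ts(2) by (intro mult_left_mono) auto
      thus "card (A \<inter> (V - set (concat ts))) \<le> L * a" using as(5) unfolding A_def by linarith
    qed
    finally have "real (card A) \<le> real (5 * a + L * a)" by (rule of_nat_mono)
    also have "\<dots> = (real L + 5) * real a" by (simp add: algebra_simps)
    also have "\<dots> \<le> (real L + 5) * (\<mu> * real n)" using a by (intro mult_left_mono) auto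
    finally show ?thesis .
  qed
  obtain Y where Y: "Y \<subseteq> V - A" "card Y \<le> L * r" "reservoir Y q"
  proof -
    have "real L * (real (card A) + real L * real r + real L)
        \<le> real L * ((real L + 5) * (\<mu> * real n) + real L * (\<nu> * real n) + real L)"
      using cA r by (intro mult_left_mono add_mono) auto
    moreover have "real (L * q) < con / 4 * real r - ln (real n ^ 4)"
    proof -
      have "real (L * q) \<le> real L * (con * \<nu> / (16 * real L) * real n)"
        unfolding of_nat_mult by (intro mult_left_mono q(1)) auto
      also have "\<dots> = con * \<nu> / 16 * real n" using L0 by simp
      also have "\<dots> < con * \<nu> / 8 * real n" using con0 pos n0 by simp
      also have "\<dots> \<le> con / 4 * (\<nu> * real n - 1) - ln (real n ^ 4)" by (rule large(4))
      also have "\<dots> \<le> con / 4 * real r - ln (real n ^ 4)"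
        using r con0 by (intro diff_right_mono mult_left_mono) auto
      finally show ?thesis .
    qed
    ultimately show ?thesis using small_reservoir[OF n AV, of r q] large(3) that by (meson order.trans)
  qed
  have finY: "finite Y" using Y(1) finite_subset by blast
  have cY: "real (card Y) \<le> real L * \<nu> * real n"
  proof -
    have "real (card Y) \<le> real (L * r)" using Y(2) by (rule of_nat_mono)
    also have "\<dots> \<le> real L * (\<nu> * real n)" using r by (simp add: mult_left_mono)
    finally show ?thesis by simp
  qed
  define V0 where "V0 = V - A - Y"
  have V0: "V0 \<subseteq> V" by (auto simp: V0_def)
  hence finV0: "finite V0" by (rule finite_subset) simp
  have cV0: "real n - \<alpha> / 16 * real n \<le> real (card V0)"
  proof -
    have "V \<subseteq> V0 \<union> (A \<union> Y)" by (auto simp: V0_def)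
    hence "card V \<le> card (V0 \<union> (A \<union> Y))" using finA finY finV0 by (intro card_mono) auto
    also have "\<dots> \<le> card V0 + (card A + card Y)"
      using card_Un_le[of V0 "A \<union> Y"] card_Un_le[of A Y] by linarith
    finally have "real n \<le> real (card V0) + real (card A) + real (card Y)" by simp
    moreover have "((real L + 5) * \<mu> + real L * \<nu>) * real n \<le> \<alpha> / 16 * real n"
      using small(1) by (intro mult_right_mono) auto
    ultimately show ?thesis using cA cY by (simp add: algebra_simps)
  qed
  obtain Ps where Ps: "distinct (concat Ps)" "set (concat Ps) \<subseteq> V0" "\<And>xs. xs \<in> set Ps \<Longrightarrow> length xs = 3 * m \<and> tw E xs"
    "real (card (V0 - set (concat Ps))) < \<eta> * real n"
    using tiling[OF V0 cV0 n0(2) pos(3,4) \<epsilon> pos(5) large(6-8)] by blast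
  have cPs: "real (length Ps) \<le> real n / (3 * real m)"
  proof -
    have "length (concat Ps) = sum_list (map (\<lambda>_. 3 * m) Ps)"
      unfolding length_concat using Ps(3) by (intro arg_cong[of _ _ sum_list] map_cong) auto
    hence "length (concat Ps) = length Ps * (3 * m)" by (simp add: sum_list_triv)
    moreover have "card (set (concat Ps)) \<le> card V"
      using Ps(2) V0 by (intro card_mono) blast+
    hence "length (concat Ps) \<le> n" unfolding distinct_card[OF Ps(1)] by simp
    ultimately have "length Ps * (3 * m) \<le> n" by simp
    hence "real (length Ps * (3 * m)) \<le> real n" by (rule of_nat_mono)
    thus ?thesis using pos(5) by (simp add: field_simps)
  qed
  have "real (length (concat as # Ps)) \<le> real (Suc q)" using cPs large(5) q(2) by simp
  hence len: "length (concat as # Ps) \<le> Suc q" by linarith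
  have "\<exists>bs. set (concat as # Ps) \<subseteq> set bs \<and> cyc E (concat bs) \<and>
     set (concat (concat as # Ps)) \<subseteq> set (concat bs) \<and> set (concat bs) \<subseteq> V"
  proof (rule close_cycle[OF Y(3) finY _ len])
    have "5 \<le> length (concat as)"
    proof -
      obtain t where t: "t \<in> set ts" using ts_ne by (cases ts) auto
      hence "set t \<subseteq> set (concat as)" using as(1) by auto
      hence "card (set t) \<le> length (concat as)" using card_mono[of "set (concat as)" "set t"] distinct_card[OF as(3)] by simp
      moreover have "distinct t" using t ts(1) by (simp add: distinct_concat_iff)
      hence "card (set t) = 5" using ts(3)[OF t] by (simp add: distinct_card)
      ultimately show ?thesis by simp
    qed
    thus "4 \<le> length p \<and> tw E p" if "p \<in> set (concat as # Ps)" for p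
      using that Ps(3) as(2) m2 by (auto simp del: length_concat)
    have "A \<inter> V0 = {}" by (auto simp: V0_def)
    hence "set (concat as) \<inter> set (concat Ps) = {}" using Ps(2) by (auto simp: A_def)
    thus "distinct (concat (concat as # Ps))" using as(3) Ps(1) by auto
    have "set (concat (concat as # Ps)) = A \<union> set (concat Ps)" by (auto simp: A_def)
    moreover have "A \<subseteq> V - Y" using AV Y(1) by blast
    moreover have "set (concat Ps) \<subseteq> V - Y" using Ps(2) unfolding V0_def by blast
    ultimately show "set (concat (concat as # Ps)) \<subseteq> V - Y" by blast
  qed auto
  then obtain bs where bs: "set (concat as # Ps) \<subseteq> set bs" "cyc E (concat bs)"
     "set (concat (concat as # Ps)) \<subseteq> set (concat bs)" "set (concat bs) \<subseteq> V" by blast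
  have "concat as \<in> set bs" using bs(1) by simp
  then obtain b1 b2 where b12: "bs = b1 @ concat as # b2" by (meson in_set_conv_decomp)
  \<comment> \<open>The path carrying all absorbers entered the cycle as one block; it is split
    again so that the single absorbers become blocks.\<close>
  define cs where "cs = b1 @ as @ b2"
  have ccs: "concat cs = concat bs" by (simp add: cs_def b12)
  have left: "real (card (V - set (concat bs))) \<le> (\<eta> + real L * \<nu>) * real n"
  proof -
    have "set (concat (concat as # Ps)) = A \<union> set (concat Ps)" by (auto simp: A_def)
    hence "A \<subseteq> set (concat bs)" "set (concat Ps) \<subseteq> set (concat bs)" using bs(3) by blast+
    hence "V - set (concat bs) \<subseteq> (V0 - set (concat Ps)) \<union> Y" unfolding V0_def by blast
    hence "card (V - set (concat bs)) \<le> card (V0 - set (concat Ps)) + card Y"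
      using finY finV0 by (intro order.trans[OF card_mono card_Un_le]) auto
    thus ?thesis using Ps(4) cY by (simp add: algebra_simps)
  qed
  have "\<exists>xs. set xs = V \<and> cyc E xs"
  proof (rule absorb_all[of cs "set ts"])
    show "cyc E (concat cs)" "set (concat cs) \<subseteq> V" unfolding ccs by (rule bs)+
    show "set ts \<subseteq> set cs" using as(1) by (auto simp: cs_def)
    show "length g = 5" if "g \<in> set ts" for g using ts(3)[OF that] by simp
    show "(\<Sum>u\<in>V - set (concat cs). lev u) \<le> card {g \<in> set ts. absorbs v g}" if "v \<in> V" for v
    proof -
      have "real (\<Sum>u\<in>V - set (concat cs). lev u) \<le> (\<Sum>u\<in>V - set (concat cs). 2 / \<alpha> + 2)"
        unfolding of_nat_sum by (intro sum_mono lev_le) (rule n0)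
      also have "\<dots> = (2 / \<alpha> + 2) * real (card (V - set (concat bs)))" by (simp add: ccs)
      also have "\<dots> \<le> (2 / \<alpha> + 2) * ((\<eta> + real L * \<nu>) * real n)"
        using left \<alpha> by (intro mult_left_mono) auto
      also have "\<dots> \<le> absc * \<mu> / 8 * real n"
        using mult_right_mono[OF small(2), of "real n"] by (simp add: mult.assoc)
      also note hits[OF that]
      finally show ?thesis by (rule of_nat_le_iff[THEN iffD1])
    qed
  qed simp
  thus ?thesis using cyc_imp_tight_cycle unfolding tight_hamiltonian_cycle_def by blast
qed

end

section \<open>Choice of the constants\<close>

lemma eventually_ln_le_linear:
  fixes a b c :: real
  assumes "0 < c"
  shows "\<forall>\<^sub>F n in sequentially. a * ln (real n) + b \<le> c * real n"
  using assms by real_asymp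

theorem theorem1p4:
  fixes \<alpha> :: real
  assumes "\<alpha> > 0"
  shows "\<exists>n0::nat. \<forall>n\<ge>n0. \<forall>E :: nat set set.
           three_graph {1..n} E \<longrightarrow>
           (\<forall>i\<in>{1..n}. \<forall>j\<in>{1..n}. i \<noteq> j \<longrightarrow>
              real (pair_degree {1..n} E i j) \<ge> min (min (real i) (real j)) (real n / 2) + \<alpha> * real n) \<longrightarrow>
           tight_hamiltonian_cycle {1..n} E"
proof -
  define \<beta> where "\<beta> = min \<alpha> (1 / 4)"
  have \<beta>: "0 < \<beta>" "\<beta> \<le> 1 / 4" "\<beta> \<le> \<alpha>" using assms by (auto simp: \<beta>_def)
  define L where "L = real (con_len \<beta>)"
  define con where "con = con_dens \<beta>"
  define absc where "absc = abs_dens \<beta>"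
  have L: "0 < L" using con_len_pos by (simp add: L_def)
  have con: "0 < con" using con_dens_pos \<beta> by (simp add: con_def)
  have absc: "0 < absc" using abs_dens_pos \<beta> by (simp add: absc_def)
  define \<Lambda> where "\<Lambda> = 2 / \<beta> + 2"
  have \<Lambda>: "0 < \<Lambda>" using \<beta> by (simp add: \<Lambda>_def add_pos_pos)
  \<comment> \<open>The three bounds allow a disjoint selection of absorbers, leave density for
    connecting tuples, and keep \<open>V0\<close> large.\<close>
  define \<mu> where "\<mu> = min (absc / 100) (min (con / (8 * L * (L + 5))) (\<beta> / (32 * (L + 5))))"
  have \<mu>: "0 < \<mu>" "25 * \<mu> \<le> absc / 4" "L * ((L + 5) * \<mu>) \<le> con / 8" "(L + 5) * \<mu> \<le> \<beta> / 32"
  proof -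
    show "0 < \<mu>" using absc con L \<beta> by (simp add: \<mu>_def)
    have "\<mu> \<le> absc / 100" "\<mu> \<le> con / (8 * L * (L + 5))" "\<mu> \<le> \<beta> / (32 * (L + 5))"
      unfolding \<mu>_def by (rule min.cobounded1, (intro min.coboundedI2 min.cobounded1 min.cobounded2)+)
    moreover have "0 < 8 * L * (L + 5)" "0 < 32 * (L + 5)" using L by auto
    ultimately have "\<mu> \<le> absc / 100" "\<mu> * (8 * L * (L + 5)) \<le> con" "\<mu> * (32 * (L + 5)) \<le> \<beta>"
      using pos_le_divide_eq by blast+
    thus "25 * \<mu> \<le> absc / 4" "L * ((L + 5) * \<mu>) \<le> con / 8" "(L + 5) * \<mu> \<le> \<beta> / 32"
      by (simp_all add: algebra_simps)
  qed
  define \<nu> where "\<nu> = min (con / (8 * L * L)) (min (\<beta> / (32 * L)) (absc * \<mu> / (16 * \<Lambda> * L)))"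
  have \<nu>: "0 < \<nu>" "L * (L * \<nu>) \<le> con / 8" "L * \<nu> \<le> \<beta> / 32" "\<Lambda> * (L * \<nu>) \<le> absc * \<mu> / 16"
  proof -
    show "0 < \<nu>" using absc con L \<beta> \<mu> \<Lambda> by (simp add: \<nu>_def)
    have "\<nu> \<le> con / (8 * L * L)" "\<nu> \<le> \<beta> / (32 * L)" "\<nu> \<le> absc * \<mu> / (16 * \<Lambda> * L)"
      unfolding \<nu>_def by (rule min.cobounded1, (intro min.coboundedI2 min.cobounded1 min.cobounded2)+)
    thus "L * (L * \<nu>) \<le> con / 8" "L * \<nu> \<le> \<beta> / 32" "\<Lambda> * (L * \<nu>) \<le> absc * \<mu> / 16"
      using L \<Lambda> by (simp_all add: field_simps)
  qed
  define \<eta> where "\<eta> = min 1 (absc * \<mu> / (16 * \<Lambda>))"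
  have \<eta>: "0 < \<eta>" "\<eta> \<le> 1" "\<Lambda> * \<eta> \<le> absc * \<mu> / 16"
  proof -
    show "0 < \<eta>" "\<eta> \<le> 1" using absc \<mu> \<Lambda> by (simp_all add: \<eta>_def)
    have "\<eta> \<le> absc * \<mu> / (16 * \<Lambda>)" unfolding \<eta>_def by (rule min.cobounded2)
    thus "\<Lambda> * \<eta> \<le> absc * \<mu> / 16" using \<Lambda> by (simp add: field_simps)
  qed
  define \<epsilon> where "\<epsilon> = \<beta> * \<eta> / 96"
  have \<epsilon>: "0 < \<epsilon>" using \<beta> \<eta> by (simp add: \<epsilon>_def)
  define \<gamma> where "\<gamma> = con * \<nu> / (32 * L)"
  have \<gamma>: "0 < \<gamma>" using con \<nu> L by (simp add: \<gamma>_def)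
  \<comment> \<open>The reservoir can make about 2\<gamma>n connections: \<gamma>n for the n/(3m)
    paths, the rest for the additive 1. The summand 2 ensures at least the four vertices per path
    that \<open>close_cycle\<close> asks for.\<close>
  define m where "m = nat \<lceil>1 / \<gamma>\<rceil> + 2"
  have m: "0 < m" "2 \<le> m" "1 / (3 * real m) \<le> \<gamma>"
  proof -
    show "0 < m" "2 \<le> m" by (simp_all add: m_def)
    have "1 / \<gamma> \<le> real (nat \<lceil>1 / \<gamma>\<rceil>)" by linarith
    hence "1 / \<gamma> \<le> 3 * real m" by (simp add: m_def)
    thus "1 / (3 * real m) \<le> \<gamma>" using \<gamma> \<open>0 < m\<close> by (simp add: field_simps)
  qed
  have ev: "\<forall>\<^sub>F n in sequentially. 16 \<le> n \<and> 0 * ln (real n) + 25 \<le> absc / 4 * real n \<and>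
      1 * ln (real n) + absc / 4 \<le> absc * \<mu> / 8 * real n \<and>
      0 * ln (real n) + L * L \<le> con / 4 * real n \<and>
      4 * ln (real n) + con / 4 \<le> con * \<nu> / 8 * real n \<and>
      0 * ln (real n) + 1 \<le> \<gamma> * real n \<and>
      0 * ln (real n) + 40 \<le> (\<epsilon> * \<eta>) * real n \<and>
      0 * ln (real n) + (81 * real m + 1) \<le> (8 * (\<epsilon> / 32) ^ 3 * \<eta>) * real n \<and>
      (6 * real m / \<epsilon>) * ln (real n) + 3 * real m * ln 4 / \<epsilon> \<le> \<epsilon> * real n"
    using absc con \<mu>(1) \<nu>(1) \<gamma> \<epsilon> \<eta>(1)
    by (intro eventually_conj eventually_ln_le_linear eventually_ge_at_top mult_pos_pos divide_pos_pos zero_less_power) simp_all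
  then obtain n0 where n0: "\<And>n. n0 \<le> n \<Longrightarrow> 16 \<le> n \<and> 0 * ln (real n) + 25 \<le> absc / 4 * real n \<and>
      1 * ln (real n) + absc / 4 \<le> absc * \<mu> / 8 * real n \<and>
      0 * ln (real n) + L * L \<le> con / 4 * real n \<and>
      4 * ln (real n) + con / 4 \<le> con * \<nu> / 8 * real n \<and>
      0 * ln (real n) + 1 \<le> \<gamma> * real n \<and>
      0 * ln (real n) + 40 \<le> (\<epsilon> * \<eta>) * real n \<and>
      0 * ln (real n) + (81 * real m + 1) \<le> (8 * (\<epsilon> / 32) ^ 3 * \<eta>) * real n \<and>
      (6 * real m / \<epsilon>) * ln (real n) + 3 * real m * ln 4 / \<epsilon> \<le> \<epsilon> * real n"
    unfolding eventually_sequentially by blast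
  show ?thesis
  proof (intro exI[of _ n0] allI impI)
    fix n E
    assume "n0 \<le> n" and graph: "three_graph {1..n} E"
      and degree: "\<forall>i\<in>{1..n}. \<forall>j\<in>{1..n}. i \<noteq> j \<longrightarrow>
        min (min (real i) (real j)) (real n / 2) + \<alpha> * real n \<le> real (pair_degree {1..n} E i j)"
    have n: "16 \<le> n" "25 \<le> absc / 4 * real n" "ln (real n) + absc / 4 \<le> absc * \<mu> / 8 * real n"
      "L * L \<le> con / 4 * real n" "4 * ln (real n) + con / 4 \<le> con * \<nu> / 8 * real n" "1 \<le> \<gamma> * real n"
      "40 \<le> (\<epsilon> * \<eta>) * real n" "81 * real m + 1 \<le> (8 * (\<epsilon> / 32) ^ 3 * \<eta>) * real n"
      "(6 * real m / \<epsilon>) * ln (real n) + 3 * real m * ln 4 / \<epsilon> \<le> \<epsilon> * real n"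
      using n0[OF \<open>n0 \<le> n\<close>] by auto
    have npos: "0 < real n" using n(1) by simp
    have "\<beta> * real n \<le> \<alpha> * real n" using \<beta> by (intro mult_right_mono) auto
    have "min (min (real i) (real j)) (real n / 2) + \<beta> * real n \<le> real (pair_degree {1..n} E i j)"
      if "i \<in> {1..n}" "j \<in> {1..n}" "i \<noteq> j" for i j
      using degree[rule_format, OF that] \<open>\<beta> * real n \<le> \<alpha> * real n\<close> by linarith
    then interpret posa_graph n E \<beta>
      using graph \<beta> by unfold_locales
    show "tight_hamiltonian_cycle {1..n} E"
    proof (rule hamiltonian_of_constants[OF n(1) \<mu>(1) \<nu>(1) \<eta>(1,2) m(1,2) _ _ \<epsilon>_def],
        unfold L_def[symmetric] con_def[symmetric] absc_def[symmetric])
      show "(L + 5) * \<mu> + L * \<nu> \<le> \<beta> / 16" using \<mu>(4) \<nu>(3) by linarith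
      show "(2 / \<beta> + 2) * (\<eta> + L * \<nu>) \<le> absc * \<mu> / 8"
        using \<eta>(3) \<nu>(4) unfolding \<Lambda>_def[symmetric] distrib_left by linarith
      have "25 * \<mu> * real n \<le> absc / 4 * real n" using \<mu> by (intro mult_right_mono) auto
      thus "25 * (\<mu> * real n) + 25 \<le> absc / 2 * real n" using n(2) by simp
      show "absc * \<mu> / 8 * real n \<le> absc / 4 * (\<mu> * real n - 1) - ln (real n)"
        using n(3) by (simp add: algebra_simps)
      have "(L * ((L + 5) * \<mu>) + L * (L * \<nu>)) * real n \<le> con / 4 * real n"
        using \<mu>(3) \<nu>(2) by (intro mult_right_mono) auto
      thus "L * ((L + 5) * (\<mu> * real n) + L * (\<nu> * real n) + L) \<le> con / 2 * real n"
        using n(4) by (simp add: algebra_simps)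
      have "ln (real n ^ 4) = 4 * ln (real n)" using npos by (simp add: ln_realpow)
      thus "con * \<nu> / 8 * real n \<le> con / 4 * (\<nu> * real n - 1) - ln (real n ^ 4)"
        using n(5) by (simp add: algebra_simps)
      have "1 / (3 * real m) * real n \<le> \<gamma> * real n" using m(3) by (intro mult_right_mono) auto
      moreover have "con * \<nu> / (16 * L) * real n = 2 * (\<gamma> * real n)" by (simp add: \<gamma>_def)
      ultimately show "real n / (3 * real m) + 1 \<le> con * \<nu> / (16 * L) * real n" using n(6) by simp
      show "40 \<le> \<epsilon> * (\<eta> * real n)" using n(7) by (simp add: mult.assoc)
      show "27 * (3 * real m) < 8 * (\<epsilon> / 32) ^ 3 * (\<eta> * real n)" using n(8) by (simp add: mult.assoc)
      have "ln (4 * real n ^ 2) = ln 4 + 2 * ln (real n)" using npos by (simp add: ln_mult ln_realpow)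
      thus "3 * real m * ln (4 * real n ^ 2) / \<epsilon> \<le> \<epsilon> * real n"
        using n(9) by (simp add: algebra_simps add_divide_distrib)
    qed
  qed
qed

end
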